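(* Let $\mathcal C$ be a class of graphs with an excluded minor. Then the restriction of Maximum Independent Set to instances in $\mathcal C$ has a polynomial time approximation scheme (PTAS).
   Context: Graphs are finite, simple and undirected; $V^G$ and $E^G$ denote the vertex and edge sets of $G$. A minor of $G$ is a graph $H$ that can be obtained from a subgraph of $G$ by contracting edges; write $H\preceq G$. A class $\mathcal C$ of graphs has an excluded minor if there is a graph $H$ such that $H\not\preceq G$ for all $G\in\mathcal C$. Maximum Independent Set: instances are graphs $G$; solutions are independent sets, i.e. sets $X\subseteq V^G$ such that $vw\notin E^G$ for all $v,w\in X$; the value is $C(G,X):=|X|$; the goal is $\max$. Let $\mathrm{opt}(G)$ be the maximum value of a solution for $G$. For $\epsilon>0$, a solution $X$ for $G$ is $\epsilon$-close if $(1-\epsilon)\,\mathrm{opt}(G)\le C(G,X)\le(1+\epsilon)\,\mathrm{opt}(G)$. A PTAS for the restriction to instances in $\mathcal C$ is a uniform family $(A_\epsilon)_{\epsilon>0}$, where $A_\epsilon$ is a polynomial time algorithm that, given $G\in\mathcal C$, computes an $\epsilon$-close solution for $G$; uniformity means that there is an algorithm that, given $\epsilon$, computes $A_\epsilon$. *)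

theory Defs
  imports Main "HOL-Computational_Algebra.Polynomial" "HOL-Library.Log_Nat"
begin

section \<open>Finite simple graphs and minors\<close>

record 'a ugraph =
  verts :: "'a set"
  edges :: "'a set set"

definition simple_graph :: "'a ugraph \<Rightarrow> bool" where
  "simple_graph G \<longleftrightarrow> finite (verts G) \<and>
     (\<forall>e\<in>edges G. \<exists>u\<in>verts G. \<exists>v\<in>verts G. u \<noteq> v \<and> e = {u, v})"

definition subgraph :: "'a ugraph \<Rightarrow> 'a ugraph \<Rightarrow> bool" where
  "subgraph S G \<longleftrightarrow> simple_graph S \<and> verts S \<subseteq> verts G \<and> edges S \<subseteq> edges G"

text \<open>The vertex arising from the contracted edge is called \<open>u\<close> again; parallel edges are
  identified because edges form a set, and the only loop, coming from \<open>{u, v}\<close>, is dropped.\<close>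

definition contract :: "'a \<Rightarrow> 'a \<Rightarrow> 'a ugraph \<Rightarrow> 'a ugraph" where
  "contract u v G =
     \<lparr> verts = verts G - {v},
       edges = (\<lambda>e. (\<lambda>x. if x = v then u else x) ` e) ` (edges G - {{u, v}}) \<rparr>"

definition contraction_step :: "'a ugraph \<Rightarrow> 'a ugraph \<Rightarrow> bool" where
  "contraction_step G G' \<longleftrightarrow> (\<exists>u v. {u, v} \<in> edges G \<and> G' = contract u v G)"

definition graph_iso :: "'a ugraph \<Rightarrow> 'b ugraph \<Rightarrow> bool" where
  "graph_iso G H \<longleftrightarrow> (\<exists>f. bij_betw f (verts G) (verts H) \<and>
     (\<forall>u\<in>verts G. \<forall>v\<in>verts G. {u, v} \<in> edges G \<longleftrightarrow> {f u, f v} \<in> edges H))"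

definition is_minor :: "'b ugraph \<Rightarrow> 'a ugraph \<Rightarrow> bool" (infix "\<preceq>\<^sub>m" 50) where
  "H \<preceq>\<^sub>m G \<longleftrightarrow>
     (\<exists>S K. subgraph S G \<and> contraction_step\<^sup>*\<^sup>* S K \<and> graph_iso K H)"

definition has_excluded_minor :: "'a ugraph set \<Rightarrow> bool" where
  "has_excluded_minor C \<longleftrightarrow>
     (\<exists>H :: nat ugraph. simple_graph H \<and> (\<forall>G\<in>C. \<not> H \<preceq>\<^sub>m G))"


section \<open>Maximum Independent Set\<close>

definition independent_set :: "'a ugraph \<Rightarrow> 'a set \<Rightarrow> bool" where
  "independent_set G X \<longleftrightarrow> X \<subseteq> verts G \<and> (\<forall>v\<in>X. \<forall>w\<in>X. {v, w} \<notin> edges G)"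

definition mis_opt :: "'a ugraph \<Rightarrow> nat" where
  "mis_opt G = Max (card ` {X. independent_set G X})"

definition eps_close :: "rat \<Rightarrow> 'a ugraph \<Rightarrow> 'a set \<Rightarrow> bool" where
  "eps_close \<epsilon> G X \<longleftrightarrow> independent_set G X \<and>
     (1 - \<epsilon>) * of_nat (mis_opt G) \<le> of_nat (card X) \<and>
     of_nat (card X) \<le> (1 + \<epsilon>) * of_nat (mis_opt G)"


section \<open>Random access machines\<close>

text \<open>
  Algorithms are programs for the random access machine of Aho, Hopcroft and Ullman, with an input
  tape, an output tape and memory cells indexed by the natural numbers, but with structured control
  flow instead of jumps. Every instruction and every test costs one step. As the only arithmetic
  operations are addition and truncated subtraction, the bit length of the stored numbers exceeds
  that of the numbers occurring in the input and in the program by at most the number of steps, so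
  that polynomial time for this machine, measured in the bit length of the input, coincides with
  polynomial time for Turing machines.
\<close>

datatype prog =
    Skip
  | Const nat nat       \<comment> \<open>\<open>m[i] := k\<close>\<close>
  | Add nat nat nat     \<comment> \<open>\<open>m[i] := m[j] + m[k]\<close>\<close>
  | Sub nat nat nat     \<comment> \<open>\<open>m[i] := m[j] - m[k]\<close>, truncated at 0\<close>
  | Load nat nat        \<comment> \<open>\<open>m[i] := m[m[j]]\<close>\<close>
  | Store nat nat       \<comment> \<open>\<open>m[m[i]] := m[j]\<close>\<close>
  | Read nat            \<comment> \<open>next input number to \<open>m[i]\<close>, or 0 if the input is exhausted\<close>
  | Write nat           \<comment> \<open>append \<open>m[i]\<close> to the output\<close>
  | Seq prog prog
  | Cond nat prog prog  \<comment> \<open>the condition is \<open>m[i] \<noteq> 0\<close>, likewise for \<open>While\<close>\<close>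
  | While nat prog

record state =
  mem :: "nat \<Rightarrow> nat"
  inp :: "nat list"
  outp :: "nat list"

definition set_mem :: "nat \<Rightarrow> nat \<Rightarrow> state \<Rightarrow> state" where
  "set_mem i x s = s\<lparr>mem := (mem s)(i := x)\<rparr>"

text \<open>\<open>exec P s t s'\<close>: started in \<open>s\<close>, the program \<open>P\<close> halts in \<open>s'\<close> after exactly \<open>t\<close> steps.\<close>

inductive exec :: "prog \<Rightarrow> state \<Rightarrow> nat \<Rightarrow> state \<Rightarrow> bool" where
  "exec Skip s 1 s"
| "exec (Const i k) s 1 (set_mem i k s)"
| "exec (Add i j k) s 1 (set_mem i (mem s j + mem s k) s)"
| "exec (Sub i j k) s 1 (set_mem i (mem s j - mem s k) s)"
| "exec (Load i j) s 1 (set_mem i (mem s (mem s j)) s)"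
| "exec (Store i j) s 1 (set_mem (mem s i) (mem s j) s)"
| "exec (Read i) s 1
     (set_mem i (case inp s of [] \<Rightarrow> 0 | x # _ \<Rightarrow> x) (s\<lparr>inp := tl (inp s)\<rparr>))"
| "exec (Write i) s 1 (s\<lparr>outp := outp s @ [mem s i]\<rparr>)"
| "exec P s t s' \<Longrightarrow> exec Q s' t' s'' \<Longrightarrow> exec (Seq P Q) s (t + t') s''"
| "mem s i \<noteq> 0 \<Longrightarrow> exec P s t s' \<Longrightarrow> exec (Cond i P Q) s (t + 1) s'"
| "mem s i = 0 \<Longrightarrow> exec Q s t s' \<Longrightarrow> exec (Cond i P Q) s (t + 1) s'"
| "mem s i = 0 \<Longrightarrow> exec (While i P) s 1 s"
| "mem s i \<noteq> 0 \<Longrightarrow> exec P s t s' \<Longrightarrow> exec (While i P) s' t' s'' \<Longrightarrow>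
     exec (While i P) s (t + t' + 1) s''"

definition run :: "prog \<Rightarrow> nat list \<Rightarrow> nat \<Rightarrow> nat list \<Rightarrow> bool" where
  "run P w t out \<longleftrightarrow>
     (\<exists>s. exec P \<lparr>mem = (\<lambda>_. 0), inp = w, outp = []\<rparr> t s \<and> outp s = out)"

inductive_cases exec_elims:
  "exec Skip s t s'" "exec (Const i k) s t s'" "exec (Add i j k) s t s'"
  "exec (Sub i j k) s t s'" "exec (Load i j) s t s'" "exec (Store i j) s t s'"
  "exec (Read i) s t s'" "exec (Write i) s t s'"
inductive_cases exec_SeqE: "exec (Seq P Q) s t s'"
inductive_cases exec_CondE: "exec (Cond i P Q) s t s'"
inductive_cases exec_WhileE: "exec (While i P) s t s'"

lemma exec_deterministic: "exec P s t s' \<Longrightarrow> exec P s u s'' \<Longrightarrow> t = u \<and> s' = s''"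
proof (induction arbitrary: u s'' rule: exec.induct)
  case (9 P s t s' Q t' r)
  from 9(5) obtain t1 s1 t2 where "exec P s t1 s1" "exec Q s1 t2 s''" "u = t1 + t2"
    by (rule exec_SeqE)
  then show ?case using 9(3)[of t1 s1] 9(4)[of t2 s''] by simp
next
  case (10 s i P t s' Q)
  from 10(1,4) obtain t1 where "exec P s t1 s''" "u = t1 + 1"
    by (auto elim!: exec_CondE)
  then show ?case using 10(3)[of t1 s''] by simp
next
  case (11 s i Q t s' P)
  from 11(1,4) obtain t1 where "exec Q s t1 s''" "u = t1 + 1"
    by (auto elim!: exec_CondE)
  then show ?case using 11(3)[of t1 s''] by simp
next
  case (12 s i P)
  from 12(2) show ?case by (rule exec_WhileE) (use 12(1) in simp_all)
next
  case (13 s i P t s' t' r)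
  from 13(6) obtain t1 s1 t2
    where "exec P s t1 s1" "exec (While i P) s1 t2 s''" "u = t1 + t2 + 1"
    by (rule exec_WhileE) (use 13(1) in simp_all)
  then show ?case using 13(4)[of t1 s1] 13(5)[of t2 s''] by simp
qed (auto elim!: exec_elims)

text \<open>Numbers are written in binary, plus one symbol per number for separation.\<close>

definition bit_size :: "nat list \<Rightarrow> nat" where
  "bit_size w = (\<Sum>x\<leftarrow>w. floorlog 2 x + 1)"

text \<open>Programs as data: prefix notation, which is uniquely decodable.\<close>

primrec encode_prog :: "prog \<Rightarrow> nat list" where
  "encode_prog Skip = [0]"
| "encode_prog (Const i k) = [1, i, k]"
| "encode_prog (Add i j k) = [2, i, j, k]"
| "encode_prog (Sub i j k) = [3, i, j, k]"
| "encode_prog (Load i j) = [4, i, j]"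
| "encode_prog (Store i j) = [5, i, j]"
| "encode_prog (Read i) = [6, i]"
| "encode_prog (Write i) = [7, i]"
| "encode_prog (Seq P Q) = [8] @ encode_prog P @ encode_prog Q"
| "encode_prog (Cond i P Q) = [9, i] @ encode_prog P @ encode_prog Q"
| "encode_prog (While i P) = [10, i] @ encode_prog P"

lemma encode_prog_append_eq:
  "encode_prog P @ xs = encode_prog Q @ ys \<Longrightarrow> P = Q \<and> xs = ys"
proof (induction P arbitrary: Q xs ys)
  case (Seq P1 P2)
  from Seq.prems obtain Q1 Q2 where Q: "Q = Seq Q1 Q2" by (cases Q) simp_all
  with Seq.prems
  have "encode_prog P1 @ encode_prog P2 @ xs = encode_prog Q1 @ encode_prog Q2 @ ys" by simp
  from Seq.IH(1)[OF this] have "P1 = Q1" and "encode_prog P2 @ xs = encode_prog Q2 @ ys"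
    by simp_all
  with Q Seq.IH(2) show ?case by simp
next
  case (Cond i P1 P2)
  from Cond.prems obtain Q1 Q2 where Q: "Q = Cond i Q1 Q2" by (cases Q) simp_all
  with Cond.prems
  have "encode_prog P1 @ encode_prog P2 @ xs = encode_prog Q1 @ encode_prog Q2 @ ys" by simp
  from Cond.IH(1)[OF this] have "P1 = Q1" and "encode_prog P2 @ xs = encode_prog Q2 @ ys"
    by simp_all
  with Q Cond.IH(2) show ?case by simp
next
  case (While i P)
  from While.prems obtain Q1 where Q: "Q = While i Q1" by (cases Q) simp_all
  with While.prems have "encode_prog P @ xs = encode_prog Q1 @ ys" by simp
  with Q While.IH show ?case by simp
qed (case_tac Q; simp)+

lemma inj_encode_prog: "inj encode_prog"
  by (metis append_Nil2 encode_prog_append_eq injI)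

text \<open>Number of vertices, their names in increasing order, and the adjacency matrix row by row.\<close>

definition encode_graph :: "nat ugraph \<Rightarrow> nat list" where
  "encode_graph G = (let vs = sorted_list_of_set (verts G) in
     length vs # vs @ [if {u, v} \<in> edges G then 1 else 0. u \<leftarrow> vs, v \<leftarrow> vs])"

text \<open>Only meant for positive rationals; numerator and denominator are in lowest terms.\<close>

definition encode_rat :: "rat \<Rightarrow> nat list" where
  "encode_rat \<epsilon> = (case quotient_of \<epsilon> of (p, q) \<Rightarrow> [nat p, nat q])"


section \<open>Approximation schemes\<close>

definition polytime_on_graphs :: "prog \<Rightarrow> bool" where
  "polytime_on_graphs P \<longleftrightarrow> (\<exists>p :: nat poly. \<forall>G. simple_graph G \<longrightarrow>
     (\<exists>t out. run P (encode_graph G) t out \<and> t \<le> poly p (bit_size (encode_graph G))))"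

text \<open>A solution is output as a list of its elements.\<close>

definition computes_eps_close :: "prog \<Rightarrow> rat \<Rightarrow> nat ugraph \<Rightarrow> bool" where
  "computes_eps_close P \<epsilon> G \<longleftrightarrow>
     (\<exists>t out. run P (encode_graph G) t out \<and> eps_close \<epsilon> G (set out))"

text \<open>Uniformity has to be stated for rational \<open>\<epsilon>\<close>, since \<open>\<epsilon>\<close> is the input of an algorithm.
  The polynomial may depend on \<open>\<epsilon>\<close>, and there is no bound on the time to compute \<open>A \<epsilon>\<close>.\<close>

definition is_mis_PTAS :: "(rat \<Rightarrow> prog) \<Rightarrow> nat ugraph set \<Rightarrow> bool" where
  "is_mis_PTAS A C \<longleftrightarrow>
     (\<forall>\<epsilon>>0. polytime_on_graphs (A \<epsilon>) \<and> (\<forall>G\<in>C. computes_eps_close (A \<epsilon>) \<epsilon> G)) \<and>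
     (\<exists>U. \<forall>\<epsilon>>0. \<exists>t. run U (encode_rat \<epsilon>) t (encode_prog (A \<epsilon>)))"

definition mis_has_PTAS :: "nat ugraph set \<Rightarrow> bool" where
  "mis_has_PTAS C \<longleftrightarrow> (\<exists>A. is_mis_PTAS A C)"

end

theory Submission
  imports Defs
begin

text \<open>
  The scheme is local search. An independent set \<open>X\<close> is improved as long as some set \<open>T\<close> of at most
  \<open>k\<close> vertices makes \<open>T \<union> (X - N(T))\<close> larger than \<open>X\<close>; trying all \<open>k\<close>-tuples of vertices takes
  polynomial time for fixed \<open>k\<close>. For a local optimum \<open>X\<close> and another independent set \<open>R\<close>, every
  \<open>T \<subseteq> R - X\<close> with at most \<open>k\<close> elements has at least \<open>|T|\<close> neighbours in \<open>X - R\<close>. By the theorem of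
  Alon, Seymour and Thomas, a graph with \<open>n\<close> vertices and without \<open>K\<^sub>h\<close> minor is split into balanced
  parts by \<open>O(\<surd>n)\<close> vertices. Both parts inherit the neighbourhood condition if the vertices of \<open>R\<close> in the
  separator are dropped and those of \<open>X\<close> are put into both parts. Recursion down to parts with at most
  \<open>k\<close> vertices, where the condition bounds \<open>|R|\<close> by \<open>|X|\<close>, yields \<open>|R| - |X| \<le> n/(2q)\<close> as soon as
  \<open>k\<close> is a suitable multiple of \<open>q\<^sup>2\<close>. Hence \<open>X\<close> is within the factor \<open>1 - 1/q\<close> of the optimum, and
  as \<open>k\<close> is such a simple function of \<open>q\<close>, the program for \<open>\<epsilon> = p/q\<close> is easily computed from \<open>\<epsilon>\<close>.
\<close>

section \<open>Connected sets and separators\<close>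

text \<open>Why the loss stays below n/(2q): a separator Z costs one unit of |R| - |X| per vertex,
  since a vertex of R in Z is dropped and a vertex of X in Z is counted twice. As square roots of
  part sizes add up to more than the root of the whole, the total loss is dominated by the smallest
  parts, which have about k vertices, and is O(n / sqrt k) for fixed h. This forces k to grow like
  q^2. The target is n/(2q) and not n/q because n is at most |X| + |R|, hence at most 2|R| when X is
  smaller than R. Uniformity shapes the program. Trying all k-tuples by k nested loops would give
  code whose shape depends on k. Instead a base-n counter with k + 1 digits drives a single loop of
  n^(k+1) rounds: its lower k digits are the tuple to be tried, its top digit counts the passes
  through all tuples. Then k is mere data, and the programs for different accuracies differ in one
  constant. The fixed number of rounds also gives the time bound on every simple graph, inside or
  outside the class.\<close>

definition conn :: "('a \<Rightarrow> 'a \<Rightarrow> bool) \<Rightarrow> 'a set \<Rightarrow> bool" where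
  "conn E K \<longleftrightarrow> K \<noteq> {} \<and> (\<forall>A. A \<subseteq> K \<and> A \<noteq> {} \<and> A \<noteq> K \<longrightarrow> (\<exists>x\<in>A. \<exists>y\<in>K - A. E x y))"

text \<open>Connectedness is defined by cuts and not by paths so that it can be used through this
  rule: a property that changes on a connected set changes along an edge.\<close>

lemma conn_cross:
  assumes "conn E K" "x \<in> K" "P x" "y \<in> K" "\<not> P y"
  obtains a b where "a \<in> K" "P a" "b \<in> K" "\<not> P b" "E a b"
proof -
  have "{z\<in>K. P z} \<subseteq> K \<and> {z\<in>K. P z} \<noteq> {} \<and> {z\<in>K. P z} \<noteq> K"
    using assms by blast
  then have "\<exists>a\<in>{z\<in>K. P z}. \<exists>b\<in>K - {z\<in>K. P z}. E a b"
    using assms(1) unfolding conn_def by blast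
  with that show ?thesis by blast
qed

lemma conn_singleton: "conn E {v}"
  by (auto simp: conn_def)

lemma conn_attach:
  assumes sym: "symp E" and C: "conn E C"
    and F: "\<And>D. D \<in> F \<Longrightarrow> conn E D"
    and att: "\<And>D. D \<in> F \<Longrightarrow> \<exists>x\<in>C. \<exists>y\<in>D. E x y \<or> x = y"
  shows "conn E (C \<union> \<Union>F)"
  unfolding conn_def
proof (intro conjI allI impI)
  show "C \<union> \<Union>F \<noteq> {}" using C by (auto simp: conn_def)
  fix A assume A: "A \<subseteq> C \<union> \<Union>F \<and> A \<noteq> {} \<and> A \<noteq> C \<union> \<Union>F"
  let ?T = "\<exists>x\<in>A. \<exists>y\<in>C \<union> \<Union>F - A. E x y"
  have cross: ?T if D: "D \<subseteq> C \<union> \<Union>F" "conn E D" "x \<in> D" "x \<in> A" "y \<in> D" "y \<notin> A" for D x y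
  proof -
    obtain a b where "a \<in> D" "a \<in> A" "b \<in> D" "b \<notin> A" "E a b"
      by (rule conn_cross[of E D x "\<lambda>z. z \<in> A" y]) (use D in auto)
    then show ?thesis using \<open>D \<subseteq> C \<union> \<Union>F\<close> by blast
  qed
  show ?T
  proof (cases "C \<subseteq> A")
    case True
    then obtain y D where y: "y \<in> D" "D \<in> F" "y \<notin> A" using A by blast
    obtain u w where uw: "u \<in> C" "w \<in> D" "E u w \<or> u = w" using att[OF y(2)] by blast
    show ?thesis
    proof (cases "w \<in> A")
      case True
      then show ?thesis using cross[of D w y] y uw F by blast
    next
      case False
      then show ?thesis using uw y \<open>C \<subseteq> A\<close> by blast
    qed
  next
    case False
    then obtain c where c: "c \<in> C" "c \<notin> A" by blast
    show ?thesis
    proof (cases "C \<inter> A = {}")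
      case False
      then show ?thesis using cross[of C _ c] C c by blast
    next
      case True
      then obtain x D where x: "x \<in> D" "D \<in> F" "x \<in> A" using A by blast
      obtain u w where uw: "u \<in> C" "w \<in> D" "E u w \<or> u = w" using att[OF x(2)] by blast
      show ?thesis
      proof (cases "w \<in> A")
        case True
        then show ?thesis using uw \<open>C \<inter> A = {}\<close> sympD[OF sym] by blast
      next
        case False
        then show ?thesis using cross[of D x w] x uw F by blast
      qed
    qed
  qed
qed

lemma conn_insert:
  assumes "symp E" "conn E T" "v \<in> T" "E v w"
  shows "conn E (insert w T)"
proof -
  have "conn E (T \<union> \<Union>{{w}})"
    by (rule conn_attach[OF assms(1,2)]) (use assms(3,4) conn_singleton[of E w] in auto)
  then show ?thesis by simp
qed

section \<open>Connected components\<close>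

definition component :: "('a \<Rightarrow> 'a \<Rightarrow> bool) \<Rightarrow> 'a set \<Rightarrow> 'a \<Rightarrow> 'a set" where
  "component E W v = \<Union>{D. conn E D \<and> v \<in> D \<and> D \<subseteq> W}"

lemma component_subset: "component E W v \<subseteq> W"
  by (auto simp: component_def)

lemma component_maximal: "conn E D \<Longrightarrow> v \<in> D \<Longrightarrow> D \<subseteq> W \<Longrightarrow> D \<subseteq> component E W v"
  by (auto simp: component_def)

lemma component_self: "v \<in> W \<Longrightarrow> v \<in> component E W v"
  using component_maximal[OF conn_singleton, of v v W] by auto

lemma conn_component:
  assumes "symp E" "v \<in> W"
  shows "conn E (component E W v)"
proof -
  have "conn E ({v} \<union> component E W v)"
    unfolding component_def by (rule conn_attach[OF assms(1) conn_singleton]) auto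
  with component_self[OF assms(2)] show ?thesis by (metis insert_absorb insert_is_Un)
qed

lemma component_closed:
  assumes "symp E" "x \<in> component E W v" "y \<in> W" "E x y"
  shows "y \<in> component E W v"
proof -
  obtain D where D: "conn E D" "v \<in> D" "D \<subseteq> W" "x \<in> D"
    using assms(2) by (auto simp: component_def)
  have "insert y D \<subseteq> component E W v"
    by (rule component_maximal) (use D assms conn_insert in auto)
  then show ?thesis by simp
qed

text \<open>This is the lemma of Alon, Seymour and Thomas. Their layers of a breadth-first search in
  stacked copies of the graph are the level sets of the functions \<open>g i\<close>, where \<open>g i v\<close> is the least
  size of a connected set that contains \<open>v\<close> and meets \<open>A 0, \<dots>, A i\<close>. Along an edge,
  \<open>g i\<close> grows by at most one, so a connected set avoiding a level stays on one side of it.\<close>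

lemma small_hub_or_small_cut:
  assumes sym: "symp E" and fin: "finite K" and K: "conn E K"
    and A: "\<And>i. i < p \<Longrightarrow> A i \<subseteq> K \<and> A i \<noteq> {}" and r: "1 \<le> r"
  shows "(\<exists>T\<subseteq>K. conn E T \<and> card T \<le> r \<and> (\<forall>i<p. T \<inter> A i \<noteq> {})) \<or>
    (\<exists>Z\<subseteq>K. card Z * r \<le> p * card K \<and> (\<forall>D. conn E D \<and> D \<subseteq> K - Z \<longrightarrow> (\<exists>i<p. D \<inter> A i = {})))"
proof (cases "p = 0")
  case True
  obtain v where "v \<in> K" using K by (auto simp: conn_def)
  then show ?thesis using True r conn_singleton[of E v]
    by (intro disjI1 exI[of _ "{v}"]) auto
next
  case False
  define ok where "ok i v T \<longleftrightarrow> conn E T \<and> T \<subseteq> K \<and> v \<in> T \<and> (\<forall>j\<le>i. T \<inter> A j \<noteq> {})" for i v T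
  define g where "g i v = (LEAST m. \<exists>T. ok i v T \<and> card T = m)" for i v
  have g_le: "g i v \<le> card T" if "ok i v T" for i v T
    unfolding g_def by (rule Least_le) (use that in blast)
  have g_ex: "\<exists>T. ok i v T \<and> card T = g i v" if "v \<in> K" "i < p" for i v
  proof -
    have "ok i v K" unfolding ok_def using K that A by (metis Int_absorb1 order_le_less_trans order_refl)
    then have "\<exists>m T. ok i v T \<and> card T = m" by blast
    then show ?thesis unfolding g_def by (rule LeastI_ex)
  qed
  have step: "g i w \<le> g i v + 1" if vw: "v \<in> K" "w \<in> K" "E v w" "i < p" for i v w
  proof -
    obtain T where T: "ok i v T" "card T = g i v" using g_ex vw by blast
    have "ok i w (insert w T)" using T vw conn_insert[OF sym] by (auto simp: ok_def)
    moreover have "card (insert w T) \<le> card T + 1"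
      by (metis Suc_eq_plus1 card.infinite card_insert_if finite_insert le_SucI order_refl zero_le)
    ultimately show ?thesis using g_le T(2) by fastforce
  qed
  have g0: "g 0 v \<le> 1" if "v \<in> A 0" for v
  proof -
    have "ok 0 v {v}" using that A[of 0] False conn_singleton[of E v] by (auto simp: ok_def)
    from g_le[OF this] show ?thesis by simp
  qed
  have gS: "g (Suc i) v \<le> g i v" if v: "v \<in> A (Suc i)" "Suc i < p" for i v
  proof -
    have "v \<in> K" using A v by blast
    then obtain T where T: "ok i v T" "card T = g i v" using g_ex v(2) by (meson Suc_lessD)
    then have "ok (Suc i) v T" using v by (auto simp: ok_def le_Suc_eq)
    from g_le[OF this] T show ?thesis by simp
  qed
  show ?thesis
  proof (cases "\<exists>v\<in>K. g (p - 1) v \<le> r")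
    case True
    then obtain v T where "v \<in> K" "g (p - 1) v \<le> r" "ok (p - 1) v T" "card T = g (p - 1) v"
      using g_ex[of _ "p - 1"] False by (metis One_nat_def diff_Suc_less gr0I)
    then show ?thesis
      by (intro disjI1 exI[of _ T]) (auto simp: ok_def)
  next
    case no_hub: False
    define Z where "Z t = {v\<in>K. \<exists>i<p. g i v = t}" for t
    \<comment> \<open>Averaging: for fixed \<open>i\<close> the level sets are disjoint, so the
      \<open>r\<close> sets \<open>Z t\<close> have at most \<open>p * card K\<close> elements in
      total.\<close>
    have "\<exists>t\<in>{1..r}. card (Z t) * r \<le> p * card K"
    proof (rule ccontr)
      assume "\<not> ?thesis"
      then have *: "p * card K < card (Z t) * r" if "t \<in> {1..r}" for t
        using that by force
      have "(\<Sum>t=1..r. card (Z t)) \<le> (\<Sum>t=1..r. \<Sum>i<p. card {v\<in>K. g i v = t})"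
      proof (rule sum_mono)
        fix t
        have "Z t = (\<Union>i<p. {v\<in>K. g i v = t})" by (auto simp: Z_def)
        then show "card (Z t) \<le> (\<Sum>i<p. card {v\<in>K. g i v = t})"
          by (simp add: card_UN_le)
      qed
      also have "\<dots> = (\<Sum>i<p. \<Sum>t=1..r. card {v\<in>K. g i v = t})"
        by (rule sum.swap)
      also have "\<dots> \<le> (\<Sum>i<p. card K)"
      proof (rule sum_mono)
        fix i
        have "(\<Sum>t=1..r. card {v\<in>K. g i v = t}) = card (\<Union>t\<in>{1..r}. {v\<in>K. g i v = t})"
          by (rule card_UN_disjoint[symmetric]) (use fin in auto)
        also have "\<dots> \<le> card K" by (rule card_mono) (use fin in auto)
        finally show "(\<Sum>t=1..r. card {v\<in>K. g i v = t}) \<le> card K" .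
      qed
      also have "\<dots> = p * card K" by simp
      finally have "(\<Sum>t=1..r. card (Z t) * r) \<le> p * card K * r"
        by (simp flip: sum_distrib_right)
      moreover have "(\<Sum>t=1..r. p * card K) < (\<Sum>t=1..r. card (Z t) * r)"
        by (rule sum_strict_mono) (use * r in auto)
      ultimately show False by (simp add: mult.commute)
    qed
    then obtain t where t: "1 \<le> t" "t \<le> r" "card (Z t) * r \<le> p * card K" by auto
    have "\<exists>i<p. D \<inter> A i = {}" if D: "conn E D" "D \<subseteq> K - Z t" for D
    proof (rule ccontr)
      assume "\<not> ?thesis"
      then have meets: "D \<inter> A i \<noteq> {}" if "i < p" for i using that by blast
      have stay: "\<forall>v\<in>D. g i v < t" if v: "v \<in> D" "g i v \<le> t" and i: "i < p" for i v
      proof (rule ccontr)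
        have ne: "g i w \<noteq> t" if "w \<in> D" for w using that D i by (auto simp: Z_def)
        assume "\<not> ?thesis"
        then obtain w where "w \<in> D" "\<not> g i w < t" by blast
        then obtain a b where ab: "a \<in> D" "g i a < t" "b \<in> D" "\<not> g i b < t" "E a b"
          using conn_cross[OF D(1), of v "\<lambda>v. g i v < t" w] v ne
          by (metis le_neq_implies_less)
        then have "g i b \<le> g i a + 1" using step[of a b i] D i by blast
        then show False using ab ne[of b] by simp
      qed
      \<comment> \<open>At a vertex of \<open>D\<close> in \<open>A (Suc i)\<close> the value for
        \<open>Suc i\<close> is at most that for \<open>i\<close>, and \<open>stay\<close> spreads
        the bound over \<open>D\<close>. For \<open>i = p - 1\<close> this contradicts the absence
        of a hub.\<close>
      have "\<forall>v\<in>D. g i v < t" if "i < p" for i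
        using that
      proof (induction i)
        case 0
        obtain v where "v \<in> D" "v \<in> A 0" using meets 0 by blast
        with stay[of v 0] g0[of v] t 0 show ?case by fastforce
      next
        case (Suc i)
        obtain v where v: "v \<in> D" "v \<in> A (Suc i)" using meets Suc by blast
        with gS[of v i] Suc have "g (Suc i) v \<le> t" by fastforce
        with stay v Suc show ?case by blast
      qed
      then have "\<forall>v\<in>D. g (p - 1) v < t" using False by simp
      moreover obtain v where "v \<in> D" using D by (auto simp: conn_def)
      ultimately have "v \<in> K" "g (p - 1) v < t" using D by blast+
      with no_hub t show False by (meson less_imp_le order_trans)
    qed
    then show ?thesis using t by (intro disjI2 exI[of _ "Z t"]) (auto simp: Z_def)
  qed
qed

section \<open>Clique models and balanced separators\<close>

definition clique_model :: "('a \<Rightarrow> 'a \<Rightarrow> bool) \<Rightarrow> nat \<Rightarrow> 'a set \<Rightarrow> bool" where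
  "clique_model E h V \<longleftrightarrow> (\<exists>F. finite F \<and> card F = h \<and> (\<forall>C\<in>F. conn E C \<and> C \<subseteq> V) \<and>
     (\<forall>C\<in>F. \<forall>D\<in>F. C \<noteq> D \<longrightarrow> C \<inter> D = {} \<and> (\<exists>x\<in>C. \<exists>y\<in>D. E x y)))"

lemma clique_model_mono: "clique_model E h V \<Longrightarrow> V \<subseteq> W \<Longrightarrow> clique_model E h W"
  unfolding clique_model_def by (elim ex_forward conj_forward; (assumption | blast))


text \<open>If every small set leaves a connected set with more than half of the vertices, a clique
  model can be built around such a set \<open>K\<close>. As long as it has fewer than
  \<open>h\<close> branch sets, the at most \<open>(h - 1) * r\<close> vertices where they touch
  \<open>K\<close>, together with \<open>r\<close> further ones, do not separate; so
  \<open>K\<close> can be shrunk again and again, against minimality.\<close>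

theorem alon_seymour_thomas_separator:
  assumes sym: "symp E" and fin: "finite V" and no_model: "\<not> clique_model E h V"
    and r: "1 \<le> r" "h * card V \<le> r * r"
  obtains Z where "Z \<subseteq> V" "card Z \<le> h * r"
    "\<And>D. conn E D \<Longrightarrow> D \<subseteq> V - Z \<Longrightarrow> 2 * card D \<le> card V"
proof (rule ccontr)
  assume no_sep: "\<not> thesis"
  note sep = that
  have big: "\<exists>D. conn E D \<and> D \<subseteq> V - Z \<and> card V < 2 * card D"
    if Z: "Z \<subseteq> V" "card Z \<le> h * r" for Z
    using sep[OF Z] no_sep by (meson not_le)
  \<comment> \<open>The invariant: \<open>F\<close> is a clique model outside \<open>K\<close> that
    covers all outer neighbours of \<open>K\<close>, and each branch set is touched by
    \<open>K\<close> in at most \<open>r\<close> vertices.\<close>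
  define S where "S K F \<longleftrightarrow> conn E K \<and> K \<subseteq> V \<and> card V < 2 * card K \<and> finite F \<and>
     (\<forall>C\<in>F. conn E C \<and> C \<subseteq> V - K) \<and>
     (\<forall>C\<in>F. \<forall>D\<in>F. C \<noteq> D \<longrightarrow> C \<inter> D = {} \<and> (\<exists>x\<in>C. \<exists>y\<in>D. E x y)) \<and>
     (\<forall>x\<in>K. \<forall>y\<in>V - K. E x y \<longrightarrow> y \<in> \<Union>F) \<and>
     (\<forall>C\<in>F. card {y\<in>C. \<exists>x\<in>K. E x y} \<le> r)" for K F
  have SI: "S K F" if "conn E K" "K \<subseteq> V" "card V < 2 * card K" "finite F"
    "\<And>C. C \<in> F \<Longrightarrow> conn E C" "\<And>C. C \<in> F \<Longrightarrow> C \<subseteq> V - K"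
    "\<And>C D. C \<in> F \<Longrightarrow> D \<in> F \<Longrightarrow> C \<noteq> D \<Longrightarrow> C \<inter> D = {}"
    "\<And>C D. C \<in> F \<Longrightarrow> D \<in> F \<Longrightarrow> C \<noteq> D \<Longrightarrow> \<exists>x\<in>C. \<exists>y\<in>D. E x y"
    "\<And>x y. x \<in> K \<Longrightarrow> y \<in> V - K \<Longrightarrow> E x y \<Longrightarrow> y \<in> \<Union>F"
    "\<And>C. C \<in> F \<Longrightarrow> card {y\<in>C. \<exists>x\<in>K. E x y} \<le> r" for K F
    unfolding S_def by (intro conjI ballI impI that)
  have "\<exists>K F. S K F"
  proof -
    obtain D where D: "conn E D" "D \<subseteq> V" "card V < 2 * card D"
      using big[of "{}"] by auto
    then obtain d where d: "d \<in> D" by (auto simp: conn_def)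
    have sub: "D \<subseteq> component E V d" using component_maximal D d by metis
    then have "card D \<le> card (component E V d)"
      using component_subset fin by (metis card_mono finite_subset)
    then have "S (component E V d) {}"
      unfolding S_def using D d conn_component[OF sym, of d V] component_subset[of E V d]
        component_closed[OF sym, of _ V d] by auto
    then show ?thesis by blast
  qed
  then have "\<exists>K. \<exists>F. S K F" by blast
  then obtain K where "\<exists>F. S K F" and min: "\<And>K' F'. S K' F' \<Longrightarrow> card K \<le> card K'"
    using ex_has_least_nat[of "\<lambda>K. \<exists>F. S K F" _ card] by blast
  then obtain F0 where F0: "S K F0" by blast
  have K: "conn E K" "K \<subseteq> V" "card V < 2 * card K" using F0 by (simp_all add: S_def)
  have finK: "finite K" using K fin finite_subset by blast
  \<comment> \<open>Branch sets not adjacent to \<open>K\<close> are discarded, so that the sets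
    \<open>A i\<close> of neighbours in \<open>K\<close> are nonempty, as the hub lemma
    demands.\<close>
  define F where "F = {C\<in>F0. \<exists>y\<in>C. \<exists>x\<in>K. E x y}"
  have finF: "finite F" using F0 by (simp add: S_def F_def)
  have FF0: "C \<in> F0" if "C \<in> F" for C using that by (simp add: F_def)
  have F: "conn E C" "C \<subseteq> V - K" "card {y\<in>C. \<exists>x\<in>K. E x y} \<le> r" if "C \<in> F" for C
    using F0 FF0[OF that] unfolding S_def by simp_all
  have touch: "\<exists>y\<in>C. \<exists>x\<in>K. E x y" if "C \<in> F" for C
    using that by (simp add: F_def)
  have pair: "C \<inter> D = {}" "\<exists>x\<in>C. \<exists>y\<in>D. E x y" if "C \<in> F" "D \<in> F" "C \<noteq> D" for C D
    using F0 FF0 that unfolding S_def by simp_all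
  have N: "y \<in> \<Union>F" if "x \<in> K" "y \<in> V - K" "E x y" for x y
  proof -
    have "y \<in> \<Union>F0" using F0 that unfolding S_def by simp
    then show ?thesis using that by (auto simp: F_def)
  qed
  have "card F < h"
  proof (rule ccontr)
    assume "\<not> card F < h"
    then obtain F' where "F' \<subseteq> F" "card F' = h"
      using obtain_subset_with_card_n by (metis not_less)
    moreover have "finite F'" using \<open>F' \<subseteq> F\<close> finF finite_subset by blast
    ultimately have "clique_model E h V"
      unfolding clique_model_def
    proof (intro exI[of _ F'] conjI ballI impI)
      fix C D assume "C \<in> F'" "D \<in> F'" "C \<noteq> D"
      then show "C \<inter> D = {}" "\<exists>x\<in>C. \<exists>y\<in>D. E x y"
        using \<open>F' \<subseteq> F\<close> by (simp_all add: pair subsetD)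
    next
      fix C assume "C \<in> F'"
      then show "conn E C" "C \<subseteq> V"
        using \<open>F' \<subseteq> F\<close> F(1,2)[of C] by auto
    qed
    with no_model show False by blast
  qed
  define B where "B = (\<Union>C\<in>F. {y\<in>C. \<exists>x\<in>K. E x y})"
  have "card B \<le> (\<Sum>C\<in>F. r)"
    unfolding B_def by (rule order_trans[OF card_UN_le[OF finF] sum_mono]) (use F(3) in blast)
  then have "card B + r \<le> Suc (card F) * r" by simp
  also have "\<dots> \<le> h * r" using \<open>card F < h\<close> by (intro mult_right_mono) auto
  finally have cardB: "card B + r \<le> h * r" .
  have BV: "B \<subseteq> V - K" using F(2) by (auto simp: B_def)
  \<comment> \<open>\<open>B\<close> and \<open>Y\<close> together are too small to separate, so a
    large connected \<open>D\<close> avoids them. It meets \<open>K\<close>, both having more than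
    half of the vertices, and cannot leave \<open>K\<close>, whose outer neighbours all lie in
    \<open>B\<close>.\<close>
  have refine: "\<exists>K0. conn E K0 \<and> K0 \<subseteq> K - Y \<and> card V < 2 * card K0 \<and>
      (\<forall>x\<in>K0. \<forall>y\<in>K - Y. E x y \<longrightarrow> y \<in> K0)" if Y: "Y \<subseteq> K" "card Y \<le> r" for Y
  proof -
    have "card (B \<union> Y) \<le> h * r" using card_Un_le[of B Y] cardB Y by linarith
    then obtain D where D: "conn E D" "D \<subseteq> V - (B \<union> Y)" "card V < 2 * card D"
      using big[of "B \<union> Y"] BV Y K by blast
    have "D \<inter> K \<noteq> {}"
    proof
      assume *: "D \<inter> K = {}"
      have "card D + card K = card (D \<union> K)"
        by (rule card_Un_disjoint[symmetric]) (use * D K fin finite_subset in auto)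
      also have "\<dots> \<le> card V" by (rule card_mono) (use D K fin in auto)
      finally show False using D K by linarith
    qed
    then obtain d where d: "d \<in> D" "d \<in> K" by blast
    have "D \<subseteq> K"
    proof (rule ccontr)
      assume "\<not> D \<subseteq> K"
      then obtain e where "e \<in> D" "e \<notin> K" by blast
      then obtain a b where "a \<in> D" "a \<in> K" "b \<in> D" "b \<notin> K" "E a b"
        using d D(1) conn_cross[of E D d "\<lambda>x. x \<in> K" e] by blast
      moreover from this have "b \<in> B" using N[of a b] D(2) by (auto simp: B_def)
      ultimately show False using D by blast
    qed
    have "D \<subseteq> component E (K - Y) d" by (rule component_maximal) (use D d \<open>D \<subseteq> K\<close> in auto)
    then have "card D \<le> card (component E (K - Y) d)"
      using component_subset[of E "K - Y" d] finK by (meson card_mono finite_Diff finite_subset)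
    moreover have "d \<in> K - Y" using d D by blast
    ultimately show ?thesis using D component_subset[of E "K - Y" d] conn_component[OF sym, of d "K - Y"]
        component_closed[OF sym, of _ "K - Y" d]
      by (intro exI[of _ "component E (K - Y) d"]) auto
  qed
  obtain f where f: "bij_betw f {..<card F} F"
    using ex_bij_betw_nat_finite[OF finF] by (auto simp: lessThan_atLeast0)
  define A where "A i = {x\<in>K. \<exists>y\<in>f i. E x y}" for i
  have A: "A i \<subseteq> K \<and> A i \<noteq> {}" if "i < card F" for i
  proof -
    have "f i \<in> F" using f that by (auto simp: bij_betw_def)
    from touch[OF this] show ?thesis by (auto simp: A_def)
  qed
  have "(\<exists>T\<subseteq>K. conn E T \<and> card T \<le> r \<and> (\<forall>i<card F. T \<inter> A i \<noteq> {})) \<or>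
    (\<exists>Z\<subseteq>K. card Z * r \<le> card F * card K \<and>
      (\<forall>D. conn E D \<and> D \<subseteq> K - Z \<longrightarrow> (\<exists>i<card F. D \<inter> A i = {})))"
    using sym finK K(1) A r(1) by (rule small_hub_or_small_cut)
  then show False
  proof (elim disjE exE conjE)
    \<comment> \<open>A hub is adjacent to every branch set and becomes a new one; \<open>K\<close>
      shrinks to a large component of the rest.\<close>
    fix T assume hub: "T \<subseteq> K" "conn E T" "card T \<le> r" "\<forall>i<card F. T \<inter> A i \<noteq> {}"
    obtain K0 where K0: "conn E K0" "K0 \<subseteq> K - T" "card V < 2 * card K0"
      and cl: "\<And>x y. x \<in> K0 \<Longrightarrow> y \<in> K - T \<Longrightarrow> E x y \<Longrightarrow> y \<in> K0"
      using refine[OF hub(1,3)] by metis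
    have TC: "\<exists>x\<in>T. \<exists>y\<in>C. E x y" if C: "C \<in> F" for C
    proof -
      obtain i where "i < card F" "f i = C"
        using bij_betw_imp_surj_on[OF f] C by (metis imageE lessThan_iff)
      with hub(4) show ?thesis by (auto simp: A_def)
    qed
    have mono: "card {y\<in>C. \<exists>x\<in>K0. E x y} \<le> r" if "C \<in> F" for C
    proof -
      have "finite C" using F(2)[OF that] fin by (meson finite_Diff finite_subset)
      then have "card {y\<in>C. \<exists>x\<in>K0. E x y} \<le> card {y\<in>C. \<exists>x\<in>K. E x y}"
        by (intro card_mono) (use K0 in auto)
      with F(3)[OF that] show ?thesis by simp
    qed
    have finT: "finite T" using hub finK finite_subset by blast
    have cardT: "card {y\<in>T. \<exists>x\<in>K0. E x y} \<le> r"
      using card_mono[OF finT, of "{y\<in>T. \<exists>x\<in>K0. E x y}"] hub(3) by auto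
    have TD: "T \<inter> D = {} \<and> D \<inter> T = {}" "\<exists>x\<in>T. \<exists>y\<in>D. E x y" "\<exists>x\<in>D. \<exists>y\<in>T. E x y"
      if D: "D \<in> F" for D
    proof -
      show "T \<inter> D = {} \<and> D \<inter> T = {}" using F(2)[OF D] hub(1) by blast
      show "\<exists>x\<in>T. \<exists>y\<in>D. E x y" by (rule TC[OF D])
      then show "\<exists>x\<in>D. \<exists>y\<in>T. E x y" using sympD[OF sym] by blast
    qed
    have "S K0 (insert T F)"
    proof (rule SI)
      show "conn E K0" "card V < 2 * card K0" by fact+
      show "K0 \<subseteq> V" using K0(2) K(2) by blast
      show "finite (insert T F)" using finF by simp
    next
      fix C assume C: "C \<in> insert T F"
      then show "conn E C" using F(1) hub(2) by auto
      show "C \<subseteq> V - K0" using C F(2)[of C] hub(1) K(2) K0(2) by auto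
      show "card {y \<in> C. \<exists>x\<in>K0. E x y} \<le> r" using C mono cardT by auto
    next
      fix C D assume "C \<in> insert T F" "D \<in> insert T F" "C \<noteq> D"
      then show "C \<inter> D = {}" "\<exists>x\<in>C. \<exists>y\<in>D. E x y"
        using TD[of C] TD[of D] pair[of C D] by (auto simp del: disjoint_iff)
    next
      fix x y assume xy: "x \<in> K0" "y \<in> V - K0" "E x y"
      show "y \<in> \<Union>(insert T F)"
      proof (cases "y \<in> K")
        case True
        then show ?thesis using cl[of x y] xy by blast
      next
        case False
        then show ?thesis using N[of x y] xy K0(2) by blast
      qed
    qed
    from min[OF this] have "card K \<le> card K0" .
    moreover have "K0 \<subset> K" using K0 hub(1,2) by (auto simp: conn_def)
    ultimately show False using psubset_card_mono[OF finK, of K0] by simp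
  next
    \<comment> \<open>Without a hub, some \<open>C\<close> in \<open>F\<close> is not adjacent to
      the large component \<open>K0\<close> of \<open>K - Z\<close>; \<open>C\<close> then absorbs a
      part of \<open>K\<close>.\<close>
    fix Z assume cut: "Z \<subseteq> K" "card Z * r \<le> card F * card K"
      "\<forall>D. conn E D \<and> D \<subseteq> K - Z \<longrightarrow> (\<exists>i<card F. D \<inter> A i = {})"
    have "card F * card K \<le> h * card V"
      using \<open>card F < h\<close> card_mono[OF fin K(2)] by (simp add: mult_le_mono)
    then have "card Z * r \<le> r * r" using cut(2) r(2) by linarith
    then have "card Z \<le> r" using r(1) by simp
    then obtain K0 where K0: "conn E K0" "K0 \<subseteq> K - Z" "card V < 2 * card K0"
      and cl: "\<And>x y. x \<in> K0 \<Longrightarrow> y \<in> K - Z \<Longrightarrow> E x y \<Longrightarrow> y \<in> K0"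
      using refine[OF cut(1)] by metis
    obtain i where i: "i < card F" "K0 \<inter> A i = {}" using cut(3) K0(1,2) by blast
    define C where "C = f i"
    have C: "C \<in> F" using f i by (auto simp: bij_betw_def C_def)
    \<comment> \<open>Enlarging \<open>C\<close> by the parts of \<open>K\<close> beyond \<open>K0\<close> that it touches keeps its border to the
      remaining component inside \<open>Z\<close>, so \<open>Z\<close> itself need not be connected.\<close>
    define Ds where "Ds = {D. conn E D \<and> D \<subseteq> K - K0 \<and> D \<inter> A i \<noteq> {}}"
    define Q where "Q = \<Union>Ds"
    have QK: "Q \<subseteq> K - K0" by (auto simp: Q_def Ds_def)
    have AQ: "A i \<subseteq> Q"
    proof
      fix v assume v: "v \<in> A i"
      then have "{v} \<in> Ds" using A[OF i(1)] i(2) conn_singleton[of E v] by (auto simp: Ds_def)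
      then show "v \<in> Q" by (auto simp: Q_def)
    qed
    have Q_closed: "x \<in> Q" if x: "x \<in> K - K0" "E x y" "y \<in> Q" for x y
    proof -
      obtain D where D: "D \<in> Ds" "y \<in> D" using x by (auto simp: Q_def)
      have "insert x D \<in> Ds"
        using D x conn_insert[OF sym, of D y x] sympD[OF sym] by (auto simp: Ds_def)
      then show ?thesis by (auto simp: Q_def)
    qed
    have connCQ: "conn E (C \<union> Q)"
      unfolding Q_def
    proof (rule conn_attach[OF sym F(1)[OF C]])
      fix D assume D: "D \<in> Ds"
      then show "conn E D" by (simp add: Ds_def)
      obtain x where "x \<in> D" "x \<in> A i" using D by (auto simp: Ds_def)
      then show "\<exists>x\<in>C. \<exists>y\<in>D. E x y \<or> x = y"
        using sympD[OF sym] by (auto simp: A_def C_def)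
    qed
    have K0Q: "K0 \<subseteq> K - Q" using K0(2) QK by blast
    \<comment> \<open>A part of \<open>K - Q\<close> that misses \<open>K0\<close> and has no edge
      to the rest of \<open>K - Q\<close> has one to \<open>Q\<close>, by connectedness of
      \<open>K\<close>, and would itself have been absorbed into \<open>Q\<close>.\<close>
    have side: ?thesis if W: "W \<subseteq> K - Q" "W \<noteq> {}" "W \<inter> K0 = {}" "\<And>x y. x \<in> W \<Longrightarrow> y \<in> K - Q - W \<Longrightarrow> \<not> E x y" for W
    proof -
      obtain w k where w: "w \<in> W" and k: "k \<in> K0" using W K0(1) by (auto simp: conn_def)
      obtain a b where ab: "a \<in> K" "a \<in> W" "b \<in> K" "b \<notin> W" "E a b"
        by (rule conn_cross[OF K(1), of w "\<lambda>x. x \<in> W" k]) (use W w k K0Q in auto)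
      then have "b \<in> Q" using W by blast
      then have "a \<in> Q" using Q_closed[of a b] ab W by blast
      then show False using ab W by blast
    qed
    have "conn E (K - Q)"
      unfolding conn_def
    proof (intro conjI allI impI)
      show "K - Q \<noteq> {}" using K0(1) K0Q by (auto simp: conn_def)
      fix X assume X: "X \<subseteq> K - Q \<and> X \<noteq> {} \<and> X \<noteq> K - Q"
      show "\<exists>x\<in>X. \<exists>y\<in>K - Q - X. E x y"
      proof (rule ccontr)
        assume no: "\<not> ?thesis"
        consider "X \<inter> K0 = {}" | "K0 \<subseteq> X" | x y where "x \<in> K0" "x \<in> X" "y \<in> K0" "y \<notin> X" by blast
        then show False
        proof cases
          case 1 then show False using side[of X] X no by blast
        next
          case 2
          then show False using side[of "K - Q - X"] X no sympD[OF sym] by blast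
        next
          case 3
          obtain a b where "a \<in> K0" "a \<in> X" "b \<in> K0" "b \<notin> X" "E a b"
            by (rule conn_cross[OF K0(1), of x "\<lambda>x. x \<in> X" y]) (use 3 in auto)
          then show False using no K0Q by blast
        qed
      qed
    qed
    \<comment> \<open>Within \<open>K - Q\<close> only \<open>K0\<close> can touch \<open>Q\<close>,
      and \<open>K0\<close> has no neighbours in \<open>K - Z\<close> outside itself; so the border
      of \<open>C \<union> Q\<close> lies in \<open>Z\<close>.\<close>
    have front: "y \<in> Z" if "x \<in> K - Q" "y \<in> Q" "E x y" for x y
    proof -
      have "x \<in> K0" using Q_closed[of x y] that by blast
      then show ?thesis using cl[of x y] that QK by blast
    qed
    have noC: "y \<notin> C" if "x \<in> K - Q" "E x y" for x y
      using that AQ by (auto simp: A_def C_def)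
    let ?F = "insert (C \<union> Q) (F - {C})"
    have cardQ: "card {y \<in> C \<union> Q. \<exists>x\<in>K - Q. E x y} \<le> r"
    proof -
      have "{y \<in> C \<union> Q. \<exists>x\<in>K - Q. E x y} \<subseteq> Z" using front noC by blast
      then show ?thesis using \<open>card Z \<le> r\<close> cut(1) finK by (meson card_mono finite_subset order_trans)
    qed
    have mono: "card {y\<in>D. \<exists>x\<in>K - Q. E x y} \<le> r" if "D \<in> F" for D
    proof -
      have "finite D" using F(2)[OF that] fin by (meson finite_Diff finite_subset)
      then have "card {y\<in>D. \<exists>x\<in>K - Q. E x y} \<le> card {y\<in>D. \<exists>x\<in>K. E x y}"
        by (intro card_mono) auto
      with F(3)[OF that] show ?thesis by simp
    qed
    have pairQ: "(C \<union> Q) \<inter> D = {} \<and> D \<inter> (C \<union> Q) = {}"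
      "\<exists>x\<in>C \<union> Q. \<exists>y\<in>D. E x y" "\<exists>x\<in>D. \<exists>y\<in>C \<union> Q. E x y"
      if D: "D \<in> F" "D \<noteq> C" for D
    proof -
      show "(C \<union> Q) \<inter> D = {} \<and> D \<inter> (C \<union> Q) = {}"
        using pair(1)[OF D(1) C D(2)] F(2)[OF D(1)] QK by blast
      show "\<exists>x\<in>C \<union> Q. \<exists>y\<in>D. E x y" using pair(2)[OF C D(1)] D(2) by blast
      show "\<exists>x\<in>D. \<exists>y\<in>C \<union> Q. E x y" using pair(2)[OF D(1) C D(2)] by blast
    qed
    have "card K0 \<le> card (K - Q)" using K0Q finK by (simp add: card_mono)
    have "S (K - Q) ?F"
    proof (rule SI)
      show "conn E (K - Q)" by fact
      show "K - Q \<subseteq> V" using K(2) by blast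
      show "card V < 2 * card (K - Q)" using K0(3) \<open>card K0 \<le> card (K - Q)\<close> by linarith
      show "finite ?F" using finF by simp
    next
      fix D assume D: "D \<in> ?F"
      then show "conn E D" using F(1) connCQ by auto
      show "D \<subseteq> V - (K - Q)" using D F(2)[of D] F(2)[OF C] QK K(2) by auto
      show "card {y \<in> D. \<exists>x\<in>K - Q. E x y} \<le> r" using D mono cardQ by auto
    next
      fix D D' assume "D \<in> ?F" "D' \<in> ?F" "D \<noteq> D'"
      then consider "D = C \<union> Q" "D' \<in> F" "D' \<noteq> C" | "D' = C \<union> Q" "D \<in> F" "D \<noteq> C"
        | "D \<in> F" "D' \<in> F" "D \<noteq> D'" by blast
      then show "D \<inter> D' = {}" "\<exists>x\<in>D. \<exists>y\<in>D'. E x y"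
        by (cases, simp_all add: pairQ pair)+
    next
      fix x y assume xy: "x \<in> K - Q" "y \<in> V - (K - Q)" "E x y"
      show "y \<in> \<Union>?F"
      proof (cases "y \<in> K")
        case True
        then have "y \<in> Q" using xy by simp
        then show ?thesis by simp
      next
        case False
        then obtain D where "D \<in> F" "y \<in> D" using N[of x y] xy by auto
        then show ?thesis by (cases "D = C") auto
      qed
    qed
    from min[OF this] have "card K \<le> card (K - Q)" .
    moreover have "K - Q \<subset> K" using AQ A[OF i(1)] by blast
    ultimately show False using psubset_card_mono[OF finK, of "K - Q"] by simp
  qed
qed

section \<open>Local optima and separators\<close>

text \<open>Take \<open>U\<close> largest among the unions of components of \<open>V - Z\<close>
  with at most half of \<open>V\<close>. If it had less than a quarter, any further component, being
  itself a competitor, would have at most \<open>card U\<close> vertices and could be added. So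
  \<open>U\<close> would be all of \<open>V - Z\<close>, which has more than a quarter.\<close>

lemma balanced_union_of_components:
  assumes sym: "symp E" and fin: "finite V" and Z: "Z \<subseteq> V" "4 * card Z < 3 * card V"
    and small: "\<And>D. conn E D \<Longrightarrow> D \<subseteq> V - Z \<Longrightarrow> 2 * card D \<le> card V"
  obtains U where "U \<subseteq> V - Z" "card V \<le> 4 * card U" "2 * card U \<le> card V"
    "\<And>x y. x \<in> U \<Longrightarrow> y \<in> V - Z \<Longrightarrow> E x y \<Longrightarrow> y \<in> U"
proof -
  define P where "P U \<longleftrightarrow> U \<subseteq> V - Z \<and> 2 * card U \<le> card V \<and>
    (\<forall>x\<in>U. \<forall>y\<in>V - Z. E x y \<longrightarrow> y \<in> U)" for U
  have "P {}" by (simp add: P_def)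
  moreover have "\<forall>U. P U \<longrightarrow> card U < Suc (card V)"
    by (auto simp: P_def)
  ultimately obtain U where U: "P U" and max: "\<And>U'. P U' \<Longrightarrow> card U' \<le> card U"
    using ex_has_greatest_nat[of P "{}" card "Suc (card V)"] by blast
  have UV: "U \<subseteq> V - Z" and U2: "2 * card U \<le> card V"
    and cl: "\<And>x y. x \<in> U \<Longrightarrow> y \<in> V - Z \<Longrightarrow> E x y \<Longrightarrow> y \<in> U"
    using U by (auto simp: P_def)
  have finU: "finite U" using UV fin by (meson finite_Diff finite_subset)
  have "card V \<le> 4 * card U"
  proof (rule ccontr)
    assume less: "\<not> card V \<le> 4 * card U"
    have "V - Z \<subseteq> U"
    proof (rule subsetI, rule ccontr)
      fix v assume v: "v \<in> V - Z" "v \<notin> U"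
      let ?D = "component E (V - Z) v"
      have D: "?D \<subseteq> V - Z" "conn E ?D" "v \<in> ?D"
        using component_subset[of E "V - Z" v] conn_component[OF sym v(1)] component_self[of v "V - Z" E] v by blast+
      have finD: "finite ?D" using D fin by (meson finite_Diff finite_subset)
      have clD: "y \<in> ?D" if "x \<in> ?D" "y \<in> V - Z" "E x y" for x y
        using component_closed[OF sym] that by metis
      have "P ?D" unfolding P_def using D small[OF D(2,1)] clD by blast
      then have "card ?D \<le> card U" by (rule max)
      then have "2 * card (U \<union> ?D) \<le> card V" using card_Un_le[of U ?D] less by linarith
      then have "P (U \<union> ?D)" unfolding P_def using UV D(1) cl clD by blast
      then have "card (U \<union> ?D) \<le> card U" by (rule max)
      moreover have "card U < card (U \<union> ?D)"
        by (rule psubset_card_mono) (use finU finD D(3) v in auto)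
      ultimately show False by simp
    qed
    then have "card V - card Z \<le> card U"
      using card_mono[OF finU, of "V - Z"] card_Diff_subset[of Z V] Z(1) fin finite_subset by fastforce
    then show False using less Z(2) by linarith
  qed
  with UV U2 cl that show thesis by blast
qed

text \<open>Squaring leaves 79/80 + 1/2 \<ge> 36/25. The missing 1/80 is the share of a
  separator.\<close>

lemma sqrt_sum_ge:
  fixes a b n :: real
  assumes "0 \<le> n" "n / 4 \<le> a" "n / 4 \<le> b" "79 / 80 * n \<le> a + b"
  shows "6 / 5 * sqrt n \<le> sqrt a + sqrt b"
proof (rule power2_le_imp_le)
  have "n / 4 = sqrt (n / 4) * sqrt (n / 4)" using assms by simp
  also have "\<dots> \<le> sqrt a * sqrt b" using assms by (intro mult_mono) auto
  finally have "n / 4 \<le> sqrt a * sqrt b" .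
  moreover have "(sqrt a + sqrt b)\<^sup>2 = a + b + 2 * sqrt a * sqrt b"
    using assms by (simp add: power2_sum)
  moreover have "(6 / 5 * sqrt n)\<^sup>2 = 36 / 25 * n"
    using assms by (simp add: power_mult_distrib power_divide)
  ultimately show "(6 / 5 * sqrt n)\<^sup>2 \<le> (sqrt a + sqrt b)\<^sup>2"
    using assms by simp
qed (use assms in auto)

text \<open>The bound is nonnegative from \<open>n = k / 4\<close> on, and both parts of a balanced separation of more
  than \<open>k\<close> vertices still have \<open>k / 4\<close> vertices. The term \<open>- 20 c \<surd>n\<close> pays for the separators, since
  the sum of the square roots of the sizes of the parts exceeds \<open>\<surd>n\<close> by a constant factor.\<close>

lemma excess_of_hall_condition:
  fixes h q c k :: nat and E :: "'a \<Rightarrow> 'a \<Rightarrow> bool"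
  defines "c \<equiv> 2 * h\<^sup>2" and "k \<equiv> 6400 * c\<^sup>2 * q\<^sup>2"
  assumes sym: "symp E" and q: "1 \<le> q" and h: "1 \<le> h"
  shows "finite S \<Longrightarrow> finite R \<Longrightarrow> S \<inter> R = {} \<Longrightarrow> \<not> clique_model E h (S \<union> R) \<Longrightarrow>
    (\<And>T. T \<subseteq> R \<Longrightarrow> card T \<le> k \<Longrightarrow> card T \<le> card {s\<in>S. \<exists>t\<in>T. E t s}) \<Longrightarrow>
    1600 * c\<^sup>2 * q\<^sup>2 \<le> card (S \<union> R) \<Longrightarrow>
    real (card R) - real (card S)
      \<le> real (card (S \<union> R)) / (2 * q) - 20 * c * sqrt (real (card (S \<union> R)))"
proof (induction "card (S \<union> R)" arbitrary: S R rule: less_induct)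
  case less
  note fin = less.prems(1,2) and disj = less.prems(3) and hall = less.prems(5)
  define n where "n = card (S \<union> R)"
  have n: "n = card S + card R" unfolding n_def using fin disj by (rule card_Un_disjoint)
  have c: "1 \<le> c" using h by (simp add: c_def)
  have sqrt_n: "40 * real c * q \<le> sqrt n"
  proof (rule real_le_rsqrt)
    have "(40 * real c * q)\<^sup>2 = real (1600 * c\<^sup>2 * q\<^sup>2)" by (simp add: power_mult_distrib)
    also have "\<dots> \<le> real n" using less.prems(6) by (simp only: n_def of_nat_le_iff)
    finally show "(40 * real c * q)\<^sup>2 \<le> real n" .
  qed
  show ?case
  proof (cases "n \<le> k")
    case True
    then have "card R \<le> card {s\<in>S. \<exists>t\<in>R. E t s}" using hall[of R] n by simp
    also have "\<dots> \<le> card S" using fin by (intro card_mono) auto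
    finally have "real (card R) - real (card S) \<le> 0" by simp
    also have "0 \<le> sqrt n * (sqrt n - 40 * c * q) / (2 * q)" using sqrt_n by simp
    also have "\<dots> = n / (2 * q) - 20 * c * sqrt n" using q by (simp add: field_simps)
    finally show ?thesis by (simp add: n_def)
  next
    case False
    then have nk: "k < n" by simp
    \<comment> \<open>This makes the bound \<open>c * sqrt n\<close> on the separator at most
      \<open>n / 80\<close>; the constant 6400 in \<open>k\<close> is the square of this 80.\<close>
    have sqrt_n80: "80 * real c * q \<le> sqrt n"
    proof (rule real_le_rsqrt)
      have "(80 * real c * q)\<^sup>2 = real k" by (simp add: k_def power_mult_distrib)
      also have "\<dots> \<le> real n" using nk by simp
      finally show "(80 * real c * q)\<^sup>2 \<le> real n" .
    qed
    have "80 * real c * 1 \<le> 80 * real c * q" using q by (intro mult_left_mono) auto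
    with sqrt_n80 have c80: "80 * real c \<le> sqrt n" by simp
    have "80 * (c * sqrt n) \<le> sqrt n * sqrt n" using c80 mult_right_mono[OF c80, of "sqrt n"] by simp
    then have cn: "80 * (c * sqrt n) \<le> n" by simp
    have n1: "1 \<le> n" using nk by simp
    \<comment> \<open>The least admissible \<open>r\<close>. Rounding up at most doubles
      \<open>sqrt (h * n) \<ge> 1\<close>, so \<open>h * r \<le> 2 * h\<^sup>2 * sqrt n\<close>;
      this is the origin of \<open>c\<close>.\<close>
    define r where "r = nat \<lceil>sqrt (h * n)\<rceil>"
    have r_ge: "sqrt (h * n) \<le> r" unfolding r_def by (simp add: real_nat_ceiling_ge)
    have hn: "1 \<le> sqrt (h * n)" using h n1 by (simp add: Suc_le_eq flip: of_nat_mult)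
    have r_le: "r \<le> 2 * sqrt (h * n)" unfolding r_def using hn by linarith
    have "real (h * n) \<le> real (r * r)"
      using mult_mono[OF r_ge r_ge] hn by simp
    then have rr: "h * n \<le> r * r" by (simp only: of_nat_le_iff)
    have r1: "1 \<le> r" using r_ge hn by linarith
    obtain Z where Z: "Z \<subseteq> S \<union> R" "card Z \<le> h * r"
      and small: "\<And>D. conn E D \<Longrightarrow> D \<subseteq> S \<union> R - Z \<Longrightarrow> 2 * card D \<le> n"
      using alon_seymour_thomas_separator[OF sym _ less.prems(4) r1, of thesis] fin rr
      unfolding n_def by blast
    have "real (card Z) \<le> real (h * r)" using Z(2) by (simp only: of_nat_le_iff)
    also have "\<dots> \<le> h * (2 * sqrt (h * n))" using r_le by (simp add: mult_left_mono)
    also have "\<dots> \<le> h * (2 * (h * sqrt n))"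
      using h by (intro mult_left_mono) (auto simp: real_sqrt_mult real_le_lsqrt power2_eq_square intro!: mult_right_mono)
    also have "\<dots> = c * sqrt n" by (simp add: c_def power2_eq_square)
    finally have z: "card Z \<le> c * sqrt n" .
    then have z80: "80 * card Z \<le> n" using cn by linarith
    have finV: "finite (S \<union> R)" using fin by simp
    obtain U where U: "U \<subseteq> S \<union> R - Z" "n \<le> 4 * card U" "2 * card U \<le> n"
      and cl: "\<And>x y. x \<in> U \<Longrightarrow> y \<in> S \<union> R - Z \<Longrightarrow> E x y \<Longrightarrow> y \<in> U"
    proof (rule balanced_union_of_components[OF sym finV Z(1), folded n_def])
      show "4 * card Z < 3 * n" using z80 n1 by linarith
    qed (use small in auto)
    define W where "W = S \<union> R - Z - U"
    define x where "x A B = card (A \<inter> B)" for A B :: "'a set"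
    have split: "card A = x A U + x A Z + x A W" if A: "A \<subseteq> S \<union> R" for A
    proof -
      have finA: "finite A" using A finV finite_subset by blast
      have "A = (A \<inter> U) \<union> ((A \<inter> Z) \<union> (A \<inter> W))" using A by (auto simp: W_def)
      also have "card \<dots> = card (A \<inter> U) + card ((A \<inter> Z) \<union> (A \<inter> W))"
        by (rule card_Un_disjoint) (use finA U(1) in \<open>auto simp: W_def\<close>)
      also have "card ((A \<inter> Z) \<union> (A \<inter> W)) = card (A \<inter> Z) + card (A \<inter> W)"
        by (rule card_Un_disjoint) (use finA in \<open>auto simp: W_def\<close>)
      finally show ?thesis by (simp add: x_def)
    qed
    have part: "card B = x S B + x R B" if B: "B \<subseteq> S \<union> R" for B
    proof -
      have "B = (S \<inter> B) \<union> (R \<inter> B)" using B by blast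
      also have "card \<dots> = x S B + x R B"
        unfolding x_def by (rule card_Un_disjoint) (use fin disj in auto)
      finally show ?thesis .
    qed
    have cards: "card S = x S U + x S Z + x S W" "card R = x R U + x R Z + x R W"
      "card U = x S U + x R U" "card Z = x S Z + x R Z" "card W = x S W + x R W"
      using split[of S] split[of R] part[of U] part[of Z] part[of W] Z(1) U(1)
      by (auto simp: W_def)
    \<comment> \<open>A vertex of \<open>R \<inter> Y\<close> has all its neighbours in
      \<open>S\<close> within \<open>Y \<union> Z\<close>, so keeping \<open>S \<inter> Z\<close> in
      both parts preserves the neighbourhood condition.\<close>
    have IH: "real (card R') - real (card S')
        \<le> real (card (S' \<union> R')) / (2 * q) - 20 * c * sqrt (real (card (S' \<union> R')))"
      if SR: "S' = S \<inter> (Y \<union> Z)" "R' = R \<inter> Y" "Y \<subseteq> S \<union> R - Z"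
        and big: "n \<le> 4 * card (S' \<union> R')" "card (S' \<union> R') < n"
        and clY: "\<And>t s. t \<in> Y \<Longrightarrow> s \<in> S \<union> R - Z \<Longrightarrow> E t s \<Longrightarrow> s \<in> Y" for Y S' R'
    proof (rule less.hyps)
      show "card (S' \<union> R') < card (S \<union> R)" using big by (simp add: n_def)
      show "finite S'" "finite R'" "S' \<inter> R' = {}" using fin disj SR by auto
      show "\<not> clique_model E h (S' \<union> R')"
        using less.prems(4) clique_model_mono[of E h "S' \<union> R'" "S \<union> R"] SR by blast
      show "1600 * c\<^sup>2 * q\<^sup>2 \<le> card (S' \<union> R')"
        using nk big by (simp add: k_def)
      fix T assume T: "T \<subseteq> R'" "card T \<le> k"
      have "{s\<in>S. \<exists>t\<in>T. E t s} = {s\<in>S'. \<exists>t\<in>T. E t s}"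
        using T(1) SR clY by blast
      then show "card T \<le> card {s\<in>S'. \<exists>t\<in>T. E t s}"
        using hall[of T] T SR by auto
    qed
    have clW: "s \<in> W" if "t \<in> W" "s \<in> S \<union> R - Z" "E t s" for t s
    proof (rule ccontr)
      assume "s \<notin> W"
      then have "s \<in> U" using that unfolding W_def by blast
      then have "t \<in> U" using cl[of s t] that sympD[OF sym] unfolding W_def by blast
      then show False using that by (simp add: W_def)
    qed
    define a where "a = card (S \<inter> (U \<union> Z) \<union> R \<inter> U)"
    define b where "b = card (S \<inter> (W \<union> Z) \<union> R \<inter> W)"
    have card_side: "card (S \<inter> (Y \<union> Z)) = x S Y + x S Z"
      "card (S \<inter> (Y \<union> Z) \<union> R \<inter> Y) = x S Y + x S Z + x R Y"
      if Y: "Y \<inter> Z = {}" for Y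
    proof -
      have "card (S \<inter> (Y \<union> Z)) = card (S \<inter> Y \<union> S \<inter> Z)" by (simp add: Int_Un_distrib)
      also have "\<dots> = x S Y + x S Z"
        unfolding x_def by (rule card_Un_disjoint) (use fin Y in auto)
      finally show 1: "card (S \<inter> (Y \<union> Z)) = x S Y + x S Z" .
      have "card (S \<inter> (Y \<union> Z) \<union> R \<inter> Y) = card (S \<inter> (Y \<union> Z)) + card (R \<inter> Y)"
        by (rule card_Un_disjoint) (use fin disj in auto)
      with 1 show "card (S \<inter> (Y \<union> Z) \<union> R \<inter> Y) = x S Y + x S Z + x R Y"
        by (simp add: x_def)
    qed
    have UZ: "U \<inter> Z = {}" "W \<inter> Z = {}" using U(1) by (auto simp: W_def)
    have a: "a = x S U + x S Z + x R U" and b: "b = x S W + x S Z + x R W"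
      unfolding a_def b_def by (rule card_side(2)[OF UZ(1)], rule card_side(2)[OF UZ(2)])
    have ab: "n \<le> 4 * a" "n \<le> 4 * b" "a < n" "b < n" "a + b \<le> n + card Z" "n \<le> a + b + card Z"
      using a b cards n U(2,3) z80 n1 by linarith+
    have ea: "real (x R U) - real (x S U + x S Z) \<le> a / (2 * q) - 20 * c * sqrt a"
      using IH[OF refl refl U(1), folded a_def, OF ab(1,3) cl] card_side(1)[OF UZ(1)]
      by (simp add: x_def)
    have WV: "W \<subseteq> S \<union> R - Z" by (auto simp: W_def)
    have eb: "real (x R W) - real (x S W + x S Z) \<le> b / (2 * q) - 20 * c * sqrt b"
      using IH[OF refl refl WV, folded b_def, OF ab(2,4) clW] card_side(1)[OF UZ(2)]
      by (simp add: x_def)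
    \<comment> \<open>Dropping \<open>R \<inter> Z\<close> and counting \<open>S \<inter> Z\<close>
      twice changes the difference by exactly \<open>card Z\<close>.\<close>
    have "real (card R) - real (card S)
        \<le> (real (x R U) - real (x S U + x S Z)) + (real (x R W) - real (x S W + x S Z)) + card Z"
      using cards by simp
    also have "\<dots> \<le> (real a + real b) / (2 * q) - 20 * c * (sqrt a + sqrt b) + card Z"
      using ea eb by (simp add: add_divide_distrib algebra_simps)
    also have "\<dots> \<le> (real n + card Z) / (2 * q) - 20 * c * (6 / 5 * sqrt n) + card Z"
    proof (intro add_right_mono diff_mono divide_right_mono mult_left_mono)
      show "6 / 5 * sqrt (real n) \<le> sqrt (real a) + sqrt (real b)"
        by (rule sqrt_sum_ge) (use ab z80 in linarith)+
      show "real a + real b \<le> real n + card Z" using ab(5) by linarith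
    qed auto
    also have "\<dots> \<le> real n / (2 * q) + card Z - 20 * c * (6 / 5 * sqrt n) + card Z"
    proof -
      have "real (card Z) / (2 * q) \<le> real (card Z) / 1"
        using q by (intro divide_left_mono) auto
      then show ?thesis by (simp add: add_divide_distrib)
    qed
    \<comment> \<open>The factor 6/5 gains \<open>4 * c * sqrt n\<close>, enough for
      \<open>2 * card Z\<close>: one \<open>card Z\<close> from the difference, the other as a bound
      for \<open>card Z / (2 * q)\<close>.\<close>
    also have "\<dots> \<le> real n / (2 * q) - 20 * c * sqrt n"
      using z by (simp add: algebra_simps)
    finally show ?thesis by (simp add: n_def)
  qed
qed

corollary locally_optimal_is_near_optimal:
  fixes h q :: nat and E :: "'a \<Rightarrow> 'a \<Rightarrow> bool"
  assumes sym: "symp E" and q: "1 \<le> q" and fin: "finite V" and XV: "X \<subseteq> V" and RV: "R \<subseteq> V"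
    and no_model: "\<not> clique_model E h V"
    and R: "\<And>u v. u \<in> R \<Longrightarrow> v \<in> R \<Longrightarrow> \<not> E u v"
    and opt: "\<And>T. T \<subseteq> V \<Longrightarrow> T \<noteq> {} \<Longrightarrow> card T \<le> 25600 * h ^ 4 * q\<^sup>2 \<Longrightarrow>
      (\<forall>u\<in>T. \<forall>v\<in>T. \<not> E u v) \<Longrightarrow> card (T \<union> (X - {v. \<exists>u\<in>T. E u v})) \<le> card X"
  shows "(1 - 1 / real q) * card R \<le> card X"
proof (cases "card R \<le> card X")
  case True
  have "(1 - 1 / real q) * card R \<le> 1 * real (card R)" by (rule mult_right_mono) auto
  then show ?thesis using True by simp
next
  case False
  have h: "1 \<le> h"
  proof (rule ccontr)
    assume "\<not> 1 \<le> h"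
    then have "clique_model E h V" unfolding clique_model_def by (intro exI[of _ "{}"]) auto
    with no_model show False by blast
  qed
  have finXR: "finite X" "finite R" using XV RV fin finite_subset by blast+
  define X' where "X' = X - R"
  define R' where "R' = R - X"
  define k where "k = 6400 * (2 * h\<^sup>2)\<^sup>2 * q\<^sup>2"
  have k: "k = 25600 * h ^ 4 * q\<^sup>2" by (simp add: k_def power_mult_distrib flip: power_mult)
  have hall: "card T \<le> card {s\<in>X'. \<exists>t\<in>T. E t s}" if T: "T \<subseteq> R'" "card T \<le> k" for T
  proof (cases "T = {}")
    case False
    let ?N = "{v. \<exists>u\<in>T. E u v}"
    have finT: "finite T" using T(1) finXR by (auto simp: R'_def intro: finite_subset)
    have TR: "T \<subseteq> R" using T(1) by (auto simp: R'_def)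
    have "card (T \<union> (X - ?N)) \<le> card X"
    proof (rule opt)
      show "T \<subseteq> V" "\<forall>u\<in>T. \<forall>v\<in>T. \<not> E u v" using TR RV R by blast+
    qed (use T False k in auto)
    moreover have "card (T \<union> (X - ?N)) = card T + card (X - ?N)"
      by (rule card_Un_disjoint) (use finT finXR T in \<open>auto simp: R'_def\<close>)
    moreover have "card X = card (X \<inter> ?N) + card (X - ?N)"
      using finXR(1) by (rule card_Int_Diff)
    \<comment> \<open>As \<open>R\<close> is independent, the neighbours of \<open>T\<close> lie
      outside \<open>R\<close>; so all vertices lost in the exchange are counted in
      \<open>X'\<close>.\<close>
    moreover have "X \<inter> ?N = {s\<in>X'. \<exists>t\<in>T. E t s}"
    proof -
      have "s \<notin> R" if "t \<in> T" "E t s" for s t using R[of t s] TR that by blast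
      then show ?thesis unfolding X'_def by blast
    qed
    ultimately show ?thesis by simp
  qed simp
  define n where "n = card (X' \<union> R')"
  have n: "n = card X' + card R'"
    unfolding n_def by (rule card_Un_disjoint) (use finXR in \<open>auto simp: X'_def R'_def\<close>)
  have diff: "real (card R) - real (card X) = real (card R') - real (card X')"
  proof -
    have "card R = card R' + card (R \<inter> X)" "card X = card X' + card (R \<inter> X)"
      unfolding X'_def R'_def using card_Int_Diff[OF finXR(2), of X] card_Int_Diff[OF finXR(1), of R]
      by (simp_all add: Int_commute)
    then show ?thesis by simp
  qed
  have "real (card R') - real (card X') \<le> n / (2 * q)"
  \<comment> \<open>The threshold is \<open>k / 4\<close>, where the bound of
    \<open>excess_of_hall_condition\<close> sets in; below it \<open>R'\<close> is itself an
    admissible \<open>T\<close>.\<close>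
  proof (cases "1600 * (2 * h\<^sup>2)\<^sup>2 * q\<^sup>2 \<le> n")
    case True
    have model: "\<not> clique_model E h (X' \<union> R')"
      using no_model clique_model_mono[of E h "X' \<union> R'" V] XV RV by (auto simp: X'_def R'_def)
    have "real (card R') - real (card X')
        \<le> real n / (2 * q) - 20 * (2 * h\<^sup>2) * sqrt (real n)"
      unfolding n_def
    proof (rule excess_of_hall_condition[OF sym q h _ _ _ model])
      show "finite X'" "finite R'" "X' \<inter> R' = {}" using finXR by (auto simp: X'_def R'_def)
    qed (use hall True in \<open>simp_all add: k_def n_def\<close>)
    also have "\<dots> \<le> n / (2 * q)" by simp
    finally show ?thesis .
  next
    case False
    then have "card R' \<le> k" using n by (simp add: k_def)
    then have "card R' \<le> card {s\<in>X'. \<exists>t\<in>R'. E t s}" by (intro hall) auto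
    also have "\<dots> \<le> card X'" using finXR by (intro card_mono) (auto simp: X'_def)
    finally have "real (card R') - real (card X') \<le> 0" by simp
    also have "0 \<le> real n / (2 * q)" by simp
    finally show ?thesis .
  qed
  \<comment> \<open>Here \<open>X\<close> is smaller than \<open>R\<close>, so the excess can be
    measured against \<open>R\<close> alone.\<close>
  also have "n \<le> 2 * card R"
  proof -
    have "card X' \<le> card X" "card R' \<le> card R"
      using finXR by (auto simp: X'_def R'_def intro: card_mono)
    then show ?thesis using n False by linarith
  qed
  then have "n / (2 * q) \<le> real (2 * card R) / (2 * q)"
    by (intro divide_right_mono) (simp_all only: of_nat_le_iff of_nat_0_le_iff)
  also have "\<dots> = card R / q" by simp
  finally show ?thesis using diff by (simp add: algebra_simps)
qed

section \<open>Minors from clique models\<close>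

definition adj :: "'a ugraph \<Rightarrow> 'a \<Rightarrow> 'a \<Rightarrow> bool" where
  "adj G u v \<longleftrightarrow> {u, v} \<in> edges G"

lemma symp_adj: "symp (adj G)"
  by (auto simp: symp_def adj_def insert_commute)

lemma adj_sym: "adj G u v \<Longrightarrow> adj G v u"
  by (simp add: adj_def insert_commute)

lemma adj_simple:
  assumes "simple_graph G" "adj G u v"
  shows "u \<noteq> v" "u \<in> verts G" "v \<in> verts G"
  using assms unfolding simple_graph_def adj_def
  by (metis doubleton_eq_iff insert_absorb2 singleton_insert_inj_eq)+

lemma adj_contract:
  assumes S: "simple_graph S" and "a \<noteq> y" "b \<noteq> y" "a \<noteq> b" "x \<noteq> y"
  shows "adj (contract x y S) a b \<longleftrightarrow>
    adj S a b \<or> (a = x \<and> adj S y b) \<or> (b = x \<and> adj S a y)"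
proof
  let ?m = "\<lambda>z. if z = y then x else z"
  assume "adj (contract x y S) a b"
  then obtain e where e: "e \<in> edges S" "e \<noteq> {x, y}" "{a, b} = ?m ` e"
    by (auto simp: adj_def contract_def)
  obtain u v where uv: "e = {u, v}" using S e(1) by (auto simp: simple_graph_def)
  then have "{a, b} = {?m u, ?m v}" using e(3) by simp
  then have "(?m u = a \<and> ?m v = b) \<or> (?m u = b \<and> ?m v = a)" by (auto simp: doubleton_eq_iff)
  moreover have "adj S u v" "adj S v u" using e(1) uv by (auto simp: adj_def insert_commute)
  ultimately show "adj S a b \<or> (a = x \<and> adj S y b) \<or> (b = x \<and> adj S a y)"
    using assms by (auto split: if_splits)
next
  let ?m = "\<lambda>z. if z = y then x else z"
  have im: "adj (contract x y S) (?m c) (?m d)" if "adj S c d" "{c, d} \<noteq> {x, y}" for c d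
  proof -
    have "?m ` {c, d} \<in> edges (contract x y S)"
      unfolding contract_def using that by (auto simp only: adj_def ugraph.simps)
    then show ?thesis by (simp only: adj_def image_insert image_empty)
  qed
  assume "adj S a b \<or> (a = x \<and> adj S y b) \<or> (b = x \<and> adj S a y)"
  then show "adj (contract x y S) a b"
    using im[of a b] im[of y b] im[of a y] assms by (auto simp: doubleton_eq_iff)
qed

lemma simple_contract:
  assumes S: "simple_graph S" and xy: "adj S x y"
  shows "simple_graph (contract x y S)"
  unfolding simple_graph_def
proof (intro conjI ballI)
  show "finite (verts (contract x y S))" using S by (simp add: simple_graph_def contract_def)
  let ?m = "\<lambda>z. if z = y then x else z"
  fix e assume "e \<in> edges (contract x y S)"
  then obtain e' where e': "e' \<in> edges S" "e' \<noteq> {x, y}" "e = ?m ` e'"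
    by (auto simp: contract_def)
  then obtain u v where uv: "u \<in> verts S" "v \<in> verts S" "u \<noteq> v" "e' = {u, v}"
    using S unfolding simple_graph_def by blast
  have "?m u \<noteq> ?m v" using uv e'(2) by (auto simp: insert_commute split: if_splits)
  moreover have "?m u \<in> verts S - {y}" "?m v \<in> verts S - {y}"
    using uv adj_simple[OF S xy] by auto
  ultimately show "\<exists>u\<in>verts (contract x y S). \<exists>v\<in>verts (contract x y S). u \<noteq> v \<and> e = {u, v}"
    using e'(3) uv(4) by (intro bexI[of _ "?m u"] bexI[of _ "?m v"]) (auto simp: contract_def)
qed

text \<open>Stronger than a usual minor model: the branch sets exhaust \<open>S\<close> and their
  adjacency is exactly that of \<open>H\<close>, so contractions alone lead from \<open>S\<close> to
  a copy of \<open>H\<close>.\<close>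

definition branches :: "'a ugraph \<Rightarrow> 'b ugraph \<Rightarrow> ('b \<Rightarrow> 'a set) \<Rightarrow> bool" where
  "branches S H B \<longleftrightarrow> verts S = (\<Union>i\<in>verts H. B i) \<and>
     (\<forall>i\<in>verts H. conn (adj S) (B i)) \<and>
     (\<forall>i\<in>verts H. \<forall>j\<in>verts H. i \<noteq> j \<longrightarrow>
       B i \<inter> B j = {} \<and> (adj H i j \<longleftrightarrow> (\<exists>x\<in>B i. \<exists>y\<in>B j. adj S x y)))"

lemma graph_iso_of_singleton_branches:
  assumes S: "simple_graph S" and H: "simple_graph H" and B: "branches S H B"
    and single: "\<And>i. i \<in> verts H \<Longrightarrow> \<exists>x. B i = {x}"
  shows "graph_iso S H"
proof -
  obtain f where f: "\<And>i. i \<in> verts H \<Longrightarrow> B i = {f i}" using single by metis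
  have inj: "inj_on f (verts H)"
  proof (rule inj_onI, rule ccontr)
    fix i j assume ij: "i \<in> verts H" "j \<in> verts H" "f i = f j" "i \<noteq> j"
    then have "B i \<inter> B j = {}" using B by (simp add: branches_def)
    then show False using f ij by simp
  qed
  have "verts S = f ` verts H" using B f by (auto simp: branches_def)
  then have bij: "bij_betw f (verts H) (verts S)" using inj by (simp add: bij_betw_def)
  have edge: "adj S (f i) (f j) \<longleftrightarrow> adj H i j" if "i \<in> verts H" "j \<in> verts H" for i j
  proof (cases "i = j")
    case True
    then show ?thesis using adj_simple(1)[OF S, of "f i" "f i"] adj_simple(1)[OF H, of i i] by blast
  next
    case False
    then show ?thesis using B f that by (simp add: branches_def)
  qed
  let ?g = "inv_into (verts H) f"
  show ?thesis unfolding graph_iso_def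
  proof (intro exI[of _ ?g] conjI ballI)
    show "bij_betw ?g (verts S) (verts H)" by (rule bij_betw_inv_into[OF bij])
    fix u v assume uv: "u \<in> verts S" "v \<in> verts S"
    have "?g u \<in> verts H" "?g v \<in> verts H"
      using uv bij_betw_apply[OF bij_betw_inv_into[OF bij]] by simp_all
    from edge[OF this] show "{u, v} \<in> edges S \<longleftrightarrow> {?g u, ?g v} \<in> edges H"
      by (simp add: adj_def bij_betw_inv_into_right[OF bij uv(1)] bij_betw_inv_into_right[OF bij uv(2)])
  qed
qed

lemma branches_contract:
  assumes S: "simple_graph S" and B: "branches S H B"
    and i: "i \<in> verts H" and xy: "x \<in> B i" "y \<in> B i" "adj S x y"
  shows "branches (contract x y S) H (\<lambda>j. B j - {y})"
proof -
  have ne: "x \<noteq> y" using adj_simple(1)[OF S xy(3)] .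
  have disj: "B j \<inter> B k = {}" if "j \<in> verts H" "k \<in> verts H" "j \<noteq> k" for j k
    using B that by (simp add: branches_def)
  have other: "x \<notin> B j" "y \<notin> B j" if "j \<in> verts H" "j \<noteq> i" for j
    using disj[OF that(1) i that(2)] xy by auto
  note contr = adj_contract[OF S _ _ _ ne]
  show ?thesis unfolding branches_def
  proof (intro conjI ballI impI)
    show "verts (contract x y S) = (\<Union>j\<in>verts H. B j - {y})"
      using B by (auto simp: branches_def contract_def)
  next
    fix j assume j: "j \<in> verts H"
    have Bj: "conn (adj S) (B j)" using B j by (simp add: branches_def)
    show "conn (adj (contract x y S)) (B j - {y})"
      unfolding conn_def
    proof (intro conjI allI impI)
      show "B j - {y} \<noteq> {}"
        using xy ne other[of j] j Bj by (cases "j = i") (auto simp: conn_def)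
      fix A assume A: "A \<subseteq> B j - {y} \<and> A \<noteq> {} \<and> A \<noteq> B j - {y}"
      then obtain a0 b0 where 0: "a0 \<in> A" "b0 \<in> B j - {y} - A" by blast
      \<comment> \<open>The cut is pulled back to \<open>B j\<close> with \<open>y\<close> on the
        side of \<open>x\<close>; a crossing edge at \<open>y\<close> becomes one at
        \<open>x\<close>.\<close>
      show "\<exists>a\<in>A. \<exists>b\<in>B j - {y} - A. adj (contract x y S) a b"
      proof (cases "x \<in> A")
        case True
        then have "j = i" using A other j by blast
        obtain a b where ab: "a \<in> B j" "a \<in> insert y A" "b \<in> B j" "b \<notin> insert y A" "adj S a b"
          using conn_cross[OF Bj, of a0 "\<lambda>z. z \<in> insert y A" b0] 0 A by blast
        show ?thesis
        proof (cases "a = y")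
          case True
          then have "adj (contract x y S) x b" using ab contr[of x b] ne \<open>x \<in> A\<close> by auto
          then show ?thesis using \<open>x \<in> A\<close> ab by blast
        next
          case False
          then have "adj (contract x y S) a b" using ab contr[of a b] by auto
          then show ?thesis using False ab by blast
        qed
      next
        case False
        obtain a b where ab: "a \<in> B j" "a \<in> A" "b \<in> B j" "b \<notin> A" "adj S a b"
          using conn_cross[OF Bj, of a0 "\<lambda>z. z \<in> A" b0] 0 A by blast
        show ?thesis
        proof (cases "b = y")
          case True
          then have "j = i" using ab other j by blast
          have "adj (contract x y S) a x" using ab True contr[of a x] ne A False by auto
          then show ?thesis using False ab xy ne \<open>j = i\<close> by blast
        next
          case False
          then have "adj (contract x y S) a b" using ab contr[of a b] A by auto
          then show ?thesis using False ab by blast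
        qed
      qed
    qed
  next
    fix j k assume jk: "j \<in> verts H" "k \<in> verts H" "j \<noteq> k"
    show "(B j - {y}) \<inter> (B k - {y}) = {}" using disj[OF jk] by blast
    have eq: "(\<exists>a\<in>B j - {y}. \<exists>b\<in>B k - {y}. adj (contract x y S) a b) \<longleftrightarrow>
      (\<exists>a\<in>B j. \<exists>b\<in>B k. adj S a b)"
    proof
      assume "\<exists>a\<in>B j - {y}. \<exists>b\<in>B k - {y}. adj (contract x y S) a b"
      then obtain a b where ab: "a \<in> B j" "a \<noteq> y" "b \<in> B k" "b \<noteq> y" "adj (contract x y S) a b"
        by blast
      then have "a \<noteq> b" using disj[OF jk] by blast
      with ab contr[of a b] consider "adj S a b" | "a = x" "adj S y b" | "b = x" "adj S a y" by blast
      then show "\<exists>a\<in>B j. \<exists>b\<in>B k. adj S a b"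
      proof cases
        case 2
        then have "j = i" using ab other jk by blast
        then show ?thesis using 2 xy ab by blast
      next
        case 3
        then have "k = i" using ab other jk by blast
        then show ?thesis using 3 xy ab by blast
      qed (use ab in blast)
    next
      assume "\<exists>a\<in>B j. \<exists>b\<in>B k. adj S a b"
      then obtain a b where ab: "a \<in> B j" "b \<in> B k" "adj S a b" by blast
      have neab: "a' \<noteq> b'" if "a' \<in> B j" "b' \<in> B k" for a' b' using disj[OF jk] that by blast
      consider "a = y" | "b = y" | "a \<noteq> y" "b \<noteq> y" by blast
      then show "\<exists>a\<in>B j - {y}. \<exists>b\<in>B k - {y}. adj (contract x y S) a b"
      proof cases
        case 1
        then have "j = i" using ab other jk by blast
        then have "adj (contract x y S) x b"
          using contr[of x b] 1 ab ne neab[of x b] neab[of y b] xy by auto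
        then show ?thesis using \<open>j = i\<close> xy ne ab 1 neab[of y b] by blast
      next
        case 2
        then have "k = i" using ab other jk by blast
        then have "adj (contract x y S) a x"
          using contr[of a x] 2 ab ne neab[of a x] neab[of a y] xy by auto
        then show ?thesis using \<open>k = i\<close> xy ne ab 2 neab[of a y] by blast
      next
        case 3
        then have "adj (contract x y S) a b" using contr[of a b] ab neab[of a b] by auto
        then show ?thesis using ab 3 by blast
      qed
    qed
    show "adj H j k \<longleftrightarrow> (\<exists>a\<in>B j - {y}. \<exists>b\<in>B k - {y}. adj (contract x y S) a b)"
      unfolding eq using B jk by (simp add: branches_def)
  qed
qed

text \<open>A branch set with two vertices contains an edge; contracting it preserves
  \<open>branches\<close> and removes a vertex. Once all branch sets are singletons, the graph is a
  copy of \<open>H\<close>.\<close>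

lemma contract_branches:
  assumes "simple_graph H"
  shows "simple_graph S \<Longrightarrow> branches S H B \<Longrightarrow>
    \<exists>K. contraction_step\<^sup>*\<^sup>* S K \<and> graph_iso K H"
proof (induction "card (verts S)" arbitrary: S B rule: less_induct)
  case less
  show ?case
  proof (cases "\<forall>i\<in>verts H. \<exists>x. B i = {x}")
    case True
    then show ?thesis
      using graph_iso_of_singleton_branches[OF less.prems(1) assms less.prems(2)] by blast
  next
    case False
    then obtain i where i: "i \<in> verts H" "\<nexists>x. B i = {x}" by blast
    have c: "conn (adj S) (B i)" using less.prems(2) i(1) by (simp add: branches_def)
    then obtain x where "x \<in> B i" by (auto simp: conn_def)
    with i(2) obtain x' where x': "x' \<in> B i" "x' \<noteq> x" by blast
    obtain y where xy: "x \<in> B i" "y \<in> B i" "adj S x y"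
      by (rule conn_cross[OF c \<open>x \<in> B i\<close>, of "\<lambda>z. z = x" x']) (use x' in auto)
    have "y \<in> verts S" by (rule adj_simple[OF less.prems(1) xy(3)])
    then have "card (verts (contract x y S)) < card (verts S)"
      unfolding contract_def ugraph.simps
      by (intro card_Diff1_less) (use less.prems(1) in \<open>simp add: simple_graph_def\<close>)
    from less.hyps[OF this simple_contract[OF less.prems(1) xy(3)]
        branches_contract[OF less.prems i(1) xy]]
    obtain K where "contraction_step\<^sup>*\<^sup>* (contract x y S) K" "graph_iso K H" by blast
    moreover have "contraction_step S (contract x y S)"
      using xy(3) by (auto simp: contraction_step_def adj_def)
    ultimately show ?thesis by (meson converse_rtranclp_into_rtranclp)
  qed
qed

text \<open>Deletions precede contractions in \<open>is_minor\<close>, so the subgraph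
  \<open>S\<close> keeps only the edges inside a branch set or between branch sets adjacent in
  \<open>H\<close>. This lemma is what allows the separator argument to speak of cliques
  only.\<close>

lemma minor_of_clique_model:
  assumes G: "simple_graph G" and H: "simple_graph H"
    and model: "clique_model (adj G) (card (verts H)) (verts G)"
  shows "H \<preceq>\<^sub>m G"
proof -
  obtain F where F0: "finite F" "card F = card (verts H)"
    and F1: "\<forall>C\<in>F. conn (adj G) C \<and> C \<subseteq> verts G"
    and F2: "\<forall>C\<in>F. \<forall>D\<in>F. C \<noteq> D \<longrightarrow> C \<inter> D = {} \<and> (\<exists>x\<in>C. \<exists>y\<in>D. adj G x y)"
    using model unfolding clique_model_def by (elim exE conjE) (rule that)
  have F: "conn (adj G) C" "C \<subseteq> verts G" if "C \<in> F" for C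
    using bspec[OF F1 that] by blast+
  have pair: "C \<inter> D = {}" "\<exists>x\<in>C. \<exists>y\<in>D. adj G x y" if "C \<in> F" "D \<in> F" "C \<noteq> D" for C D
    using bspec[OF bspec[OF F2 that(1)] that(2)] that(3) by blast+
  have "finite (verts H)" using H by (simp add: simple_graph_def)
  then obtain B where B: "bij_betw B (verts H) F"
    using F0 finite_same_card_bij[of "verts H" F] by metis
  have BF: "B i \<in> F" if "i \<in> verts H" for i using B that by (auto simp: bij_betw_def)
  have Bne: "B i \<noteq> B j" if "i \<in> verts H" "j \<in> verts H" "i \<noteq> j" for i j
    using B that by (auto simp: bij_betw_def inj_on_def)
  define R where "R x y \<longleftrightarrow> adj G x y \<and>
    (\<exists>i\<in>verts H. \<exists>j\<in>verts H. x \<in> B i \<and> y \<in> B j \<and> (i = j \<or> adj H i j))" for x y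
  have R_sym: "R y x" if "R x y" for x y
    using that adj_sym[of G x y] adj_sym[of H] unfolding R_def by blast
  define S where "S = \<lparr>verts = (\<Union>i\<in>verts H. B i), edges = {{x, y} |x y. R x y}\<rparr>"
  have adjS: "adj S x y \<longleftrightarrow> R x y" for x y
    unfolding adj_def S_def ugraph.simps
  proof
    assume "{x, y} \<in> {{x, y} |x y. R x y}"
    then obtain x' y' where "{x, y} = {x', y'}" "R x' y'" by blast
    then show "R x y" using R_sym by (auto simp: doubleton_eq_iff)
  qed blast
  have SG: "verts S \<subseteq> verts G"
    unfolding S_def ugraph.simps by (rule UN_least) (rule F(2)[OF BF])
  have S: "simple_graph S"
    unfolding simple_graph_def
  proof (intro conjI ballI)
    show "finite (verts S)" using SG by (rule finite_subset) (use G in \<open>simp add: simple_graph_def\<close>)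
    fix e assume "e \<in> edges S"
    then obtain x y where xy: "e = {x, y}" "R x y" by (auto simp: S_def)
    then have "x \<in> verts S" "y \<in> verts S" "adj G x y"
      unfolding R_def S_def ugraph.simps by blast+
    then show "\<exists>u\<in>verts S. \<exists>v\<in>verts S. u \<noteq> v \<and> e = {u, v}"
      using adj_simple(1)[OF G] xy(1) by blast
  qed
  have "branches S H B" unfolding branches_def
  proof (intro conjI ballI impI)
    show "verts S = (\<Union>i\<in>verts H. B i)" by (simp add: S_def)
  next
    fix i assume i: "i \<in> verts H"
    have eq: "adj S x y \<longleftrightarrow> adj G x y" if "x \<in> B i" "y \<in> B i" for x y
      using that i unfolding adjS R_def by blast
    show "conn (adj S) (B i)"
      unfolding conn_def
    proof (intro conjI allI impI)
      show "B i \<noteq> {}" using F(1)[OF BF[OF i]] by (simp add: conn_def)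
      fix A assume A: "A \<subseteq> B i \<and> A \<noteq> {} \<and> A \<noteq> B i"
      then have "\<exists>x\<in>A. \<exists>y\<in>B i - A. adj G x y"
        using F(1)[OF BF[OF i]] by (simp add: conn_def)
      then obtain a b where "a \<in> A" "b \<in> B i - A" "adj G a b" by blast
      moreover from this have "adj S a b" using eq[of a b] A by blast
      ultimately show "\<exists>x\<in>A. \<exists>y\<in>B i - A. adj S x y" by blast
    qed
  next
    fix i j assume ij: "i \<in> verts H" "j \<in> verts H" "i \<noteq> j"
    have disj: "B k \<inter> B l = {}" if "k \<in> verts H" "l \<in> verts H" "k \<noteq> l" for k l
      using pair(1)[OF BF[OF that(1)] BF[OF that(2)] Bne[OF that]] .
    show "B i \<inter> B j = {}" using disj[OF ij] .
    have uniq: "k = l" if "x \<in> B k" "x \<in> B l" "k \<in> verts H" "l \<in> verts H" for x k l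
      using disj[OF that(3,4)] that(1,2) by blast
    show "adj H i j \<longleftrightarrow> (\<exists>x\<in>B i. \<exists>y\<in>B j. adj S x y)"
    proof
      assume "adj H i j"
      obtain x y where xy: "x \<in> B i" "y \<in> B j" "adj G x y"
        using pair(2)[OF BF[OF ij(1)] BF[OF ij(2)] Bne[OF ij]] by (elim bexE) (rule that)
      with ij \<open>adj H i j\<close> have "R x y" unfolding R_def by blast
      with xy show "\<exists>x\<in>B i. \<exists>y\<in>B j. adj S x y" unfolding adjS by blast
    next
      assume "\<exists>x\<in>B i. \<exists>y\<in>B j. adj S x y"
      then obtain x y where xy: "x \<in> B i" "y \<in> B j" "R x y" unfolding adjS by blast
      then obtain k l where kl: "k \<in> verts H" "l \<in> verts H" "x \<in> B k" "y \<in> B l"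
        "k = l \<or> adj H k l"
        unfolding R_def by blast
      have "k = i" "l = j" using uniq[OF kl(3) xy(1) kl(1) ij(1)] uniq[OF kl(4) xy(2) kl(2) ij(2)] .
      with kl(5) ij(3) show "adj H i j" by simp
    qed
  qed
  from contract_branches[OF H S this]
  obtain K where "contraction_step\<^sup>*\<^sup>* S K" "graph_iso K H" by blast
  moreover have "subgraph S G"
    unfolding subgraph_def
  proof (intro conjI)
    show "edges S \<subseteq> edges G" unfolding S_def R_def adj_def by auto
  qed (rule S, rule SG)
  ultimately show ?thesis unfolding is_minor_def by blast
qed

section \<open>Timed Hoare triples\<close>

primrec loop_free :: "prog \<Rightarrow> bool" where
  "loop_free Skip = True"
| "loop_free (Const i k) = True"
| "loop_free (Add i j k) = True"
| "loop_free (Sub i j k) = True"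
| "loop_free (Load i j) = True"
| "loop_free (Store i j) = True"
| "loop_free (Read i) = True"
| "loop_free (Write i) = True"
| "loop_free (Seq P Q) = (loop_free P \<and> loop_free Q)"
| "loop_free (Cond i P Q) = (loop_free P \<and> loop_free Q)"
| "loop_free (While i P) = False"

text \<open>\<open>Cond\<close> is charged for both branches, which bounds either one without a
  maximum.\<close>

primrec cost :: "prog \<Rightarrow> nat" where
  "cost Skip = 1"
| "cost (Const i k) = 1"
| "cost (Add i j k) = 1"
| "cost (Sub i j k) = 1"
| "cost (Load i j) = 1"
| "cost (Store i j) = 1"
| "cost (Read i) = 1"
| "cost (Write i) = 1"
| "cost (Seq P Q) = cost P + cost Q"
| "cost (Cond i P Q) = cost P + cost Q + 1"
| "cost (While i P) = 0"

text \<open>Straight-line code is evaluated by this function, so that triples about it follow by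
  simplification. The clause for \<open>While\<close> is a placeholder, ruled out by
  \<open>loop_free\<close>.\<close>

primrec sem :: "prog \<Rightarrow> state \<Rightarrow> state" where
  "sem Skip s = s"
| "sem (Const i k) s = set_mem i k s"
| "sem (Add i j k) s = set_mem i (mem s j + mem s k) s"
| "sem (Sub i j k) s = set_mem i (mem s j - mem s k) s"
| "sem (Load i j) s = set_mem i (mem s (mem s j)) s"
| "sem (Store i j) s = set_mem (mem s i) (mem s j) s"
| "sem (Read i) s = set_mem i (case inp s of [] \<Rightarrow> 0 | x # _ \<Rightarrow> x) (s\<lparr>inp := tl (inp s)\<rparr>)"
| "sem (Write i) s = s\<lparr>outp := outp s @ [mem s i]\<rparr>"
| "sem (Seq P Q) s = sem Q (sem P s)"
| "sem (Cond i P Q) s = (if mem s i \<noteq> 0 then sem P s else sem Q s)"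
| "sem (While i P) s = s"

lemma exec_loop_free: "loop_free P \<Longrightarrow> \<exists>t\<le>cost P. exec P s t (sem P s)"
proof (induction P arbitrary: s)
  case (Seq P Q)
  obtain t where "t \<le> cost P" "exec P s t (sem P s)" using Seq by fastforce
  moreover obtain t' where "t' \<le> cost Q" "exec Q (sem P s) t' (sem Q (sem P s))"
    using Seq by fastforce
  ultimately show ?case by (auto intro!: exI[of _ "t + t'"] exec.intros)
next
  case (Cond i P Q)
  obtain t where t: "t \<le> cost P" "exec P s t (sem P s)" using Cond by fastforce
  obtain t' where t': "t' \<le> cost Q" "exec Q s t' (sem Q s)" using Cond by fastforce
  show ?case
  proof (cases "mem s i = 0")
    case True
    then show ?thesis using exec.intros(11)[OF True t'(2), of P] t'(1)
      by (intro exI[of _ "t' + 1"]) simp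
  next
    case False
    then show ?thesis using exec.intros(10)[OF False t(2), of Q] t(1)
      by (intro exI[of _ "t + 1"]) simp
  qed
qed (rule exI[of _ 1]; simp add: exec.intros(1-8) del: One_nat_def)+

definition triple :: "(state \<Rightarrow> bool) \<Rightarrow> prog \<Rightarrow> nat \<Rightarrow> (state \<Rightarrow> bool) \<Rightarrow> bool" where
  "triple A P T B \<longleftrightarrow> (\<forall>s. A s \<longrightarrow> (\<exists>t s'. exec P s t s' \<and> t \<le> T \<and> B s'))"

lemma tripleD: "triple A P T B \<Longrightarrow> A s \<Longrightarrow> \<exists>t s'. exec P s t s' \<and> t \<le> T \<and> B s'"
  by (simp add: triple_def)

lemma triple_loop_free:
  assumes "loop_free P" "cost P \<le> T" "\<And>s. A s \<Longrightarrow> B (sem P s)"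
  shows "triple A P T B"
  unfolding triple_def
proof (intro allI impI)
  fix s assume "A s"
  obtain t where "t \<le> cost P" "exec P s t (sem P s)" using exec_loop_free assms(1) by blast
  with assms(2,3) \<open>A s\<close> show "\<exists>t s'. exec P s t s' \<and> t \<le> T \<and> B s'"
    by (meson order_trans)
qed

lemma triple_Seq:
  assumes P: "triple A P T B" and Q: "triple B Q T' C"
  shows "triple A (Seq P Q) (T + T') C"
  unfolding triple_def
proof (intro allI impI)
  fix s assume "A s"
  then obtain t s1 where 1: "exec P s t s1" "t \<le> T" "B s1" using tripleD[OF P] by blast
  then obtain t' s2 where 2: "exec Q s1 t' s2" "t' \<le> T'" "C s2" using tripleD[OF Q] by blast
  have "exec (Seq P Q) s (t + t') s2" using 1(1) 2(1) by (rule exec.intros)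
  moreover have "t + t' \<le> T + T'" using 1 2 by simp
  ultimately show "\<exists>t s'. exec (Seq P Q) s t s' \<and> t \<le> T + T' \<and> C s'" using 2(3) by blast
qed

lemma triple_weaken:
  assumes "triple A P T B" "\<And>s. A' s \<Longrightarrow> A s" "T \<le> T'" "\<And>s. B s \<Longrightarrow> B' s"
  shows "triple A' P T' B'"
  unfolding triple_def
proof (intro allI impI)
  fix s assume "A' s"
  then obtain t s1 where "exec P s t s1" "t \<le> T" "B s1" using tripleD[OF assms(1)] assms(2) by blast
  then show "\<exists>t s'. exec P s t s' \<and> t \<le> T' \<and> B' s'"
    using assms(3,4) by (meson order_trans)
qed

lemma triple_Cond:
  assumes P: "triple (\<lambda>s. A s \<and> mem s i \<noteq> 0) P T B" and Q: "triple (\<lambda>s. A s \<and> mem s i = 0) Q T B"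
  shows "triple A (Cond i P Q) (T + 1) B"
  unfolding triple_def
proof (intro allI impI)
  fix s assume A: "A s"
  show "\<exists>t s'. exec (Cond i P Q) s t s' \<and> t \<le> T + 1 \<and> B s'"
  proof (cases "mem s i = 0")
    case True
    obtain t s1 where "exec Q s t s1" "t \<le> T" "B s1" using tripleD[OF Q] A True by blast
    then show ?thesis using exec.intros(11)[OF True] by (meson add_le_mono1)
  next
    case False
    obtain t s1 where "exec P s t s1" "t \<le> T" "B s1" using tripleD[OF P] A False by blast
    then show ?thesis using exec.intros(10)[OF False] by (meson add_le_mono1)
  qed
qed

text \<open>The invariant is indexed by the number of completed rounds, and \<open>m\<close> is
  their exact number. Each round adds one test to \<open>T\<close>; the final 1 is the failing
  test.\<close>

lemma triple_While:
  assumes step: "\<And>j. j < m \<Longrightarrow> triple (I j) P T (I (Suc j))"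
    and go: "\<And>j s. j < m \<Longrightarrow> I j s \<Longrightarrow> mem s f \<noteq> 0"
    and stop: "\<And>s. I m s \<Longrightarrow> mem s f = 0"
  shows "triple (I 0) (While f P) (m * (T + 1) + 1) (I m)"
proof -
  have "triple (I (m - j)) (While f P) (j * (T + 1) + 1) (I m)" if "j \<le> m" for j
    using that
  proof (induction j)
    case 0
    show ?case unfolding triple_def
    proof (intro allI impI)
      fix s assume "I (m - 0) s"
      then have "I m s" by simp
      with exec.intros(12)[OF stop[OF this], of P]
      show "\<exists>t s'. exec (While f P) s t s' \<and> t \<le> 0 * (T + 1) + 1 \<and> I m s'" by auto
    qed
  next
    case (Suc j)
    show ?case unfolding triple_def
    proof (intro allI impI)
      fix s assume s: "I (m - Suc j) s"
      have j: "m - Suc j < m" "Suc (m - Suc j) = m - j" using Suc.prems by auto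
      obtain t s1 where 1: "exec P s t s1" "t \<le> T" "I (m - j) s1"
        using tripleD[OF step[OF j(1)] s] j(2) by auto
      obtain t' s2 where 2: "exec (While f P) s1 t' s2" "t' \<le> j * (T + 1) + 1" "I m s2"
        using tripleD[OF Suc.IH 1(3)] Suc.prems by auto
      have "exec (While f P) s (t + t' + 1) s2"
        using go[OF j(1) s] 1(1) 2(1) by (rule exec.intros)
      moreover have "t + t' + 1 \<le> Suc j * (T + 1) + 1" using 1(2) 2(2) by simp
      ultimately show "\<exists>t s'. exec (While f P) s t s' \<and> t \<le> Suc j * (T + 1) + 1 \<and> I m s'"
        using 2(3) by blast
    qed
  qed
  from this[of m] show ?thesis by simp
qed

lemma triple_ex: "(\<And>x. triple (A x) P T B) \<Longrightarrow> triple (\<lambda>s. \<exists>x. A x s) P T B"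
  unfolding triple_def by blast

lemma set_mem_simps [simp]:
  "mem (set_mem i x s) j = (if j = i then x else mem s j)"
  "inp (set_mem i x s) = inp s" "outp (set_mem i x s) = outp s"
  by (simp_all add: set_mem_def)

text \<open>\<open>While\<close> only compares a cell with 0, so the flag cell \<open>f\<close>
  holds the number of rounds left. The increment is taken from register 1, which has to contain
  1.\<close>

definition for_loop :: "nat \<Rightarrow> nat \<Rightarrow> nat \<Rightarrow> prog \<Rightarrow> prog" where
  "for_loop r l f P = Seq (Seq (Const r 0) (Sub f l r)) (While f (Seq P (Seq (Add r r 1) (Sub f l r))))"

lemma triple_for_loop:
  assumes body: "\<And>i. i < m \<Longrightarrow> triple (\<lambda>s. I i s \<and> mem s r = i \<and> mem s l = m \<and> mem s 1 = 1) P T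
      (\<lambda>s. I (Suc i) s \<and> mem s r = i \<and> mem s l = m \<and> mem s 1 = 1)"
    and inv: "\<And>i s x y. I i s \<Longrightarrow> I i (set_mem f y (set_mem r x s))"
    and distinct: "r \<noteq> l" "f \<noteq> l" "f \<noteq> r" "r \<noteq> 1" "f \<noteq> 1"
  shows "triple (\<lambda>s. I 0 s \<and> mem s l = m \<and> mem s 1 = 1) (for_loop r l f P) (m * (T + 3) + 3)
    (\<lambda>s. I m s \<and> mem s l = m \<and> mem s 1 = 1)"
proof -
  define J where "J i s \<longleftrightarrow> I i s \<and> mem s r = i \<and> mem s f = m - i \<and> mem s l = m \<and> mem s 1 = 1"
    for i s
  have "triple (J 0) (While f (Seq P (Seq (Add r r 1) (Sub f l r)))) (m * ((T + 2) + 1) + 1) (J m)"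
  proof (rule triple_While)
    fix i assume i: "i < m"
    show "triple (J i) (Seq P (Seq (Add r r 1) (Sub f l r))) (T + 2) (J (Suc i))"
    proof (rule triple_Seq)
      show "triple (J i) P T (\<lambda>s. I (Suc i) s \<and> mem s r = i \<and> mem s l = m \<and> mem s 1 = 1)"
        by (rule triple_weaken[OF body[OF i]]) (auto simp: J_def)
      show "triple (\<lambda>s. I (Suc i) s \<and> mem s r = i \<and> mem s l = m \<and> mem s 1 = 1)
          (Seq (Add r r 1) (Sub f l r)) 2 (J (Suc i))"
        by (rule triple_loop_free) (use distinct inv in \<open>auto simp: J_def\<close>)
    qed
  qed (auto simp: J_def)
  moreover have "triple (\<lambda>s. I 0 s \<and> mem s l = m \<and> mem s 1 = 1) (Seq (Const r 0) (Sub f l r)) 2 (J 0)"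
    by (rule triple_loop_free) (use distinct inv in \<open>auto simp: J_def\<close>)
  ultimately have "triple (\<lambda>s. I 0 s \<and> mem s l = m \<and> mem s 1 = 1) (for_loop r l f P)
      (2 + (m * ((T + 2) + 1) + 1)) (J m)"
    unfolding for_loop_def by (intro triple_Seq)
  then show ?thesis
    by (rule triple_weaken) (auto simp: J_def algebra_simps)
qed

text \<open>Cells below 32 serve as registers. The other cells hold eight interleaved arrays, entry
  \<open>i\<close> of array \<open>j\<close> being cell \<open>cell j i\<close>; cells 30 and 31 are scratch space for computing
  addresses.\<close>

definition cell :: "nat \<Rightarrow> nat \<Rightarrow> nat" where
  "cell j i = 32 + j + 8 * i"

text \<open>From \<open>j = 8\<close> on, \<open>cell\<close> would run into other arrays and a
  store would change more than one entry; the default 0 keeps stores plain function updates.\<close>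

definition arr :: "state \<Rightarrow> nat \<Rightarrow> nat \<Rightarrow> nat" where
  "arr s j i = (if j < 8 then mem s (cell j i) else 0)"

text \<open>The fixed stride 8 leaves all arrays unbounded, although their lengths depend on the
  input; three doublings replace a multiplication.\<close>

definition addr_prog :: "nat \<Rightarrow> nat \<Rightarrow> prog" where
  "addr_prog j i = Seq (Add 31 i i) (Seq (Add 31 31 31) (Seq (Add 31 31 31)
     (Seq (Const 30 (32 + j)) (Add 31 30 31))))"

definition aload :: "nat \<Rightarrow> nat \<Rightarrow> nat \<Rightarrow> prog" where
  "aload r j i = Seq (addr_prog j i) (Load r 31)"

definition astore :: "nat \<Rightarrow> nat \<Rightarrow> nat \<Rightarrow> prog" where
  "astore j i r = Seq (addr_prog j i) (Store 31 r)"

lemma cell_eq: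
  assumes "j < 8" "j' < 8"
  shows "cell j i = cell j' i' \<longleftrightarrow> j = j' \<and> i = i'"
proof
  assume "cell j i = cell j' i'"
  then have e: "j + 8 * i = j' + 8 * i'" by (simp add: cell_def)
  then have "(j + 8 * i) mod 8 = (j' + 8 * i') mod 8" by (rule arg_cong)
  then have "j = j'" using assms by simp
  with e show "j = j' \<and> i = i'" by simp
qed simp

lemma arr_simps [simp]:
  "r < 32 \<Longrightarrow> arr (set_mem r x s) = arr s"
  "arr (s\<lparr>inp := u\<rparr>) = arr s" "arr (s\<lparr>outp := u\<rparr>) = arr s"
  by (auto simp: arr_def cell_def fun_eq_iff)

lemma array_prog_simps [simp]:
  "loop_free (aload r j i)" "cost (aload r j i) = 6"
  "loop_free (astore j i r)" "cost (astore j i r) = 6"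
  by (simp_all add: aload_def astore_def addr_prog_def)

lemma sem_addr_prog:
  assumes "i < 30"
  shows "mem (sem (addr_prog j i) s) 31 = cell j (mem s i)"
    "x \<noteq> 30 \<Longrightarrow> x \<noteq> 31 \<Longrightarrow> mem (sem (addr_prog j i) s) x = mem s x"
    "inp (sem (addr_prog j i) s) = inp s" "outp (sem (addr_prog j i) s) = outp s"
proof -
  have i: "i \<noteq> 30" "i \<noteq> 31" using assms by simp_all
  show "mem (sem (addr_prog j i) s) 31 = cell j (mem s i)"
    by (simp add: addr_prog_def cell_def i)
qed (simp_all add: addr_prog_def)

lemma cell_neq_register: "r < 32 \<Longrightarrow> cell j i \<noteq> r" "r < 32 \<Longrightarrow> r \<noteq> cell j i"
  by (auto simp: cell_def)

lemma sem_aload [simp]: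
  assumes "i < 30" "r < 30" "j < 8"
  shows "x < 30 \<Longrightarrow> mem (sem (aload r j i) s) x = (if x = r then arr s j (mem s i) else mem s x)"
    "arr (sem (aload r j i) s) = arr s"
    "inp (sem (aload r j i) s) = inp s" "outp (sem (aload r j i) s) = outp s"
proof -
  note addr = sem_addr_prog[OF assms(1)]
  show "x < 30 \<Longrightarrow> mem (sem (aload r j i) s) x = (if x = r then arr s j (mem s i) else mem s x)"
    using assms(3) by (simp add: aload_def addr arr_def cell_neq_register)
  show "arr (sem (aload r j i) s) = arr s"
    using assms(2) by (simp add: aload_def addr arr_def cell_neq_register fun_eq_iff)
qed (simp_all add: aload_def sem_addr_prog[OF assms(1)])

lemma sem_astore [simp]:
  assumes "i < 30" "r < 30" "j < 8"
  shows "x < 30 \<Longrightarrow> mem (sem (astore j i r) s) x = mem s x"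
    "arr (sem (astore j i r) s) = (arr s)(j := (arr s j)(mem s i := mem s r))"
    "inp (sem (astore j i r) s) = inp s" "outp (sem (astore j i r) s) = outp s"
proof -
  note addr = sem_addr_prog[OF assms(1)]
  have r: "r \<noteq> 30" "r \<noteq> 31" using assms(2) by simp_all
  show "x < 30 \<Longrightarrow> mem (sem (astore j i r) s) x = mem s x"
    by (simp add: astore_def addr cell_neq_register)
  show "arr (sem (astore j i r) s) = (arr s)(j := (arr s j)(mem s i := mem s r))"
  proof (intro ext)
    fix j' i'
    show "arr (sem (astore j i r) s) j' i' = ((arr s)(j := (arr s j)(mem s i := mem s r))) j' i'"
      using assms(3)
      by (cases "j' < 8") (simp_all add: astore_def addr r arr_def cell_neq_register cell_eq)
  qed
qed (simp_all add: astore_def sem_addr_prog[OF assms(1)])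

text \<open>\<open>St n k A os\<close> fixes the constants in the registers 0 to 4, the contents \<open>A\<close> of the arrays
  and the output so far, and leaves the other registers open.\<close>

definition St :: "nat \<Rightarrow> nat \<Rightarrow> (nat \<Rightarrow> nat \<Rightarrow> nat) \<Rightarrow> nat list \<Rightarrow> state \<Rightarrow> bool" where
  "St n k A os s \<longleftrightarrow> mem s 0 = 0 \<and> mem s 1 = 1 \<and> mem s 2 = n \<and> mem s 3 = k \<and> mem s 4 = Suc k \<and>
     arr s = A \<and> outp s = os"

lemma St_simps [simp]:
  "4 < r \<Longrightarrow> r < 30 \<Longrightarrow> St n k A os (set_mem r x s) = St n k A os s"
  "St n k A os (s\<lparr>inp := u\<rparr>) = St n k A os s"
  "i < 30 \<Longrightarrow> 4 < r \<Longrightarrow> r < 30 \<Longrightarrow> j < 8 \<Longrightarrow> St n k A os (sem (aload r j i) s) = St n k A os s"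
  by (simp_all add: St_def)

lemma St_D:
  assumes "St n k A os s"
  shows "mem s 0 = 0" "mem s 1 = 1" "mem s (Suc 0) = 1" "mem s 2 = n" "mem s 3 = k"
    "mem s 4 = Suc k" "arr s = A" "outp s = os"
  using assms by (simp_all add: St_def)

definition read_array :: "nat \<Rightarrow> nat \<Rightarrow> prog" where
  "read_array j l = for_loop 5 l 6 (Seq (Read 7) (astore j 5 7))"

lemma triple_read_array:
  assumes "j < 8" "l \<notin> {1, 5, 6, 7}" "l < 30"
  shows "triple (\<lambda>s. St n k A os s \<and> inp s = u @ v \<and> mem s l = length u)
    (read_array j l) (length u * 10 + 3)
    (\<lambda>s. St n k (A(j := \<lambda>i. if i < length u then u ! i else A j i)) os s \<and> inp s = v)"
proof -
  define B where "B m = A(j := \<lambda>i. if i < m then u ! i else A j i)" for m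
  have B_Suc: "(B m)(j := (B m j)(m := u ! m)) = B (Suc m)" for m
    by (auto simp: B_def fun_eq_iff)
  let ?I = "\<lambda>m s. St n k (B m) os s \<and> inp s = drop m u @ v"
  have "triple (\<lambda>s. ?I 0 s \<and> mem s l = length u \<and> mem s 1 = 1) (read_array j l) (length u * (7 + 3) + 3)
    (\<lambda>s. ?I (length u) s \<and> mem s l = length u \<and> mem s 1 = 1)"
    unfolding read_array_def
  proof (rule triple_for_loop)
    fix i assume i: "i < length u"
    then have dr: "drop i u = u ! i # drop (Suc i) u" by (rule Cons_nth_drop_Suc[symmetric])
    show "triple (\<lambda>s. ?I i s \<and> mem s 5 = i \<and> mem s l = length u \<and> mem s 1 = 1)
      (Seq (Read 7) (astore j 5 7)) 7
      (\<lambda>s. ?I (Suc i) s \<and> mem s 5 = i \<and> mem s l = length u \<and> mem s 1 = 1)"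
      by (rule triple_loop_free) (use assms dr in \<open>auto simp: St_def B_Suc\<close>)
  qed (use assms in auto)
  then show ?thesis
    by (rule triple_weaken) (auto simp: B_def St_D)
qed

section \<open>Programs for local search\<close>

definition copy_array :: "nat \<Rightarrow> nat \<Rightarrow> prog" where
  "copy_array j j' = for_loop 5 2 6 (Seq (aload 7 j 5) (astore j' 5 7))"

text \<open>Only \<open>n\<close> entries are copied; agreement from \<open>n\<close> on makes the
  result an equation between whole arrays, which keeps later assertions simple.\<close>

lemma triple_copy_array:
  assumes "j < 8" "j' < 8" "j \<noteq> j'" "\<And>i. n \<le> i \<Longrightarrow> A j i = A j' i"
  shows "triple (St n k A os) (copy_array j j') (n * 15 + 3) (St n k (A(j' := A j)) os)"
proof -
  define B where "B m = A(j' := \<lambda>i. if i < m then A j i else A j' i)" for m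
  have B_Suc: "(B m)(j' := (B m j')(m := B m j m)) = B (Suc m)" for m
    using assms(3) by (auto simp: B_def fun_eq_iff)
  have "triple (\<lambda>s. St n k (B 0) os s \<and> mem s 2 = n \<and> mem s 1 = 1) (copy_array j j') (n * (12 + 3) + 3)
    (\<lambda>s. St n k (B n) os s \<and> mem s 2 = n \<and> mem s 1 = 1)"
    unfolding copy_array_def
  proof (rule triple_for_loop)
    fix i
    show "triple (\<lambda>s. St n k (B i) os s \<and> mem s 5 = i \<and> mem s 2 = n \<and> mem s 1 = 1)
      (Seq (aload 7 j 5) (astore j' 5 7)) 12
      (\<lambda>s. St n k (B (Suc i)) os s \<and> mem s 5 = i \<and> mem s 2 = n \<and> mem s 1 = 1)"
      by (rule triple_loop_free) (use assms in \<open>auto simp: St_def B_Suc\<close>)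
  qed auto
  moreover have "B n = A(j' := A j)" "B 0 = A"
    using assms(4) by (auto simp: B_def fun_eq_iff)
  ultimately show ?thesis
    by (elim triple_weaken) (auto simp: St_D)
qed

text \<open>Repeated addition is linear in the value of the first factor. This is harmless: in the
  search this factor is at most \<open>n\<close>, and computing the program from \<epsilon> is
  subject to no time bound.\<close>

definition mul_prog :: "nat \<Rightarrow> nat \<Rightarrow> prog" where
  "mul_prog x y = Seq (Const 8 0) (for_loop 5 x 6 (Add 8 8 y))"

lemma triple_mul_prog:
  assumes x: "x \<notin> {5, 6, 8}" "x < 30" and y: "y \<notin> {5, 6, 8}" "y < 30"
    and P: "\<And>s r v. r \<in> {5, 6, 8} \<Longrightarrow> P s \<Longrightarrow> P (set_mem r v s)"
    and one: "\<And>s. P s \<Longrightarrow> mem s 1 = 1"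
  shows "triple (\<lambda>s. P s \<and> mem s x = a \<and> mem s y = b) (mul_prog x y) (a * 4 + 4)
    (\<lambda>s. P s \<and> mem s 8 = a * b)"
proof -
  have x1: "x \<noteq> 5" "x \<noteq> 6" "x \<noteq> 8" "y \<noteq> 5" "y \<noteq> 6" "y \<noteq> 8" using x y by auto
  let ?I = "\<lambda>i s. P s \<and> mem s y = b \<and> mem s 8 = i * b"
  have "triple (\<lambda>s. ?I 0 s \<and> mem s x = a \<and> mem s 1 = 1) (for_loop 5 x 6 (Add 8 8 y)) (a * (1 + 3) + 3)
    (\<lambda>s. ?I a s \<and> mem s x = a \<and> mem s 1 = 1)"
  proof (rule triple_for_loop)
    fix i
    show "triple (\<lambda>s. ?I i s \<and> mem s 5 = i \<and> mem s x = a \<and> mem s 1 = 1) (Add 8 8 y) 1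
      (\<lambda>s. ?I (Suc i) s \<and> mem s 5 = i \<and> mem s x = a \<and> mem s 1 = 1)"
      by (rule triple_loop_free) (use x1 P in auto)
  qed (use x1 P in auto)
  moreover have "triple (\<lambda>s. P s \<and> mem s x = a \<and> mem s y = b) (Const 8 0) 1
    (\<lambda>s. ?I 0 s \<and> mem s x = a \<and> mem s 1 = 1)"
    by (rule triple_loop_free) (use x1 P one in auto)
  ultimately have "triple (\<lambda>s. P s \<and> mem s x = a \<and> mem s y = b) (mul_prog x y) (1 + (a * (1 + 3) + 3))
    (\<lambda>s. ?I a s \<and> mem s x = a \<and> mem s 1 = 1)"
    unfolding mul_prog_def by (intro triple_Seq)
  then show ?thesis by (rule triple_weaken) auto
qed

text \<open>The elementary exchange on characteristic vectors: \<open>u\<close> enters and its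
  neighbours leave, \<open>M\<close> being the adjacency matrix stored row by row.\<close>

definition move :: "nat \<Rightarrow> (nat \<Rightarrow> nat) \<Rightarrow> nat \<Rightarrow> (nat \<Rightarrow> nat) \<Rightarrow> nat \<Rightarrow> nat" where
  "move n M u Y = (\<lambda>v. if v < n \<and> M (u * n + v) \<noteq> 0 then 0 else Y v)(u := 1)"

text \<open>Array 0 holds the vertex names, array 1 the adjacency matrix, array 2 the current
  solution, array 3 the candidate and array 4 the digits of the round counter. Register 10 tells
  which digit is the vertex to insert.\<close>

definition move_prog :: prog where
  "move_prog = Seq (aload 12 4 10) (Seq (mul_prog 12 2)
     (Seq (for_loop 5 2 6 (Seq (Add 13 8 5) (Seq (aload 7 1 13) (Cond 7 (astore 3 5 0) Skip))))
       (astore 3 12 1)))"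

lemma triple_move_prog:
  assumes "A 4 i \<le> n"
  shows "triple (\<lambda>s. St n k A os s \<and> mem s 10 = i) move_prog (n * 22 + 19)
    (\<lambda>s. St n k (A(3 := move n (A 1) (A 4 i) (A 3))) os s \<and> mem s 10 = i)"
proof -
  let ?u = "A 4 i"
  let ?P = "\<lambda>s. St n k A os s \<and> mem s 10 = i \<and> mem s 12 = ?u"
  define B where "B m = A(3 := \<lambda>v. if v < m \<and> A 1 (?u * n + v) \<noteq> 0 then 0 else A 3 v)" for m
  have B_Suc: "(B m)(3 := (B m 3)(m := 0)) = B (Suc m)" if "A (Suc 0) (?u * n + m) \<noteq> 0" for m
    using that by (auto simp: B_def fun_eq_iff less_Suc_eq)
  have B_Suc': "B (Suc m) = B m" if "A (Suc 0) (?u * n + m) = 0" for m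
    using that by (auto simp: B_def fun_eq_iff less_Suc_eq)
  have B1: "B m (Suc 0) = A (Suc 0)" for m by (simp add: B_def)
  let ?I = "\<lambda>m s. St n k (B m) os s \<and> mem s 10 = i \<and> mem s 12 = ?u \<and> mem s 8 = ?u * n"
  have load: "triple (\<lambda>s. St n k A os s \<and> mem s 10 = i) (aload 12 4 10) 6
    (\<lambda>s. ?P s \<and> mem s 12 = ?u \<and> mem s 2 = n)"
    by (rule triple_loop_free) (auto simp: St_def)
  have mul: "triple (\<lambda>s. ?P s \<and> mem s 12 = ?u \<and> mem s 2 = n) (mul_prog 12 2) (?u * 4 + 4)
      (\<lambda>s. ?P s \<and> mem s 8 = ?u * n)"
    by (rule triple_mul_prog) (auto simp: St_D)
  have kill: "triple (\<lambda>s. ?I 0 s \<and> mem s 2 = n \<and> mem s 1 = 1)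
    (for_loop 5 2 6 (Seq (Add 13 8 5) (Seq (aload 7 1 13) (Cond 7 (astore 3 5 0) Skip))))
    (n * (15 + 3) + 3) (\<lambda>s. ?I n s \<and> mem s 2 = n \<and> mem s 1 = 1)"
  proof (rule triple_for_loop)
    fix m
    show "triple (\<lambda>s. ?I m s \<and> mem s 5 = m \<and> mem s 2 = n \<and> mem s 1 = 1)
      (Seq (Add 13 8 5) (Seq (aload 7 1 13) (Cond 7 (astore 3 5 0) Skip))) 15
      (\<lambda>s. ?I (Suc m) s \<and> mem s 5 = m \<and> mem s 2 = n \<and> mem s 1 = 1)"
      by (rule triple_loop_free) (auto simp: St_def B_Suc B_Suc' B1)
  qed auto
  have store: "triple (\<lambda>s. ?I n s \<and> mem s 2 = n \<and> mem s 1 = 1) (astore 3 12 1) 6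
    (\<lambda>s. St n k (A(3 := move n (A 1) ?u (A 3))) os s \<and> mem s 10 = i)"
    by (rule triple_loop_free) (auto simp: St_def B_def move_def fun_eq_iff)
  have "B 0 = A" by (auto simp: B_def fun_eq_iff)
  then have mul': "triple (\<lambda>s. ?P s \<and> mem s 12 = ?u \<and> mem s 2 = n) (mul_prog 12 2) (n * 4 + 4)
      (\<lambda>s. ?I 0 s \<and> mem s 2 = n \<and> mem s 1 = 1)"
    using assms by (intro triple_weaken[OF mul]) (auto simp: St_D)
  have "triple (\<lambda>s. St n k A os s \<and> mem s 10 = i) move_prog
      (6 + (n * 4 + 4 + (n * (15 + 3) + 3 + 6)))
    (\<lambda>s. St n k (A(3 := move n (A 1) ?u (A 3))) os s \<and> mem s 10 = i)"
    unfolding move_prog_def by (intro triple_Seq[OF load] triple_Seq[OF mul'] triple_Seq[OF kill] store)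
  then show ?thesis by (rule triple_weaken) auto
qed

primrec moves :: "nat \<Rightarrow> (nat \<Rightarrow> nat) \<Rightarrow> (nat \<Rightarrow> nat) \<Rightarrow> nat \<Rightarrow> (nat \<Rightarrow> nat) \<Rightarrow> nat \<Rightarrow> nat" where
  "moves n M D 0 Y = Y"
| "moves n M D (Suc i) Y = move n M (D i) (moves n M D i Y)"

definition candidate_prog :: prog where
  "candidate_prog = Seq (copy_array 2 3) (for_loop 10 3 11 move_prog)"

lemma triple_candidate_prog:
  assumes D: "\<And>i. i < k \<Longrightarrow> A 4 i \<le> n" and out: "\<And>i. n \<le> i \<Longrightarrow> A 2 i = A 3 i"
  shows "triple (St n k A os) candidate_prog (n * 15 + 3 + (k * (n * 22 + 22) + 3))
    (St n k (A(3 := moves n (A 1) (A 4) k (A 2))) os)"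
  unfolding candidate_prog_def
proof (rule triple_Seq)
  define B where "B i = A(3 := moves n (A 1) (A 4) i (A 2))" for i
  show "triple (St n k A os) (copy_array 2 3) (n * 15 + 3) (St n k (B 0) os)"
    using triple_copy_array[of 2 3 n A k os] out by (simp add: B_def)
  have "triple (\<lambda>s. St n k (B 0) os s \<and> mem s 3 = k \<and> mem s 1 = 1) (for_loop 10 3 11 move_prog)
    (k * (n * 22 + 19 + 3) + 3) (\<lambda>s. St n k (B k) os s \<and> mem s 3 = k \<and> mem s 1 = 1)"
  proof (rule triple_for_loop)
    fix i assume i: "i < k"
    have *: "(B i)(3 := move n (B i 1) (B i 4 i) (B i 3)) = B (Suc i)" "B i 4 i \<le> n"
      using D[OF i] by (simp_all add: B_def)
    show "triple (\<lambda>s. St n k (B i) os s \<and> mem s 10 = i \<and> mem s 3 = k \<and> mem s 1 = 1)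
      move_prog (n * 22 + 19)
      (\<lambda>s. St n k (B (Suc i)) os s \<and> mem s 10 = i \<and> mem s 3 = k \<and> mem s 1 = 1)"
      by (rule triple_weaken[OF triple_move_prog[of "B i" i n k os, OF *(2), unfolded *(1)]]) (auto simp: St_D)
  qed auto
  then show "triple (St n k (B 0) os) (for_loop 10 3 11 move_prog) (k * (n * 22 + 22) + 3)
    (St n k (A(3 := moves n (A 1) (A 4) k (A 2))) os)"
    by (rule triple_weaken) (auto simp: St_D B_def)
qed

definition total :: "nat \<Rightarrow> (nat \<Rightarrow> nat) \<Rightarrow> nat" where
  "total n X = (\<Sum>v<n. X v)"

definition accept_prog :: prog where
  "accept_prog = Seq (Seq (Const 13 0) (Const 14 0))
     (Seq (for_loop 5 2 6
         (Seq (aload 7 2 5) (Seq (Add 13 13 7) (Seq (aload 7 3 5) (Add 14 14 7)))))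
       (Seq (Sub 14 14 13) (Cond 14 (copy_array 3 2) Skip)))"

lemma triple_accept_prog:
  assumes out: "\<And>i. n \<le> i \<Longrightarrow> A 2 i = A 3 i"
  shows "triple (St n k A os) accept_prog (n * 32 + 10)
    (St n k (A(2 := if total n (A 2) < total n (A 3) then A 3 else A 2)) os)"
proof -
  let ?I = "\<lambda>m s. St n k A os s \<and> mem s 13 = total m (A 2) \<and> mem s 14 = total m (A 3)"
  have init: "triple (St n k A os) (Seq (Const 13 0) (Const 14 0)) 2
    (\<lambda>s. ?I 0 s \<and> mem s 2 = n \<and> mem s 1 = 1)"
    by (rule triple_loop_free) (auto simp: St_D total_def)
  have sum: "triple (\<lambda>s. ?I 0 s \<and> mem s 2 = n \<and> mem s 1 = 1) (for_loop 5 2 6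
         (Seq (aload 7 2 5) (Seq (Add 13 13 7) (Seq (aload 7 3 5) (Add 14 14 7)))))
     (n * (14 + 3) + 3) (\<lambda>s. ?I n s \<and> mem s 2 = n \<and> mem s 1 = 1)"
  proof (rule triple_for_loop)
    fix m
    show "triple (\<lambda>s. ?I m s \<and> mem s 5 = m \<and> mem s 2 = n \<and> mem s 1 = 1)
      (Seq (aload 7 2 5) (Seq (Add 13 13 7) (Seq (aload 7 3 5) (Add 14 14 7)))) 14
      (\<lambda>s. ?I (Suc m) s \<and> mem s 5 = m \<and> mem s 2 = n \<and> mem s 1 = 1)"
      by (rule triple_loop_free) (auto simp: St_def total_def)
  qed auto
  let ?Q = "St n k (A(2 := if total n (A 2) < total n (A 3) then A 3 else A 2)) os"
  let ?R = "\<lambda>s. St n k A os s \<and> mem s 14 = total n (A 3) - total n (A 2)"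
  \<comment> \<open>The truncated difference is nonzero exactly if the candidate is strictly
    larger.\<close>
  have sub: "triple (\<lambda>s. ?I n s \<and> mem s 2 = n \<and> mem s 1 = 1) (Sub 14 14 13) 1 ?R"
    by (rule triple_loop_free) auto
  have cond: "triple ?R (Cond 14 (copy_array 3 2) Skip) (n * 15 + 3 + 1) ?Q"
  proof (rule triple_Cond)
    show "triple (\<lambda>s. ?R s \<and> mem s 14 \<noteq> 0) (copy_array 3 2) (n * 15 + 3) ?Q"
    proof (cases "total n (A 2) < total n (A 3)")
      case True
      have "triple (St n k A os) (copy_array 3 2) (n * 15 + 3) (St n k (A(2 := A 3)) os)"
        by (rule triple_copy_array) (use out in auto)
      then show ?thesis by (rule triple_weaken) (use True in auto)
    next
      case False
      then show ?thesis by (auto simp: triple_def)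
    qed
    show "triple (\<lambda>s. ?R s \<and> mem s 14 = 0) Skip (n * 15 + 3) ?Q"
      by (rule triple_loop_free) auto
  qed
  have "triple (St n k A os) accept_prog (2 + (n * (14 + 3) + 3 + (1 + (n * 15 + 3 + 1)))) ?Q"
    unfolding accept_prog_def by (intro triple_Seq[OF init] triple_Seq[OF sum] triple_Seq[OF sub] cond)
  then show ?thesis by (rule triple_weaken) auto
qed

section \<open>Counting in base n\<close>

definition digit :: "nat \<Rightarrow> nat \<Rightarrow> nat \<Rightarrow> nat" where
  "digit n c i = c div n ^ i mod n"

text \<open>A carry reaches position \<open>i\<close> exactly if \<open>n ^ i\<close> divides
  \<open>Suc c\<close>. The three parts are the rules of incrementing: the effect of a carry, its
  absence, and its passing on.\<close>

lemma digit_Suc: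
  assumes "0 < n"
  shows "n ^ i dvd Suc c \<Longrightarrow> digit n (Suc c) i = (if Suc (digit n c i) = n then 0 else Suc (digit n c i))"
    "\<not> n ^ i dvd Suc c \<Longrightarrow> digit n (Suc c) i = digit n c i"
    "n ^ Suc i dvd Suc c \<longleftrightarrow> n ^ i dvd Suc c \<and> Suc (digit n c i) = n"
proof -
  have 1: "Suc c div n ^ i = (if n ^ i dvd Suc c then Suc (c div n ^ i) else c div n ^ i)"
    by (simp add: div_Suc dvd_eq_mod_eq_0)
  show "n ^ i dvd Suc c \<Longrightarrow> digit n (Suc c) i = (if Suc (digit n c i) = n then 0 else Suc (digit n c i))"
    "\<not> n ^ i dvd Suc c \<Longrightarrow> digit n (Suc c) i = digit n c i"
    by (auto simp: digit_def 1 mod_Suc)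
  show "n ^ Suc i dvd Suc c \<longleftrightarrow> n ^ i dvd Suc c \<and> Suc (digit n c i) = n"
  proof (cases "n ^ i dvd Suc c")
    case True
    then obtain d where d: "Suc c = n ^ i * d" by (elim dvdE)
    have "n ^ Suc i dvd Suc c \<longleftrightarrow> n dvd d"
      unfolding d using assms by (simp add: mult.commute[of n])
    also have "d = Suc (c div n ^ i)" using 1 True assms d by simp
    finally show ?thesis using True assms
      by (auto simp: digit_def dvd_eq_mod_eq_0 mod_Suc)
  next
    case False
    then show ?thesis using dvd_trans[of "n ^ i" "n ^ Suc i" "Suc c"] by auto
  qed
qed

text \<open>One digit more than the \<open>k\<close> vertices of a tuple: the top one counts the
  \<open>n\<close> passes through all tuples. Zeros beyond let the blank array represent the counter
  0.\<close>

definition digits :: "nat \<Rightarrow> nat \<Rightarrow> nat \<Rightarrow> nat \<Rightarrow> nat" where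
  "digits n k c = (\<lambda>i. if i \<le> k then digit n c i else 0)"

text \<open>The carry sits in register 13. Register 9, the flag of the main loop, becomes 0 when a
  carry leaves the top digit.\<close>

definition count_prog :: prog where
  "count_prog = Seq (Const 13 1) (Seq (for_loop 5 4 6
     (Seq (aload 7 4 5) (Seq (Add 7 7 13) (Seq (Sub 13 2 7)
       (Seq (Cond 13 (Const 13 0) (Seq (Const 13 1) (Const 7 0))) (astore 4 5 7))))))
     (Sub 9 1 13))"

lemma triple_count_prog:
  assumes n: "0 < n"
  shows "triple (St n k (A(4 := digits n k c)) os) count_prog (Suc k * 21 + 5)
    (\<lambda>s. St n k (A(4 := digits n k (Suc c))) os s \<and> (mem s 9 = 0 \<longleftrightarrow> n ^ Suc k dvd Suc c))"
proof -
  define B where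
    "B m = A(4 := \<lambda>i. if i < m then digits n k (Suc c) i else digits n k c i)" for m
  have B_Suc: "(B m)(4 := (B m 4)(m := digit n (Suc c) m)) = B (Suc m)" if "m < Suc k" for m
    using that by (auto simp: B_def fun_eq_iff digits_def less_Suc_eq)
  have B4: "B m 4 m = digit n c m" if "m < Suc k" for m
    using that by (auto simp: B_def digits_def)
  let ?I = "\<lambda>m s. St n k (B m) os s \<and> mem s 13 = (if n ^ m dvd Suc c then 1 else 0)"
  have init: "triple (St n k (A(4 := digits n k c)) os) (Const 13 1) 1
    (\<lambda>s. ?I 0 s \<and> mem s 4 = Suc k \<and> mem s 1 = 1)"
    by (rule triple_loop_free) (auto simp: St_D B_def)
  have loop: "triple (\<lambda>s. ?I 0 s \<and> mem s 4 = Suc k \<and> mem s 1 = 1) (for_loop 5 4 6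
     (Seq (aload 7 4 5) (Seq (Add 7 7 13) (Seq (Sub 13 2 7)
       (Seq (Cond 13 (Const 13 0) (Seq (Const 13 1) (Const 7 0))) (astore 4 5 7))))))
    (Suc k * (18 + 3) + 3) (\<lambda>s. ?I (Suc k) s \<and> mem s 4 = Suc k \<and> mem s 1 = 1)"
  proof (rule triple_for_loop)
    fix m assume m: "m < Suc k"
    have lt: "digit n c m < n" using n by (simp add: digit_def)
    show "triple (\<lambda>s. ?I m s \<and> mem s 5 = m \<and> mem s 4 = Suc k \<and> mem s 1 = 1)
      (Seq (aload 7 4 5) (Seq (Add 7 7 13) (Seq (Sub 13 2 7)
       (Seq (Cond 13 (Const 13 0) (Seq (Const 13 1) (Const 7 0))) (astore 4 5 7))))) 18
      (\<lambda>s. ?I (Suc m) s \<and> mem s 5 = m \<and> mem s 4 = Suc k \<and> mem s 1 = 1)"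
      by (rule triple_loop_free)
        (use lt m digit_Suc[OF n, of m c] in \<open>auto simp: St_def B_Suc[symmetric] B4 simp del: power_Suc split: if_splits\<close>)
  qed auto
  have final: "triple (\<lambda>s. ?I (Suc k) s \<and> mem s 4 = Suc k \<and> mem s 1 = 1) (Sub 9 1 13) 1
    (\<lambda>s. St n k (A(4 := digits n k (Suc c))) os s \<and> (mem s 9 = 0 \<longleftrightarrow> n ^ Suc k dvd Suc c))"
  proof -
    have "B (Suc k) = A(4 := digits n k (Suc c))"
      by (auto simp: B_def digits_def fun_eq_iff)
    then show ?thesis by (intro triple_loop_free) (auto simp: St_D)
  qed
  have "triple (St n k (A(4 := digits n k c)) os) count_prog (1 + (Suc k * (18 + 3) + 3 + 1))
    (\<lambda>s. St n k (A(4 := digits n k (Suc c))) os s \<and> (mem s 9 = 0 \<longleftrightarrow> n ^ Suc k dvd Suc c))"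
    unfolding count_prog_def by (intro triple_Seq[OF init] triple_Seq[OF loop] final)
  then show ?thesis by (rule triple_weaken) auto
qed

section \<open>Local search on vertex indices\<close>

text \<open>Multiples of \<open>n ^ k\<close> affect only the digits from position \<open>k\<close>
  on, so each block of \<open>n ^ k\<close> rounds tries the same tuples.\<close>

lemma digit_add_multiple:
  assumes "i < k" "0 < n"
  shows "digit n (p * n ^ k + c) i = digit n c i"
proof -
  have "n ^ k = n ^ i * (n * n ^ (k - Suc i))"
    using assms(1) by (simp flip: power_Suc power_add)
  then have "p * n ^ k + c = c + n ^ i * (n * (p * n ^ (k - Suc i)))"
    by (simp add: algebra_simps)
  then have "(p * n ^ k + c) div n ^ i = c div n ^ i + n * (p * n ^ (k - Suc i))"
    using assms(2) by (simp only:) (simp add: add.commute)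
  then show ?thesis by (simp add: digit_def)
qed

lemma ex_digits:
  assumes "\<And>i. i < k \<Longrightarrow> d i < n" "0 < n"
  shows "\<exists>c<n ^ k. \<forall>i<k. digit n c i = d i"
  using assms(1)
proof (induction k)
  case (Suc k)
  then obtain c where c: "c < n ^ k" "\<forall>i<k. digit n c i = d i" by auto
  have dk: "d k < n" using Suc.prems by simp
  let ?c = "d k * n ^ k + c"
  have "?c < Suc (d k) * n ^ k" using c(1) by simp
  also have "\<dots> \<le> n * n ^ k" using dk by (intro mult_le_mono1) simp
  finally have "?c < n ^ Suc k" by simp
  moreover have "digit n ?c i = d i" if i: "i < Suc k" for i
  proof (cases "i < k")
    case True
    then show ?thesis using digit_add_multiple[OF True assms(2)] c(2) by simp
  next
    case False
    then have "i = k" using i by simp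
    then show ?thesis using c(1) dk assms(2) by (simp add: digit_def)
  qed
  ultimately show ?case by blast
qed simp

text \<open>One-by-one insertion keeps the set independent for arbitrary tuples, so the program can
  skip testing them. If the tuple is independent, no inserted vertex is removed again and the result
  is the intended exchange.\<close>

primrec insertions :: "(nat \<Rightarrow> nat set) \<Rightarrow> (nat \<Rightarrow> nat) \<Rightarrow> nat \<Rightarrow> nat set \<Rightarrow> nat set" where
  "insertions nb d 0 S = S"
| "insertions nb d (Suc i) S = insert (d i) (insertions nb d i S - nb (d i))"

primrec search :: "nat \<Rightarrow> (nat \<Rightarrow> nat set) \<Rightarrow> nat \<Rightarrow> nat \<Rightarrow> nat set" where
  "search n nb k 0 = {}"
| "search n nb k (Suc c) = (let S = search n nb k c; Y = insertions nb (digit n c) k S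
     in if card S < card Y then Y else S)"

lemma insertions_cong: "(\<And>i. i < k \<Longrightarrow> d i = d' i) \<Longrightarrow> insertions nb d k S = insertions nb d' k S"
  by (induction k) auto

lemma insertions_subset:
  "(\<And>i. i < k \<Longrightarrow> d i < n) \<Longrightarrow> S \<subseteq> {..<n} \<Longrightarrow> insertions nb d k S \<subseteq> {..<n}"
  by (induction k) auto

lemma insertions_independent:
  assumes sym: "\<And>u v. v \<in> nb u \<Longrightarrow> u \<in> nb v" and irr: "\<And>u. u \<notin> nb u"
    and S: "\<And>u v. u \<in> S \<Longrightarrow> v \<in> S \<Longrightarrow> v \<notin> nb u"
  shows "u \<in> insertions nb d k S \<Longrightarrow> v \<in> insertions nb d k S \<Longrightarrow> v \<notin> nb u"
proof (induction k arbitrary: u v)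
  case (Suc k)
  then show ?case using sym irr by (auto dest: sym)
qed (use S in auto)

lemma insertions_eq:
  assumes "\<And>i j. i < k \<Longrightarrow> j < k \<Longrightarrow> d i \<notin> nb (d j)"
  shows "insertions nb d k S = d ` {..<k} \<union> (S - (\<Union>i<k. nb (d i)))"
  using assms
proof (induction k)
  case (Suc k)
  then have "insertions nb d k S = d ` {..<k} \<union> (S - (\<Union>i<k. nb (d i)))" by simp
  then show ?case using Suc.prems by (auto simp: lessThan_Suc)
qed simp

lemma search_subset:
  assumes "0 < n"
  shows "search n nb k c \<subseteq> {..<n}"
proof (induction c)
  case (Suc c)
  have "insertions nb (digit n c) k (search n nb k c) \<subseteq> {..<n}"
    by (rule insertions_subset) (use assms Suc in \<open>auto simp: digit_def\<close>)
  then show ?case using Suc by (simp add: Let_def)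
qed simp

lemma search_independent:
  assumes sym: "\<And>u v. v \<in> nb u \<Longrightarrow> u \<in> nb v" and irr: "\<And>u. u \<notin> nb u"
  shows "u \<in> search n nb k c \<Longrightarrow> v \<in> search n nb k c \<Longrightarrow> v \<notin> nb u"
proof (induction c arbitrary: u v)
  case (Suc c)
  show ?case
  proof (cases "card (search n nb k c) < card (insertions nb (digit n c) k (search n nb k c))")
    case True
    let ?Y = "insertions nb (digit n c) k (search n nb k c)"
    have uv: "u \<in> ?Y" "v \<in> ?Y" using Suc.prems True by simp_all
    show ?thesis by (rule insertions_independent[OF sym irr Suc.IH uv])
  next
    case False
    then show ?thesis using Suc by simp
  qed
qed simp

lemma search_card_mono: "c \<le> c' \<Longrightarrow> card (search n nb k c) \<le> card (search n nb k c')"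
  by (rule lift_Suc_mono_le[of "\<lambda>c. card (search n nb k c)"]) (auto simp: Let_def)

text \<open>The solution changes only by growing, so equal sizes at both ends exclude any change in
  between.\<close>

lemma search_eq_if_card_eq:
  "card (search n nb k (c + j)) = card (search n nb k c) \<Longrightarrow> search n nb k (c + j) = search n nb k c"
proof (induction j)
  case (Suc j)
  have "card (search n nb k (c + j)) = card (search n nb k c)"
    using search_card_mono[of c "c + j" n nb k] search_card_mono[of "c + j" "c + Suc j" n nb k] Suc.prems
    by simp
  with Suc show ?case by (auto simp: Let_def split: if_splits)
qed simp

definition locally_optimal :: "nat \<Rightarrow> (nat \<Rightarrow> nat set) \<Rightarrow> nat \<Rightarrow> nat set \<Rightarrow> bool" where
  "locally_optimal n nb k S \<longleftrightarrow>
    (\<forall>d. (\<forall>i<k. d i < n) \<longrightarrow> card (insertions nb d k S) \<le> card S)"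

lemma search_stable:
  assumes "locally_optimal n nb k (search n nb k c)" "0 < n"
  shows "search n nb k (c + j) = search n nb k c"
proof (induction j)
  case (Suc j)
  have "card (insertions nb (digit n (c + j)) k (search n nb k c)) \<le> card (search n nb k c)"
    using assms unfolding locally_optimal_def by (auto simp: digit_def)
  with Suc show ?case by (simp add: Let_def)
qed simp

text \<open>Each block of \<open>n ^ k\<close> rounds tries all \<open>k\<close>-tuples of vertices, so that it either
  improves the solution or certifies local optimality; there are at most \<open>n\<close> improvements.\<close>

lemma search_locally_optimal:
  assumes n: "0 < n"
  shows "locally_optimal n nb k (search n nb k (n ^ Suc k))"
proof -
  let ?S = "search n nb k"
  have block: "locally_optimal n nb k (?S (p * n ^ k)) \<or> p \<le> card (?S (p * n ^ k))" for p
  proof (induction p)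
    case (Suc p)
    let ?c = "p * n ^ k"
    have c': "Suc p * n ^ k = ?c + n ^ k" by simp
    show ?case
    proof (cases "locally_optimal n nb k (?S ?c)")
      case True
      then show ?thesis using search_stable[OF True n, of "n ^ k"] by (simp add: add.commute)
    next
      case False
      then have p: "p \<le> card (?S ?c)" using Suc by simp
      have le: "card (?S ?c) \<le> card (?S (?c + n ^ k))" by (rule search_card_mono) simp
      show ?thesis
      proof (cases "card (?S (?c + n ^ k)) = card (?S ?c)")
        case True
        have same: "?S (?c + j) = ?S ?c" if j: "j \<le> n ^ k" for j
        proof (rule search_eq_if_card_eq)
          show "card (?S (?c + j)) = card (?S ?c)"
            using search_card_mono[of "?c" "?c + j" n nb k]
              search_card_mono[of "?c + j" "?c + n ^ k" n nb k] True j by simp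
        qed
        have "locally_optimal n nb k (?S ?c)"
          unfolding locally_optimal_def
        proof (intro allI impI)
          fix d assume "\<forall>i<k. d i < n"
          then obtain j where j: "j < n ^ k" "\<forall>i<k. digit n j i = d i"
            using ex_digits[of k d n] n by blast
          have ins: "insertions nb (digit n (?c + j)) k (?S ?c) = insertions nb d k (?S ?c)"
            using digit_add_multiple[OF _ n] j(2) by (intro insertions_cong) simp
          have "?S (?c + Suc j) = ?S ?c" "?S (?c + j) = ?S ?c"
            by (rule same; use j(1) in simp)+
          then show "card (insertions nb d k (?S ?c)) \<le> card (?S ?c)"
            using ins by (auto simp: Let_def split: if_splits)
        qed
        with False show ?thesis by blast
      next
        case False
        then have "Suc p \<le> card (?S (?c + n ^ k))" using p le by linarith
        then show ?thesis unfolding c' by blast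
      qed
    qed
  qed simp
  \<comment> \<open>After \<open>n\<close> blocks the set is locally optimal or has \<open>n\<close>
    elements; in the latter case no candidate inside \<open>{..<n}\<close> is larger.\<close>
  have "locally_optimal n nb k (?S (n * n ^ k))"
  proof (rule ccontr)
    assume not: "\<not> ?thesis"
    then have "n \<le> card (?S (n * n ^ k))" using block[of n] by blast
    moreover have "card (insertions nb d k (?S (n * n ^ k))) \<le> n" if "\<forall>i<k. d i < n" for d
      using card_mono[OF _ insertions_subset[of k d n "?S (n * n ^ k)" nb]] that search_subset[OF n]
      by simp
    ultimately show False using not unfolding locally_optimal_def by (meson order_trans)
  qed
  then show ?thesis by simp
qed

lemma locally_optimal_swap:
  assumes opt: "locally_optimal n nb k S" and T: "T \<subseteq> {..<n}" "T \<noteq> {}" "card T \<le> k"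
    and indep: "\<And>u v. u \<in> T \<Longrightarrow> v \<in> T \<Longrightarrow> v \<notin> nb u"
  shows "card (T \<union> (S - (\<Union>u\<in>T. nb u))) \<le> card S"
proof -
  have fin: "finite T" using T(1) finite_subset by blast
  then have c0: "0 < card T" using T(2) by (simp add: card_gt_0_iff)
  obtain f where f: "bij_betw f {..<card T} T"
    using ex_bij_betw_nat_finite[OF fin] by (auto simp: lessThan_atLeast0)
  \<comment> \<open>A tuple has exactly \<open>k\<close> entries; the surplus positions repeat one
    vertex of the nonempty \<open>T\<close>, which does not change the set inserted.\<close>
  define d where "d i = f (if i < card T then i else 0)" for i
  have d_in: "d i \<in> T" for i
    using bij_betw_apply[OF f] c0 by (simp add: d_def)
  have "d ` {..<k} = T"
  proof
    show "d ` {..<k} \<subseteq> T" using d_in by blast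
    have "f ` {..<card T} \<subseteq> d ` {..<k}" using T(3) by (auto simp: d_def image_iff)
    then show "T \<subseteq> d ` {..<k}" using bij_betw_imp_surj_on[OF f] by simp
  qed
  moreover from this have "(\<Union>i<k. nb (d i)) = (\<Union>u\<in>T. nb u)" by blast
  moreover have "insertions nb d k S = d ` {..<k} \<union> (S - (\<Union>i<k. nb (d i)))"
    by (rule insertions_eq) (use indep d_in in blast)
  moreover have "card (insertions nb d k S) \<le> card S"
    using opt d_in T(1) unfolding locally_optimal_def by blast
  ultimately show ?thesis by simp
qed

section \<open>Characteristic vectors and the main loop\<close>

definition charfun :: "nat set \<Rightarrow> nat \<Rightarrow> nat" where
  "charfun S v = (if v \<in> S then 1 else 0)"

definition nbrs :: "nat \<Rightarrow> (nat \<Rightarrow> nat) \<Rightarrow> nat \<Rightarrow> nat set" where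
  "nbrs n M u = {v. v < n \<and> M (u * n + v) \<noteq> 0}"

lemma moves_charfun: "moves n M d k (charfun S) = charfun (insertions (nbrs n M) d k S)"
  by (induction k) (auto simp: move_def charfun_def nbrs_def fun_eq_iff)

lemma total_charfun:
  assumes "S \<subseteq> {..<n}"
  shows "total n (charfun S) = card S"
proof -
  have "total n (charfun S) = (\<Sum>v\<in>{..<n} \<inter> S. 1)"
    unfolding total_def by (subst sum.inter_restrict) (simp_all add: charfun_def)
  also have "{..<n} \<inter> S = S" using assms by blast
  finally show ?thesis by simp
qed

definition search_prog :: prog where
  "search_prog = While 9 (Seq candidate_prog (Seq accept_prog count_prog))"

definition round_time :: "nat \<Rightarrow> nat \<Rightarrow> nat" where
  "round_time k n = n * 15 + 3 + (k * (n * 22 + 22) + 3) + (n * 32 + 10 + (Suc k * 21 + 5))"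

text \<open>The flag in register 9 starts as \<open>n\<close>: an empty graph has no rounds,
  otherwise the flag stays nonzero until \<open>count_prog\<close> reports the end. The candidate
  array is left existential, since only its zeros from \<open>n\<close> on matter to the next
  round.\<close>

lemma triple_search_prog:
  fixes n k :: nat and A :: "nat \<Rightarrow> nat \<Rightarrow> nat"
  defines "S \<equiv> search n (nbrs n (A 1)) k"
  assumes A: "A 2 = (\<lambda>_. 0)" "A 3 = (\<lambda>_. 0)" "A 4 = (\<lambda>_. 0)"
  shows "triple (\<lambda>s. St n k A os s \<and> mem s 9 = n) search_prog (n ^ Suc k * (round_time k n + 1) + 1)
    (\<lambda>s. \<exists>B. B 0 = A 0 \<and> B 2 = charfun (S (n ^ Suc k)) \<and> St n k B os s)"
proof -
  let ?nb = "nbrs n (A 1)"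
  define B where "B c Y = A(2 := charfun (S c), 3 := Y, 4 := digits n k c)" for c Y
  define J where "J c s \<longleftrightarrow> (\<exists>Y. (\<forall>i\<ge>n. Y i = 0) \<and> St n k (B c Y) os s) \<and>
    (mem s 9 = 0 \<longleftrightarrow> \<not> c < n ^ Suc k)" for c s
  have "triple (J 0) search_prog (n ^ Suc k * (round_time k n + 1) + 1) (J (n ^ Suc k))"
    unfolding search_prog_def
  proof (rule triple_While)
    fix c assume c: "c < n ^ Suc k"
    then have n: "0 < n" by (cases n) auto
    have sub: "S c \<subseteq> {..<n}" unfolding S_def by (rule search_subset[OF n])
    define Z where "Z = insertions ?nb (digit n c) k (S c)"
    have Zsub: "Z \<subseteq> {..<n}"
      unfolding Z_def by (rule insertions_subset) (use sub n in \<open>auto simp: digit_def\<close>)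
    have mv: "moves n (A 1) (digits n k c) k (charfun (S c)) = charfun Z"
      unfolding moves_charfun Z_def
      by (intro arg_cong[where f = charfun] insertions_cong) (simp add: digits_def)
    have "triple (\<lambda>s. \<exists>Y. (\<forall>i\<ge>n. Y i = 0) \<and> St n k (B c Y) os s)
        (Seq candidate_prog (Seq accept_prog count_prog)) (round_time k n) (J (Suc c))"
    proof (rule triple_ex)
      fix Y
      show "triple (\<lambda>s. (\<forall>i\<ge>n. Y i = 0) \<and> St n k (B c Y) os s)
        (Seq candidate_prog (Seq accept_prog count_prog)) (round_time k n) (J (Suc c))"
      proof (cases "\<forall>i\<ge>n. Y i = (0::nat)")
        case True
        have out: "charfun (S c) i = 0" "charfun Z i = 0" if "n \<le> i" for i
          using sub Zsub that by (auto simp: charfun_def)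
        have cand: "triple (St n k (B c Y) os) candidate_prog (n * 15 + 3 + (k * (n * 22 + 22) + 3))
          (St n k (B c (charfun Z)) os)"
        proof -
          have "(B c Y)(3 := moves n (B c Y 1) (B c Y 4) k (B c Y 2)) = B c (charfun Z)"
            using mv by (simp add: B_def fun_eq_iff)
          moreover have "triple (St n k (B c Y) os) candidate_prog (n * 15 + 3 + (k * (n * 22 + 22) + 3))
              (St n k ((B c Y)(3 := moves n (B c Y 1) (B c Y 4) k (B c Y 2))) os)"
            by (rule triple_candidate_prog) (use n True out in \<open>auto simp: B_def digits_def digit_def less_imp_le\<close>)
          ultimately show ?thesis by simp
        qed
        have acc: "triple (St n k (B c (charfun Z)) os) accept_prog (n * 32 + 10)
          (St n k ((B (Suc c) (charfun Z))(4 := digits n k c)) os)"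
        proof -
          have "S (Suc c) = (if card (S c) < card Z then Z else S c)"
            by (simp add: S_def Z_def Let_def)
          then have "(B c (charfun Z))(2 := if total n (B c (charfun Z) 2) < total n (B c (charfun Z) 3)
              then B c (charfun Z) 3 else B c (charfun Z) 2) = (B (Suc c) (charfun Z))(4 := digits n k c)"
            using sub Zsub by (auto simp: B_def fun_eq_iff total_charfun)
          moreover have "triple (St n k (B c (charfun Z)) os) accept_prog (n * 32 + 10)
             (St n k ((B c (charfun Z))(2 := if total n (B c (charfun Z) 2) < total n (B c (charfun Z) 3)
              then B c (charfun Z) 3 else B c (charfun Z) 2)) os)"
            by (rule triple_accept_prog) (use out in \<open>auto simp: B_def\<close>)
          ultimately show ?thesis by simp
        qed
        \<comment> \<open>As \<open>c\<close> is below \<open>n ^ Suc k\<close>, this divisibility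
          singles out the last round.\<close>
        have "n ^ Suc k dvd Suc c \<longleftrightarrow> \<not> Suc c < n ^ Suc k"
        proof
          assume "n ^ Suc k dvd Suc c"
          then show "\<not> Suc c < n ^ Suc k" using dvd_imp_le[of "n ^ Suc k" "Suc c"] by linarith
        next
          assume "\<not> Suc c < n ^ Suc k"
          then have "Suc c = n ^ Suc k" using c by linarith
          then show "n ^ Suc k dvd Suc c" by simp
        qed
        then have count: "triple (St n k ((B (Suc c) (charfun Z))(4 := digits n k c)) os) count_prog
            (Suc k * 21 + 5) (J (Suc c))"
        proof (intro triple_weaken[OF triple_count_prog[OF n]])
          fix s
          have "(B (Suc c) (charfun Z))(4 := digits n k (Suc c)) = B (Suc c) (charfun Z)"
            by (simp add: B_def)
          moreover assume "St n k ((B (Suc c) (charfun Z))(4 := digits n k (Suc c))) os s \<and>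
            (mem s 9 = 0 \<longleftrightarrow> n ^ Suc k dvd Suc c)"
          ultimately have "(\<forall>i\<ge>n. charfun Z i = 0) \<and> St n k (B (Suc c) (charfun Z)) os s"
            "mem s 9 = 0 \<longleftrightarrow> \<not> Suc c < n ^ Suc k"
            using out(2) \<open>n ^ Suc k dvd Suc c \<longleftrightarrow> _\<close> by simp_all
          then show "J (Suc c) s" unfolding J_def by blast
        qed simp_all
        have "triple (St n k (B c Y) os) (Seq candidate_prog (Seq accept_prog count_prog))
            (n * 15 + 3 + (k * (n * 22 + 22) + 3) + (n * 32 + 10 + (Suc k * 21 + 5))) (J (Suc c))"
          by (intro triple_Seq[OF cand] triple_Seq[OF acc] count)
        then show ?thesis by (rule triple_weaken) (auto simp: round_time_def)
      qed (auto simp: triple_def)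
    qed
    then show "triple (J c) (Seq candidate_prog (Seq accept_prog count_prog)) (round_time k n) (J (Suc c))"
      by (rule triple_weaken) (auto simp: J_def)
  qed (auto simp: J_def)
  then show ?thesis
  proof (rule triple_weaken)
    fix s assume s: "St n k A os s \<and> mem s 9 = n"
    have "B 0 (\<lambda>_. 0) = A"
      using A by (auto simp: B_def S_def charfun_def digits_def digit_def fun_eq_iff)
    with s show "J 0 s" unfolding J_def by (auto intro!: exI[of _ "\<lambda>_. 0"])
  next
    fix s assume "J (n ^ Suc k) s"
    then obtain Y where "St n k (B (n ^ Suc k) Y) os s" by (auto simp: J_def)
    then show "\<exists>B. B 0 = A 0 \<and> B 2 = charfun (S (n ^ Suc k)) \<and> St n k B os s"
      by (intro exI[of _ "B (n ^ Suc k) Y"]) (simp add: B_def)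
  qed simp
qed

definition output_prog :: prog where
  "output_prog = for_loop 5 2 6 (Seq (aload 7 2 5) (Cond 7 (Seq (aload 7 0 5) (Write 7)) Skip))"

lemma triple_output_prog:
  "triple (St n k A []) output_prog (n * 18 + 3)
    (\<lambda>s. outp s = map (A 0) (filter (\<lambda>v. A 2 v \<noteq> 0) [0..<n]))"
proof -
  let ?I = "\<lambda>m. St n k A (map (A 0) (filter (\<lambda>v. A 2 v \<noteq> 0) [0..<m]))"
  have "triple (\<lambda>s. ?I 0 s \<and> mem s 2 = n \<and> mem s 1 = 1) output_prog (n * (15 + 3) + 3)
    (\<lambda>s. ?I n s \<and> mem s 2 = n \<and> mem s 1 = 1)"
    unfolding output_prog_def
  proof (rule triple_for_loop)
    fix m
    show "triple (\<lambda>s. ?I m s \<and> mem s 5 = m \<and> mem s 2 = n \<and> mem s 1 = 1)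
      (Seq (aload 7 2 5) (Cond 7 (Seq (aload 7 0 5) (Write 7)) Skip)) 15
      (\<lambda>s. ?I (Suc m) s \<and> mem s 5 = m \<and> mem s 2 = n \<and> mem s 1 = 1)"
      by (rule triple_loop_free) (auto simp: St_def)
  qed auto
  then show ?thesis by (rule triple_weaken) (auto simp: St_def)
qed

definition mis_prog :: prog where
  "mis_prog = Seq (Seq (Const 1 1) (Seq (Add 4 3 1) (Read 2)))
    (Seq (read_array 0 2) (Seq (mul_prog 2 2) (Seq (read_array 1 8)
      (Seq (Add 9 2 0) (Seq search_prog output_prog)))))"

text \<open>The parameter enters through one leading instruction, so the code is a fixed list except
  for a single number.\<close>

definition mis_alg :: "nat \<Rightarrow> prog" where
  "mis_alg k = Seq (Const 3 k) mis_prog"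

definition mis_time :: "nat \<Rightarrow> nat \<Rightarrow> nat" where
  "mis_time k n = 1 + (3 + ((n * 10 + 3) + ((n * 4 + 4) + ((n * n * 10 + 3) + (1 +
     ((n ^ Suc k * (round_time k n + 1) + 1) + (n * 18 + 3)))))))"

lemma triple_mis_alg:
  fixes n :: nat and names bits :: "nat list"
  assumes names: "length names = n" and bits: "length bits = n * n"
  defines "M \<equiv> \<lambda>i. if i < n * n then bits ! i else 0"
  shows "triple (\<lambda>s. s = \<lparr>mem = \<lambda>_. 0, inp = n # names @ bits, outp = []\<rparr>) (mis_alg k) (mis_time k n)
    (\<lambda>s. outp s = map ((!) names) (filter (\<lambda>v. v \<in> search n (nbrs n M) k (n ^ Suc k)) [0..<n]))"
proof -
  define A0 where "A0 = (\<lambda>(_::nat) (_::nat). 0::nat)"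
  define A1 where "A1 = A0(0 := \<lambda>i. if i < n then names ! i else 0)"
  define A2 where "A2 = A1(1 := M)"
  let ?S = "search n (nbrs n M) k (n ^ Suc k)"
  have c: "triple (\<lambda>s. s = \<lparr>mem = \<lambda>_. 0, inp = n # names @ bits, outp = []\<rparr>) (Const 3 k) 1
    (\<lambda>s. mem s = (\<lambda>_. 0)(3 := k) \<and> inp s = n # names @ bits \<and> outp s = [])"
    by (rule triple_loop_free) (auto simp: set_mem_def)
  have i: "triple (\<lambda>s. mem s = (\<lambda>_. 0)(3 := k) \<and> inp s = n # names @ bits \<and> outp s = [])
      (Seq (Const 1 1) (Seq (Add 4 3 1) (Read 2))) 3
      (\<lambda>s. St n k A0 [] s \<and> inp s = names @ bits \<and> mem s 2 = length names)"
    by (rule triple_loop_free) (auto simp: St_def A0_def arr_def cell_def names fun_eq_iff)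
  have r1: "triple (\<lambda>s. St n k A0 [] s \<and> inp s = names @ bits \<and> mem s 2 = length names)
      (read_array 0 2) (n * 10 + 3) (\<lambda>s. (St n k A1 [] s \<and> inp s = bits) \<and> mem s 2 = n \<and> mem s 2 = n)"
  proof (rule triple_weaken[OF triple_read_array[of 0 2 n k A0 "[]" names bits]])
    have "A0(0 := \<lambda>i. if i < length names then names ! i else A0 0 i) = A1"
      unfolding A1_def A0_def names ..
    then show "St n k (A0(0 := \<lambda>i. if i < length names then names ! i else A0 0 i)) [] s \<and> inp s = bits
      \<Longrightarrow> (St n k A1 [] s \<and> inp s = bits) \<and> mem s 2 = n \<and> mem s 2 = n" for s
      by (auto simp: St_def)
  qed (simp_all add: names)
  have m: "triple (\<lambda>s. (St n k A1 [] s \<and> inp s = bits) \<and> mem s 2 = n \<and> mem s 2 = n) (mul_prog 2 2)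
     (n * 4 + 4) (\<lambda>s. (St n k A1 [] s \<and> inp s = bits) \<and> mem s 8 = n * n)"
    by (rule triple_mul_prog) (auto simp: St_D)
  have r2: "triple (\<lambda>s. (St n k A1 [] s \<and> inp s = bits) \<and> mem s 8 = n * n) (read_array 1 8)
     (n * n * 10 + 3) (St n k A2 [])"
  proof (rule triple_weaken[OF triple_read_array[of 1 8 n k A1 "[]" bits "[]"]])
    have "A1(1 := \<lambda>i. if i < length bits then bits ! i else A1 1 i) = A2"
      unfolding A2_def A1_def A0_def M_def bits by (simp add: fun_eq_iff)
    then show "St n k (A1(1 := \<lambda>i. if i < length bits then bits ! i else A1 1 i)) [] s \<and> inp s = []
      \<Longrightarrow> St n k A2 [] s" for s
      by simp
  qed (simp_all add: bits)
  have f: "triple (St n k A2 []) (Add 9 2 0) 1 (\<lambda>s. St n k A2 [] s \<and> mem s 9 = n)"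
    by (rule triple_loop_free) (auto simp: St_D)
  have A2: "A2 1 = M" "A2 0 = (\<lambda>i. if i < n then names ! i else 0)"
    by (simp_all add: A2_def A1_def)
  have s: "triple (\<lambda>s. St n k A2 [] s \<and> mem s 9 = n) search_prog (n ^ Suc k * (round_time k n + 1) + 1)
    (\<lambda>s. \<exists>B. B 0 = A2 0 \<and> B 2 = charfun ?S \<and> St n k B [] s)"
    unfolding A2(1)[symmetric] by (rule triple_search_prog) (simp_all add: A2_def A1_def A0_def)
  have o: "triple (\<lambda>s. \<exists>B. B 0 = A2 0 \<and> B 2 = charfun ?S \<and> St n k B [] s) output_prog (n * 18 + 3)
    (\<lambda>s. outp s = map ((!) names) (filter (\<lambda>v. v \<in> ?S) [0..<n]))"
  proof (rule triple_ex)
    fix B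
    show "triple (\<lambda>s. B 0 = A2 0 \<and> B 2 = charfun ?S \<and> St n k B [] s) output_prog (n * 18 + 3)
      (\<lambda>s. outp s = map ((!) names) (filter (\<lambda>v. v \<in> ?S) [0..<n]))"
    proof (cases "B 0 = A2 0 \<and> B 2 = charfun ?S")
      case True
      then have "map (B 0) (filter (\<lambda>v. B 2 v \<noteq> 0) [0..<n]) = map ((!) names) (filter (\<lambda>v. v \<in> ?S) [0..<n])"
        unfolding A2(2) by (simp add: charfun_def)
      with triple_output_prog[of n k B] have "triple (St n k B []) output_prog (n * 18 + 3)
          (\<lambda>s. outp s = map ((!) names) (filter (\<lambda>v. v \<in> ?S) [0..<n]))" by simp
      then show ?thesis by (rule triple_weaken) auto
    qed (auto simp: triple_def)
  qed
  show ?thesis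
    unfolding mis_alg_def mis_prog_def mis_time_def
    by (intro triple_Seq[OF c] triple_Seq[OF i] triple_Seq[OF r1] triple_Seq[OF m] triple_Seq[OF r2] triple_Seq[OF f]
      triple_Seq[OF s] o)
qed

section \<open>The approximation scheme\<close>

lemma nth_concat_rows:
  assumes "\<And>x. x \<in> set xs \<Longrightarrow> length (f x) = m"
  shows "i < length xs \<Longrightarrow> j < m \<Longrightarrow> concat (map f xs) ! (i * m + j) = f (xs ! i) ! j"
  using assms
proof (induction xs arbitrary: i)
  case (Cons x xs)
  have "length (f x) = m" using Cons.prems by simp
  then show ?case using Cons by (cases i) (auto simp: nth_append)
qed simp

lemma length_concat_rows: "length (concat (map (\<lambda>x. map (g x) ys) xs)) = length xs * length ys"
  by (induction xs) simp_all

lemma triple_run: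
  assumes "triple (\<lambda>s. s = \<lparr>mem = \<lambda>_. 0, inp = w, outp = []\<rparr>) P T (\<lambda>s. outp s = out)"
  shows "\<exists>t\<le>T. run P w t out"
  using tripleD[OF assms refl] unfolding run_def by blast

lemma mis_alg_run:
  fixes G :: "nat ugraph"
  assumes G: "simple_graph G"
  defines "f \<equiv> (!) (sorted_list_of_set (verts G))" and "n \<equiv> card (verts G)"
  defines "nb \<equiv> \<lambda>u. {v. u < n \<and> v < n \<and> adj G (f u) (f v)}"
  shows "bij_betw f {..<n} (verts G)"
    "\<exists>t\<le>mis_time k n. run (mis_alg k) (encode_graph G) t
      (map f (filter (\<lambda>v. v \<in> search n nb k (n ^ Suc k)) [0..<n]))"
proof -
  let ?vs = "sorted_list_of_set (verts G)"
  have fin: "finite (verts G)" using G by (simp add: simple_graph_def)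
  have len: "length ?vs = n" by (simp add: n_def)
  show "bij_betw f {..<n} (verts G)"
    unfolding f_def by (rule bij_betw_nth) (use fin len in auto)
  define bits where "bits = [if {u, v} \<in> edges G then 1 else (0::nat). u \<leftarrow> ?vs, v \<leftarrow> ?vs]"
  have bits: "bits = concat (map (\<lambda>u. map (\<lambda>v. if {u, v} \<in> edges G then 1 else 0) ?vs) ?vs)"
    by (simp add: bits_def)
  have enc: "encode_graph G = n # ?vs @ bits"
    by (simp add: encode_graph_def bits_def Let_def n_def)
  have lenb: "length bits = n * n" unfolding bits length_concat_rows len ..
  let ?M = "\<lambda>i. if i < n * n then bits ! i else 0"
  \<comment> \<open>For \<open>u \<ge> n\<close> the index lies beyond the matrix, where the array
    is 0; hence the guard \<open>u < n\<close> in \<open>nb\<close>.\<close>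
  have "nbrs n ?M = nb"
  proof
    fix u
    show "nbrs n ?M u = nb u"
    proof (cases "u < n")
      case True
      have "u * n + v < n * n \<and> bits ! (u * n + v) = (if adj G (f u) (f v) then 1 else 0)" if v: "v < n" for v
      proof
        have "u * n + v < Suc u * n" using v by simp
        also have "\<dots> \<le> n * n" using True by (intro mult_le_mono1) simp
        finally show "u * n + v < n * n" .
        show "bits ! (u * n + v) = (if adj G (f u) (f v) then 1 else 0)"
          unfolding bits using True v len by (subst nth_concat_rows) (auto simp: f_def adj_def)
      qed
      then show ?thesis using True by (auto simp: nbrs_def nb_def split: if_splits)
    next
      case False
      then have "n * n \<le> u * n" by (intro mult_le_mono1) simp
      then have "\<not> u * n + v < n * n" for v by linarith
      then show ?thesis using False by (simp add: nbrs_def nb_def)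
    qed
  qed
  with triple_run[OF triple_mis_alg[OF len lenb, of k]]
  show "\<exists>t\<le>mis_time k n. run (mis_alg k) (encode_graph G) t
      (map f (filter (\<lambda>v. v \<in> search n nb k (n ^ Suc k)) [0..<n]))"
    unfolding enc f_def by simp
qed

section \<open>Polynomial time bounds\<close>

definition poly_fun :: "(nat \<Rightarrow> nat) \<Rightarrow> bool" where
  "poly_fun f \<longleftrightarrow> (\<exists>p. \<forall>n. f n = poly p n)"

lemma poly_fun_intros:
  "poly_fun (\<lambda>n. n)" "poly_fun (\<lambda>n. c)"
  "poly_fun f \<Longrightarrow> poly_fun g \<Longrightarrow> poly_fun (\<lambda>n. f n + g n)"
  "poly_fun f \<Longrightarrow> poly_fun g \<Longrightarrow> poly_fun (\<lambda>n. f n * g n)"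
proof -
  show "poly_fun (\<lambda>n. n)" unfolding poly_fun_def by (intro exI[of _ "[:0, 1:]"]) simp
  show "poly_fun (\<lambda>n. c)" unfolding poly_fun_def by (intro exI[of _ "[:c:]"]) simp
  show "poly_fun f \<Longrightarrow> poly_fun g \<Longrightarrow> poly_fun (\<lambda>n. f n + g n)"
    unfolding poly_fun_def by (metis poly_add)
  show "poly_fun f \<Longrightarrow> poly_fun g \<Longrightarrow> poly_fun (\<lambda>n. f n * g n)"
    unfolding poly_fun_def by (metis poly_mult)
qed

lemma poly_fun_power: "poly_fun f \<Longrightarrow> poly_fun (\<lambda>n. f n ^ k)"
  by (induction k) (auto intro: poly_fun_intros)

lemma poly_fun_mis_time: "poly_fun (mis_time k)"
  unfolding mis_time_def[abs_def] round_time_def by (intro poly_fun_intros poly_fun_power)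

lemma poly_nat_mono:
  fixes p :: "nat poly"
  assumes "m \<le> n"
  shows "poly p m \<le> poly p n"
proof (induction p)
  case (pCons a p)
  then show ?case using assms by (simp add: mult_le_mono)
qed simp

lemma length_le_bit_size: "length w \<le> bit_size w"
  by (induction w) (simp_all add: bit_size_def)

lemma polytime_mis_alg: "polytime_on_graphs (mis_alg k)"
proof -
  obtain p where p: "\<And>n. mis_time k n = poly p n"
    using poly_fun_mis_time[of k] unfolding poly_fun_def by blast
  show ?thesis unfolding polytime_on_graphs_def
  proof (intro exI[of _ p] allI impI)
    fix G :: "nat ugraph" assume G: "simple_graph G"
    obtain t out where run: "t \<le> mis_time k (card (verts G))" "run (mis_alg k) (encode_graph G) t out"
      using mis_alg_run(2)[OF G] by blast
    have "card (verts G) \<le> length (encode_graph G)"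
      by (simp add: encode_graph_def Let_def)
    also have "\<dots> \<le> bit_size (encode_graph G)" by (rule length_le_bit_size)
    finally have "mis_time k (card (verts G)) \<le> poly p (bit_size (encode_graph G))"
      unfolding p by (rule poly_nat_mono)
    with run show "\<exists>t out. run (mis_alg k) (encode_graph G) t out \<and>
        t \<le> poly p (bit_size (encode_graph G))"
      by (meson order_trans)
  qed
qed

text \<open>The program works on indices, the optimality argument on vertices; the bijection
  \<open>f\<close> carries exchanges, neighbourhoods and cardinalities over.\<close>

lemma mis_alg_near_optimal:
  fixes G :: "nat ugraph" and h q :: nat
  assumes G: "simple_graph G" and q: "1 \<le> q" and no_model: "\<not> clique_model (adj G) h (verts G)"
  shows "\<exists>t out. run (mis_alg (25600 * h ^ 4 * q\<^sup>2)) (encode_graph G) t out \<and>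
    independent_set G (set out) \<and>
    (\<forall>R. independent_set G R \<longrightarrow> (1 - 1 / real q) * card R \<le> card (set out))"
proof -
  define k where "k = 25600 * h ^ 4 * q\<^sup>2"
  define f where "f = (!) (sorted_list_of_set (verts G))"
  define n where "n = card (verts G)"
  define nb where "nb u = {v. u < n \<and> v < n \<and> adj G (f u) (f v)}" for u
  define X where "X = {v. v < n \<and> v \<in> search n nb k (n ^ Suc k)}"
  have bij: "bij_betw f {..<n} (verts G)"
    using mis_alg_run(1)[OF G] by (simp add: f_def n_def)
  have inj: "inj_on f {..<n}" and img: "f ` {..<n} = verts G"
    using bij by (simp_all add: bij_betw_def)
  have fin: "finite (verts G)" using G by (simp add: simple_graph_def)
  obtain t where run: "run (mis_alg k) (encode_graph G) t
      (map f (filter (\<lambda>v. v \<in> search n nb k (n ^ Suc k)) [0..<n]))"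
    using mis_alg_run(2)[OF G, of k] unfolding f_def n_def nb_def[abs_def] by blast
  have out: "set (map f (filter (\<lambda>v. v \<in> search n nb k (n ^ Suc k)) [0..<n])) = f ` X"
    by (auto simp: X_def)
  have Xsub: "X \<subseteq> {..<n}" by (auto simp: X_def)
  have sym: "u \<in> nb v" if "v \<in> nb u" for u v using that adj_sym by (auto simp: nb_def)
  have irr: "u \<notin> nb u" for u using adj_simple(1)[OF G] by (auto simp: nb_def)
  have indep: "v \<notin> nb u" if "u \<in> X" "v \<in> X" for u v
    using search_independent[of nb u n k "n ^ Suc k" v] sym irr that by (auto simp: X_def)
  have ind: "independent_set G (f ` X)"
    unfolding independent_set_def
  proof (intro conjI ballI)
    show "f ` X \<subseteq> verts G" using Xsub img by blast
    fix x y assume "x \<in> f ` X" "y \<in> f ` X"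
    then obtain u v where "u \<in> X" "v \<in> X" "x = f u" "y = f v" by blast
    with indep[of u v] Xsub show "{x, y} \<notin> edges G" by (auto simp: nb_def adj_def)
  qed
  have near: "(1 - 1 / real q) * card R \<le> card (f ` X)" if R: "independent_set G R" for R
  proof (rule locally_optimal_is_near_optimal[OF symp_adj q fin _ _ no_model])
    show "f ` X \<subseteq> verts G" using ind by (simp add: independent_set_def)
    show "R \<subseteq> verts G" using R by (simp add: independent_set_def)
    show "\<not> adj G u v" if "u \<in> R" "v \<in> R" for u v
      using R that by (simp add: independent_set_def adj_def)
    fix T assume T: "T \<subseteq> verts G" "T \<noteq> {}" "card T \<le> 25600 * h ^ 4 * q\<^sup>2"
      "\<forall>u\<in>T. \<forall>v\<in>T. \<not> adj G u v"
    define T' where "T' = {i. i < n \<and> f i \<in> T}"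
    have T': "T' \<subseteq> {..<n}" "f ` T' = T" using T(1) img by (auto simp: T'_def)
    have "T' \<noteq> {}" using T(2) T'(2) by auto
    then have n: "0 < n" using T'(1) by auto
    have cT: "card T' = card T" using card_image[OF inj_on_subset[OF inj T'(1)]] T'(2) by simp
    have X: "X = search n nb k (n ^ Suc k)" using search_subset[OF n] by (auto simp: X_def)
    have swap: "card (T' \<union> (X - (\<Union>u\<in>T'. nb u))) \<le> card X"
      unfolding X
    proof (rule locally_optimal_swap[OF search_locally_optimal[OF n] T'(1) \<open>T' \<noteq> {}\<close>])
      show "card T' \<le> k" using cT T(3) by (simp add: k_def)
      show "v \<notin> nb u" if "u \<in> T'" "v \<in> T'" for u v using T(4) that by (auto simp: nb_def T'_def)
    qed
    have "f ` (T' \<union> (X - (\<Union>u\<in>T'. nb u))) = T \<union> (f ` X - {v. \<exists>u\<in>T. adj G u v})"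
    proof -
      have "f v \<in> {v. \<exists>u\<in>T. adj G u v} \<longleftrightarrow> v \<in> (\<Union>u\<in>T'. nb u)" if v: "v < n" for v
        using T' v unfolding nb_def by auto
      then have "f ` (X - (\<Union>u\<in>T'. nb u)) = f ` X - {v. \<exists>u\<in>T. adj G u v}"
        using Xsub by blast
      then show ?thesis using T'(2) by (simp add: image_Un)
    qed
    moreover have "T' \<union> (X - (\<Union>u\<in>T'. nb u)) \<subseteq> {..<n}" using T'(1) Xsub by blast
    ultimately have "card (T \<union> (f ` X - {v. \<exists>u\<in>T. adj G u v})) = card (T' \<union> (X - (\<Union>u\<in>T'. nb u)))"
      using card_image inj_on_subset[OF inj] by metis
    also have "\<dots> \<le> card (f ` X)" using swap card_image[OF inj_on_subset[OF inj Xsub]] by simp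
    finally show "card (T \<union> (f ` X - {v. \<exists>u\<in>T. adj G u v})) \<le> card (f ` X)" .
  qed
  from run ind near show ?thesis unfolding k_def[symmetric] out[symmetric] by blast
qed

lemma eps_closeI:
  fixes \<epsilon> :: rat and q :: nat
  assumes fin: "finite (verts G)" and X: "independent_set G X" and q: "1 \<le> q" "1 / of_nat q \<le> \<epsilon>"
    and near: "\<And>R. independent_set G R \<Longrightarrow> (1 - 1 / real q) * card R \<le> card X"
  shows "eps_close \<epsilon> G X"
proof -
  let ?I = "{X. independent_set G X}"
  have finI: "finite ?I"
    by (rule finite_subset[of _ "Pow (verts G)"]) (use fin in \<open>auto simp: independent_set_def\<close>)
  have "mis_opt G \<in> card ` ?I"
    unfolding mis_opt_def by (rule Max_in) (use finI X in auto)
  then obtain R where R: "independent_set G R" "mis_opt G = card R" by auto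
  have le: "card X \<le> mis_opt G"
    unfolding mis_opt_def by (rule Max_ge) (use finI X in auto)
  have \<epsilon>: "0 \<le> \<epsilon>" using q by (meson of_nat_0_le_iff order_trans zero_le_divide_1_iff)
  \<comment> \<open>The guarantee is over the reals because of the square roots, whereas
    \<open>eps_close\<close> is over the rationals; clearing denominators leads from one to the
    other through natural numbers.\<close>
  have "real q * card R - card R \<le> real q * card X"
    using mult_left_mono[OF near[OF R(1)], of "real q"] q(1) by (simp add: algebra_simps)
  then have "real (q * card R) \<le> real (q * card X + card R)" by simp
  then have "q * card R \<le> q * card X + card R" by (simp only: of_nat_le_iff)
  then have "(of_nat (q * card R) :: rat) \<le> of_nat (q * card X + card R)" by (simp only: of_nat_le_iff)
  then have "(1 - 1 / of_nat q) * (of_nat (card R) :: rat) \<le> of_nat (card X)"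
    using q(1) by (simp add: field_simps)
  moreover have "(1 - \<epsilon>) * of_nat (card R) \<le> (1 - 1 / of_nat q) * of_nat (card R)"
    using q(2) by (intro mult_right_mono) auto
  ultimately have "(1 - \<epsilon>) * of_nat (mis_opt G) \<le> of_nat (card X)" using R(2) by simp
  moreover have "of_nat (card X) \<le> (1 + \<epsilon>) * of_nat (mis_opt G)"
  proof -
    have "(of_nat (card X) :: rat) \<le> 1 * of_nat (mis_opt G)" using le by simp
    also have "\<dots> \<le> (1 + \<epsilon>) * of_nat (mis_opt G)" using \<epsilon> by (intro mult_right_mono) auto
    finally show ?thesis .
  qed
  ultimately show ?thesis using X by (simp add: eps_close_def)
qed

section \<open>Computing the program from the accuracy\<close>

definition write_list :: "nat list \<Rightarrow> prog" where
  "write_list ws = foldr (\<lambda>w P. Seq (Seq (Const 20 w) (Write 20)) P) ws Skip"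

lemma loop_free_write_list: "loop_free (write_list ws)"
  by (induction ws) (simp_all add: write_list_def)

lemma sem_write_list:
  "outp (sem (write_list ws) s) = outp s @ ws \<and> mem (sem (write_list ws) s) 8 = mem s 8"
  by (induction ws arbitrary: s) (simp_all add: write_list_def)

text \<open>The second \<open>Read 10\<close> overwrites the numerator: as
  \<open>1 / q \<le> p / q\<close>, accuracy \<open>1 / q\<close> suffices. The prefix
  \<open>8, 1, 3\<close> is the code of \<open>Seq (Const 3 _) _\<close> up to the constant, which
  waits in register 8, untouched by \<open>write_list\<close>. The factor \<open>c\<close> depends
  on the excluded minor only and is hard-wired.\<close>

definition uniform_prog :: "nat \<Rightarrow> prog" where
  "uniform_prog c = Seq (Seq (Const 1 1) (Seq (Read 10) (Read 10))) (Seq (mul_prog 10 10)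
     (Seq (Seq (Add 10 8 0) (Const 11 c)) (Seq (mul_prog 11 10)
       (Seq (write_list [8, 1, 3]) (Seq (Write 8) (write_list (encode_prog mis_prog)))))))"

lemma uniform_prog_run:
  "\<exists>t. run (uniform_prog c) [p, q] t (encode_prog (mis_alg (c * q\<^sup>2)))"
proof -
  let ?P = "\<lambda>s. mem s 0 = 0 \<and> mem s 1 = 1 \<and> outp s = []"
  have 1: "triple (\<lambda>s. s = \<lparr>mem = \<lambda>_. 0, inp = [p, q], outp = []\<rparr>) (Seq (Const 1 1) (Seq (Read 10) (Read 10))) 3
    (\<lambda>s. ?P s \<and> mem s 10 = q \<and> mem s 10 = q)"
    by (rule triple_loop_free) auto
  have 2: "triple (\<lambda>s. ?P s \<and> mem s 10 = q \<and> mem s 10 = q) (mul_prog 10 10) (q * 4 + 4)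
    (\<lambda>s. ?P s \<and> mem s 8 = q * q)"
    by (rule triple_mul_prog) auto
  have 3: "triple (\<lambda>s. ?P s \<and> mem s 8 = q * q) (Seq (Add 10 8 0) (Const 11 c)) 2
    (\<lambda>s. ?P s \<and> mem s 11 = c \<and> mem s 10 = q * q)"
    by (rule triple_loop_free) auto
  have 4: "triple (\<lambda>s. ?P s \<and> mem s 11 = c \<and> mem s 10 = q * q) (mul_prog 11 10) (c * 4 + 4)
    (\<lambda>s. ?P s \<and> mem s 8 = c * (q * q))"
    by (rule triple_mul_prog) auto
  let ?W = "Seq (write_list [8, 1, 3]) (Seq (Write 8) (write_list (encode_prog mis_prog)))"
  have 5: "triple (\<lambda>s. ?P s \<and> mem s 8 = c * (q * q)) ?W (cost ?W)
    (\<lambda>s. outp s = encode_prog (mis_alg (c * q\<^sup>2)))"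
    by (rule triple_loop_free)
      (simp_all add: loop_free_write_list sem_write_list mis_alg_def power2_eq_square)
  have "triple (\<lambda>s. s = \<lparr>mem = \<lambda>_. 0, inp = [p, q], outp = []\<rparr>) (uniform_prog c)
      (3 + (q * 4 + 4 + (2 + (c * 4 + 4 + cost ?W))))
      (\<lambda>s. outp s = encode_prog (mis_alg (c * q\<^sup>2)))"
    unfolding uniform_prog_def
    by (intro triple_Seq[OF 1] triple_Seq[OF 2] triple_Seq[OF 3] triple_Seq[OF 4] 5)
  from triple_run[OF this] show ?thesis by blast
qed

theorem theorem5p6:
  fixes C :: "nat ugraph set"
  assumes "\<forall>G\<in>C. simple_graph G"
    and "has_excluded_minor C"
  shows "mis_has_PTAS C"
proof -
  obtain H :: "nat ugraph" where H: "simple_graph H" "\<And>G. G \<in> C \<Longrightarrow> \<not> H \<preceq>\<^sub>m G"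
    using assms(2) unfolding has_excluded_minor_def by blast
  define h where "h = card (verts H)"
  define denom where "denom \<epsilon> = nat (snd (quotient_of \<epsilon>))" for \<epsilon> :: rat
  define A where "A \<epsilon> = mis_alg (25600 * h ^ 4 * (denom \<epsilon>)\<^sup>2)" for \<epsilon>
  have denom: "1 \<le> denom \<epsilon>" "1 / of_nat (denom \<epsilon>) \<le> \<epsilon>" if \<epsilon>: "0 < \<epsilon>" for \<epsilon>
  proof -
    obtain p q where pq: "quotient_of \<epsilon> = (p, q)" by (cases "quotient_of \<epsilon>")
    have q: "0 < q" using quotient_of_denom_pos[OF pq] .
    have eq: "\<epsilon> = of_int p / of_int q" using quotient_of_div[OF pq] .
    then have "0 < p" using \<epsilon> q by (simp add: zero_less_divide_iff)
    have "denom \<epsilon> = nat q" by (simp add: denom_def pq)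
    then show "1 \<le> denom \<epsilon>" "1 / of_nat (denom \<epsilon>) \<le> \<epsilon>"
      using q \<open>0 < p\<close> unfolding eq by (simp_all add: divide_right_mono)
  qed
  have "computes_eps_close (A \<epsilon>) \<epsilon> G" if \<epsilon>: "0 < \<epsilon>" and G: "G \<in> C" for \<epsilon> G
  proof -
    have simple: "simple_graph G" using assms(1) G by blast
    have "\<not> clique_model (adj G) h (verts G)"
      using minor_of_clique_model[OF simple H(1)] H(2)[OF G] unfolding h_def by blast
    from mis_alg_near_optimal[OF simple denom(1)[OF \<epsilon>] this]
    obtain t out where "run (A \<epsilon>) (encode_graph G) t out" "independent_set G (set out)"
      "\<And>R. independent_set G R \<Longrightarrow> (1 - 1 / real (denom \<epsilon>)) * card R \<le> card (set out)"
      unfolding A_def by blast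
    moreover have "finite (verts G)" using simple by (simp add: simple_graph_def)
    ultimately show ?thesis
      unfolding computes_eps_close_def using eps_closeI[of G _ "denom \<epsilon>" \<epsilon>] denom[OF \<epsilon>] by blast
  qed
  moreover have "\<exists>t. run (uniform_prog (25600 * h ^ 4)) (encode_rat \<epsilon>) t (encode_prog (A \<epsilon>))" for \<epsilon>
    using uniform_prog_run[of "25600 * h ^ 4"]
    by (cases "quotient_of \<epsilon>") (simp add: encode_rat_def A_def denom_def)
  moreover have "polytime_on_graphs (A \<epsilon>)" for \<epsilon>
    unfolding A_def by (rule polytime_mis_alg)
  ultimately have "is_mis_PTAS A C"
    unfolding is_mis_PTAS_def by blast
  then show ?thesis unfolding mis_has_PTAS_def by blast
qed

end
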